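(* Suppose $E\subset D\times[0,1]$ is a compact connected evasion region such that $\pi=\pi_2|_E:E\to[0,1]$ is surjective, i.e. at each point in time there is somewhere an intruder can evade detection. Then the Remak decomposition of $\pi_*\hat k_E$ must have a barcode that stretches the length of $[0,1]$ (i.e. an indecomposable summand whose support is all of $[0,1]$).
   Context: $k$ is a field. $D$ is a spatial region and $\pi_2:D\times[0,1]\to[0,1]$ is the time projection. A subset $S\subset D\times[0,1]$ is the region covered by sensors, and the evasion region is its complement $E=S^c$. It is assumed that $E$ is a finite union of cells of a cell structure on $D\times[0,1]$, and that $\pi:E\to[0,1]$ is a cellular map for some finite cell structure on $[0,1]$ by vertices and open intervals (each cell is mapped onto a cell by a map that looks like a coordinate projection $\mathbb R^{n+m}\to\mathbb R^n$). A cellular cosheaf on a cell complex $Z$ is a contravariant functor from the face poset (arrow $\sigma\le\tau$ when $\sigma$ is a face of $\tau$) to vector spaces. $\hat k_E$ is the constant cosheaf with value $k$ on $E$ (identity extension maps). Its pushforward is $\pi_*\hat k_E(\tau)=\varinjlim_{\sigma:\ \pi(\sigma)\ge\tau}\hat k_E(\sigma)$, a cellular cosheaf on $[0,1]$. Its Remak decomposition is its decomposition into indecomposable cosheaves. Over $[0,1]$ each indecomposable is a constant cosheaf with value $k$ supported on a connected union of cells (an interval, or "barcode") and zero elsewhere. *)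

theory Defs
  imports "HOL-Analysis.Analysis" "HOL-Algebra.AbelCoset" "HOL-Algebra.Module"
begin

section \<open>Cell structures and cellular maps\<close>

text \<open>Cells are represented by the underlying point sets, so that a cell complex is a
  partition of a space, and \<open>face \<sigma> \<tau>\<close> is the relation \<open>\<sigma> \<le> \<tau>\<close> of the face poset.
  For cells lying in a space \<open>X\<close>, inclusion in the closure taken in the ambient type and
  inclusion in the closure relative to \<open>X\<close> are the same condition.\<close>

definition face :: "'a::topological_space set \<Rightarrow> 'a set \<Rightarrow> bool" where
  "face \<sigma> \<tau> \<longleftrightarrow> \<sigma> \<subseteq> closure \<tau>"

text \<open>A locally finite partition into open cells satisfying the axiom of the frontier.
  Nothing is required of the closed cells (they need not be balls, nor even compact), so
  regular cell complexes, and spaces obtained from these by removing a vertex at infinity,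
  are all included.\<close>

definition cell_structure :: "'a::topological_space set \<Rightarrow> 'a set set \<Rightarrow> bool" where
  "cell_structure X C \<longleftrightarrow>
     partition_on X C \<and>
     (\<forall>x\<in>X. \<exists>U. open U \<and> x \<in> U \<and> finite {\<sigma> \<in> C. \<sigma> \<inter> U \<noteq> {}}) \<and>
     (\<forall>\<sigma>\<in>C. \<exists>n. top_of_set \<sigma> homeomorphic_space Euclidean_space n) \<and>
     (\<forall>\<sigma>\<in>C. \<forall>\<tau>\<in>C. \<sigma> \<inter> closure \<tau> \<noteq> {} \<longrightarrow> face \<sigma> \<tau>)"

definition interval_cell_structure :: "real set set \<Rightarrow> bool" where
  "interval_cell_structure T \<longleftrightarrow>
     finite T \<and> cell_structure {0..1} T \<and>
     (\<forall>\<tau>\<in>T. (\<exists>t. \<tau> = {t}) \<or> (\<exists>a b. a < b \<and> \<tau> = {a<..<b}))"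

text \<open>In the coordinates \<open>h\<close>, \<open>g\<close> the restriction of \<open>f\<close> to a cell is the projection
  of \<open>\<real>\<^sup>n\<^sup>+\<^sup>m\<close> onto the first \<open>n\<close> coordinates; points of \<open>Euclidean_space n\<close> are sequences
  vanishing from index \<open>n\<close> on.\<close>

definition cellular_map ::
  "'a::topological_space set set \<Rightarrow> 'b::topological_space set set \<Rightarrow> ('a \<Rightarrow> 'b) \<Rightarrow> bool" where
  "cellular_map K L f \<longleftrightarrow>
     continuous_on (\<Union>K) f \<and>
     (\<forall>\<sigma>\<in>K. f ` \<sigma> \<in> L \<and>
       (\<exists>n m h g.
          homeomorphic_map (top_of_set \<sigma>) (Euclidean_space (n + m)) h \<and>
          homeomorphic_map (top_of_set (f ` \<sigma>)) (Euclidean_space n) g \<and>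
          (\<forall>x\<in>\<sigma>. g (f x) = (\<lambda>i. if i < n then h x i else 0))))"

definition evasion_region :: "'a set \<Rightarrow> ('a \<times> real) set \<Rightarrow> ('a \<times> real) set" where
  "evasion_region D S = D \<times> {0..1} - S"


section \<open>Vector spaces\<close>

text \<open>A vector space over a field \<open>R\<close> is a \<open>module\<close> over \<open>R\<close>. The module record extends
  the ring record; its fields \<open>mult\<close> and \<open>one\<close> play no role for modules and are left
  undefined.\<close>

definition regular_module :: "('k, 'm) ring_scheme \<Rightarrow> ('k, 'k) module" where
  "regular_module R =
     \<lparr>carrier = carrier R, monoid.mult = undefined, one = undefined,
      zero = \<zero>\<^bsub>R\<^esub>, add = (\<oplus>\<^bsub>R\<^esub>), smult = (\<otimes>\<^bsub>R\<^esub>)\<rparr>"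

definition zero_module :: "'v \<Rightarrow> ('k, 'v) module" where
  "zero_module z =
     \<lparr>carrier = {z}, monoid.mult = undefined, one = undefined,
      zero = z, add = (\<lambda>_ _. z), smult = (\<lambda>_ _. z)\<rparr>"

definition linear_maps ::
  "('k, 'm) ring_scheme \<Rightarrow> ('k, 'v) module \<Rightarrow> ('k, 'w) module \<Rightarrow> ('v \<Rightarrow> 'w) set" where
  "linear_maps R M N =
     {h \<in> carrier M \<rightarrow> carrier N.
        (\<forall>x\<in>carrier M. \<forall>y\<in>carrier M. h (x \<oplus>\<^bsub>M\<^esub> y) = h x \<oplus>\<^bsub>N\<^esub> h y) \<and>
        (\<forall>a\<in>carrier R. \<forall>x\<in>carrier M. h (a \<odot>\<^bsub>M\<^esub> x) = a \<odot>\<^bsub>N\<^esub> h x)}"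

definition direct_sum :: "'i set \<Rightarrow> ('i \<Rightarrow> ('k, 'v) module) \<Rightarrow> ('k, 'i \<Rightarrow> 'v) module" where
  "direct_sum I M =
     \<lparr>carrier = {x \<in> \<Pi>\<^sub>E i\<in>I. carrier (M i). finite {i \<in> I. x i \<noteq> \<zero>\<^bsub>M i\<^esub>}},
      monoid.mult = undefined, one = undefined,
      zero = (\<lambda>i\<in>I. \<zero>\<^bsub>M i\<^esub>),
      add = (\<lambda>x y. \<lambda>i\<in>I. x i \<oplus>\<^bsub>M i\<^esub> y i),
      smult = (\<lambda>a x. \<lambda>i\<in>I. a \<odot>\<^bsub>M i\<^esub> x i)\<rparr>"

definition direct_sum_inj :: "'i set \<Rightarrow> ('i \<Rightarrow> ('k, 'v) module) \<Rightarrow> 'i \<Rightarrow> 'v \<Rightarrow> 'i \<Rightarrow> 'v" where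
  "direct_sum_inj I M i v = (\<lambda>j\<in>I. if j = i then v else \<zero>\<^bsub>M j\<^esub>)"

definition submodule_span ::
  "('k, 'm) ring_scheme \<Rightarrow> ('k, 'v) module \<Rightarrow> 'v set \<Rightarrow> 'v set" where
  "submodule_span R M A = \<Inter>{N. submodule N R M \<and> A \<subseteq> N}"

definition quotient_module :: "('k, 'v) module \<Rightarrow> 'v set \<Rightarrow> ('k, 'v set) module" where
  "quotient_module M N =
     \<lparr>carrier = a_rcosets\<^bsub>M\<^esub> N, monoid.mult = undefined, one = undefined,
      zero = N, add = set_add M, smult = (\<lambda>a X. \<Union>x\<in>X. N +>\<^bsub>M\<^esub> (a \<odot>\<^bsub>M\<^esub> x))\<rparr>"


section \<open>Cellular cosheaves\<close>

text \<open>\<open>ext_map F \<tau> \<sigma>\<close> is the map from the stalk at \<open>\<tau>\<close> to the stalk at its face \<open>\<sigma>\<close>.\<close>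

record ('c, 'k, 'v) cosheaf =
  stalk :: "'c \<Rightarrow> ('k, 'v) module"
  ext_map :: "'c \<Rightarrow> 'c \<Rightarrow> 'v \<Rightarrow> 'v"

definition cellular_cosheaf ::
  "('k, 'm) ring_scheme \<Rightarrow> 'a::topological_space set set \<Rightarrow> ('a set, 'k, 'v) cosheaf \<Rightarrow> bool" where
  "cellular_cosheaf R Z F \<longleftrightarrow>
     (\<forall>\<sigma>\<in>Z. Module.module R (stalk F \<sigma>)) \<and>
     (\<forall>\<sigma>\<in>Z. \<forall>\<tau>\<in>Z. face \<sigma> \<tau> \<longrightarrow> ext_map F \<tau> \<sigma> \<in> linear_maps R (stalk F \<tau>) (stalk F \<sigma>)) \<and>
     (\<forall>\<sigma>\<in>Z. \<forall>x\<in>carrier (stalk F \<sigma>). ext_map F \<sigma> \<sigma> x = x) \<and>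
     (\<forall>\<rho>\<in>Z. \<forall>\<sigma>\<in>Z. \<forall>\<tau>\<in>Z. face \<rho> \<sigma> \<longrightarrow> face \<sigma> \<tau> \<longrightarrow>
        (\<forall>x\<in>carrier (stalk F \<tau>). ext_map F \<sigma> \<rho> (ext_map F \<tau> \<sigma> x) = ext_map F \<tau> \<rho> x))"

definition cosheaf_iso ::
  "('k, 'm) ring_scheme \<Rightarrow> 'a::topological_space set set \<Rightarrow>
   ('a set, 'k, 'v) cosheaf \<Rightarrow> ('a set, 'k, 'w) cosheaf \<Rightarrow> bool" where
  "cosheaf_iso R Z F G \<longleftrightarrow>
     (\<exists>\<phi>. (\<forall>\<sigma>\<in>Z. \<phi> \<sigma> \<in> linear_maps R (stalk F \<sigma>) (stalk G \<sigma>) \<and>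
                   bij_betw (\<phi> \<sigma>) (carrier (stalk F \<sigma>)) (carrier (stalk G \<sigma>))) \<and>
          (\<forall>\<sigma>\<in>Z. \<forall>\<tau>\<in>Z. face \<sigma> \<tau> \<longrightarrow>
             (\<forall>x\<in>carrier (stalk F \<tau>). \<phi> \<sigma> (ext_map F \<tau> \<sigma> x) = ext_map G \<tau> \<sigma> (\<phi> \<tau> x))))"

definition cosheaf_sum :: "'i set \<Rightarrow> ('i \<Rightarrow> ('c, 'k, 'v) cosheaf) \<Rightarrow> ('c, 'k, 'i \<Rightarrow> 'v) cosheaf" where
  "cosheaf_sum I G =
     \<lparr>stalk = (\<lambda>\<sigma>. direct_sum I (\<lambda>i. stalk (G i) \<sigma>)),
      ext_map = (\<lambda>\<tau> \<sigma> x. \<lambda>i\<in>I. ext_map (G i) \<tau> \<sigma> (x i))\<rparr>"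

text \<open>The constant cosheaf with value \<open>R\<close> on the cells in \<open>J\<close>, extended by zero to all
  other cells.\<close>

definition constant_cosheaf :: "('k, 'm) ring_scheme \<Rightarrow> 'c set \<Rightarrow> ('c, 'k, 'k) cosheaf" where
  "constant_cosheaf R J =
     \<lparr>stalk = (\<lambda>\<sigma>. if \<sigma> \<in> J then regular_module R else zero_module \<zero>\<^bsub>R\<^esub>),
      ext_map = (\<lambda>\<tau> \<sigma> x. if \<tau> \<in> J \<and> \<sigma> \<in> J then x else \<zero>\<^bsub>R\<^esub>)\<rparr>"


section \<open>Colimits and pushforward\<close>

text \<open>The colimit of the restriction of \<open>F\<close> to a set \<open>I\<close> of cells is the cokernel
  presentation: the direct sum of the stalks modulo the span of all
  \<open>\<iota>\<^sub>\<tau> v - \<iota>\<^sub>\<sigma> (F(\<sigma> \<le> \<tau>) v)\<close>.\<close>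

definition colimit_relations ::
  "('k, 'm) ring_scheme \<Rightarrow> 'a::topological_space set set \<Rightarrow> ('a set, 'k, 'v) cosheaf \<Rightarrow>
   ('a set \<Rightarrow> 'v) set" where
  "colimit_relations R I F =
     submodule_span R (direct_sum I (stalk F))
       {direct_sum_inj I (stalk F) \<tau> v \<ominus>\<^bsub>direct_sum I (stalk F)\<^esub>
          direct_sum_inj I (stalk F) \<sigma> (ext_map F \<tau> \<sigma> v) | \<sigma> \<tau> v.
        \<sigma> \<in> I \<and> \<tau> \<in> I \<and> face \<sigma> \<tau> \<and> v \<in> carrier (stalk F \<tau>)}"

definition cosheaf_colimit ::
  "('k, 'm) ring_scheme \<Rightarrow> 'a::topological_space set set \<Rightarrow> ('a set, 'k, 'v) cosheaf \<Rightarrow>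
   ('k, ('a set \<Rightarrow> 'v) set) module" where
  "cosheaf_colimit R I F = quotient_module (direct_sum I (stalk F)) (colimit_relations R I F)"

text \<open>The map of colimits induced by an inclusion \<open>I \<subseteq> J\<close> of index sets: the class of \<open>x\<close>
  goes to the class of \<open>x\<close> extended by zero.\<close>

definition colimit_map ::
  "('k, 'm) ring_scheme \<Rightarrow> 'a::topological_space set set \<Rightarrow> 'a set set \<Rightarrow>
   ('a set, 'k, 'v) cosheaf \<Rightarrow> ('a set \<Rightarrow> 'v) set \<Rightarrow> ('a set \<Rightarrow> 'v) set" where
  "colimit_map R I J F X =
     (\<Union>x\<in>X. colimit_relations R J F +>\<^bsub>direct_sum J (stalk F)\<^esub>
              (\<lambda>\<sigma>\<in>J. if \<sigma> \<in> I then x \<sigma> else \<zero>\<^bsub>stalk F \<sigma>\<^esub>))"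

definition cells_over ::
  "('a \<Rightarrow> 'b::topological_space) \<Rightarrow> 'a set set \<Rightarrow> 'b set \<Rightarrow> 'a set set" where
  "cells_over f K \<tau> = {\<sigma> \<in> K. face \<tau> (f ` \<sigma>)}"

definition pushforward ::
  "('k, 'm) ring_scheme \<Rightarrow> ('a::topological_space \<Rightarrow> 'b::topological_space) \<Rightarrow> 'a set set \<Rightarrow>
   ('a set, 'k, 'v) cosheaf \<Rightarrow> ('b set, 'k, ('a set \<Rightarrow> 'v) set) cosheaf" where
  "pushforward R f K F =
     \<lparr>stalk = (\<lambda>\<tau>. cosheaf_colimit R (cells_over f K \<tau>) F),
      ext_map = (\<lambda>\<tau> \<rho>. colimit_map R (cells_over f K \<tau>) (cells_over f K \<rho>) F)\<rparr>"


section \<open>Remak decompositions and barcodes\<close>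

definition zero_cosheaf :: "'c set \<Rightarrow> ('c, 'k, 'v) cosheaf \<Rightarrow> bool" where
  "zero_cosheaf Z F \<longleftrightarrow> (\<forall>\<sigma>\<in>Z. carrier (stalk F \<sigma>) = {\<zero>\<^bsub>stalk F \<sigma>\<^esub>})"

text \<open>It is no restriction that the summands have stalks in the same type as \<open>F\<close>: every
  direct summand of \<open>F\<close> is isomorphic to a subcosheaf of \<open>F\<close>.\<close>

definition indecomposable ::
  "('k, 'm) ring_scheme \<Rightarrow> 'a::topological_space set set \<Rightarrow> ('a set, 'k, 'v) cosheaf \<Rightarrow> bool" where
  "indecomposable R Z F \<longleftrightarrow>
     cellular_cosheaf R Z F \<and> \<not> zero_cosheaf Z F \<and>
     (\<forall>G :: bool \<Rightarrow> ('a set, 'k, 'v) cosheaf.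
        (\<forall>b. cellular_cosheaf R Z (G b)) \<and> cosheaf_iso R Z F (cosheaf_sum UNIV G) \<longrightarrow>
        (\<exists>b. zero_cosheaf Z (G b)))"

definition remak_decomposition ::
  "('k, 'm) ring_scheme \<Rightarrow> 'a::topological_space set set \<Rightarrow> ('a set, 'k, 'v) cosheaf \<Rightarrow>
   nat \<Rightarrow> (nat \<Rightarrow> ('a set, 'k, 'w) cosheaf) \<Rightarrow> bool" where
  "remak_decomposition R Z F n G \<longleftrightarrow>
     (\<forall>i<n. indecomposable R Z (G i)) \<and> cosheaf_iso R Z F (cosheaf_sum {..<n} G)"

definition cosheaf_support :: "'a set set \<Rightarrow> ('a set, 'k, 'v) cosheaf \<Rightarrow> 'a set" where
  "cosheaf_support Z F = \<Union>{\<sigma> \<in> Z. carrier (stalk F \<sigma>) \<noteq> {\<zero>\<^bsub>stalk F \<sigma>\<^esub>}}"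

definition is_barcode ::
  "('k, 'm) ring_scheme \<Rightarrow> real set set \<Rightarrow> (real set, 'k, 'v) cosheaf \<Rightarrow> bool" where
  "is_barcode R T F \<longleftrightarrow>
     (\<exists>J\<subseteq>T. J \<noteq> {} \<and> connected (\<Union>J) \<and> cosheaf_iso R T F (constant_cosheaf R J))"

end

(* The pushforward F has an augmentation e: F -> k_T to the constant cosheaf, adding up the
   coefficients of the classes of cells. Since E is connected and meets both ends of [0,1], a walk
   through faces and cofaces leads from a cell over 0 to a cell over 1; counting its signed crossings
   of each cell of T gives a section s: k_T -> F with e s = 1. If F is a sum of indecomposables G_i, the
   identity of k_T is the sum of the composites k_T -> G_i -> k_T, so one of these is a nonzero scalar;
   then k_T is a direct summand of G_i, hence isomorphic to it. A Remak decomposition exists because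
   the stalks have bounded dimension, so that there is a longest decomposition into nonzero summands. *)

theory Submission
  imports Defs
begin

text \<open>A walk through E may go back in time, and E need not contain a path along which time
  increases. So a section of the pushforward cannot be found by choosing one component of E over
  each cell of [0,1]. Linear combinations of components remove this obstacle: a cell that the walk
  crosses forwards, backwards and forwards again receives [x] - [y] + [z], and such coefficients add
  up to 1 whatever the walk does between the two ends. The classes fit together because cells of E
  that are related by \<open>face\<close> and lie over \<open>\<tau>\<close> have the same class in
  the stalk at \<open>\<tau>\<close>. No classification of the indecomposables over [0,1] enters.
  The composite k_T -> G_i -> k_T is a scalar because [0,1] is connected, and a nonzero scalar is
  invertible because k is a field. Hence the argument applies to every Remak decomposition, with
  summands of any type.\<close>

section \<open>Modules\<close>

lemma linear_mapsI:
  assumes "\<And>x. x \<in> carrier M \<Longrightarrow> h x \<in> carrier N"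
    and "\<And>x y. x \<in> carrier M \<Longrightarrow> y \<in> carrier M \<Longrightarrow> h (x \<oplus>\<^bsub>M\<^esub> y) = h x \<oplus>\<^bsub>N\<^esub> h y"
    and "\<And>a x. a \<in> carrier R \<Longrightarrow> x \<in> carrier M \<Longrightarrow> h (a \<odot>\<^bsub>M\<^esub> x) = a \<odot>\<^bsub>N\<^esub> h x"
  shows "h \<in> linear_maps R M N"
  using assms by (auto simp: linear_maps_def)

lemma linear_maps_closed: "h \<in> linear_maps R M N \<Longrightarrow> x \<in> carrier M \<Longrightarrow> h x \<in> carrier N"
  and linear_maps_add: "h \<in> linear_maps R M N \<Longrightarrow> x \<in> carrier M \<Longrightarrow> y \<in> carrier M \<Longrightarrow>
    h (x \<oplus>\<^bsub>M\<^esub> y) = h x \<oplus>\<^bsub>N\<^esub> h y"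
  and linear_maps_smult: "h \<in> linear_maps R M N \<Longrightarrow> a \<in> carrier R \<Longrightarrow> x \<in> carrier M \<Longrightarrow>
    h (a \<odot>\<^bsub>M\<^esub> x) = a \<odot>\<^bsub>N\<^esub> h x"
  by (auto simp: linear_maps_def)

lemma linear_maps_comp:
  assumes "f \<in> linear_maps R L M" "g \<in> linear_maps R M N"
  shows "(\<lambda>x. g (f x)) \<in> linear_maps R L N"
  by (rule linear_mapsI)
    (use assms in \<open>simp_all add: linear_maps_closed linear_maps_add linear_maps_smult\<close>)

lemma linear_maps_inverse:
  assumes "h \<in> linear_maps R M N" "bij_betw h (carrier M) (carrier N)"
    and M: "Module.module R M"
  shows "inv_into (carrier M) h \<in> linear_maps R N M"
proof -
  interpret M: Module.module R M by fact
  let ?g = "inv_into (carrier M) h"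
  have g: "?g y \<in> carrier M" "h (?g y) = y" if "y \<in> carrier N" for y
    using assms(2) that by (metis bij_betw_imp_surj_on inv_into_into f_inv_into_f)+
  have gh: "?g (h x) = x" if "x \<in> carrier M" for x
    using assms(2) that by (meson bij_betw_inv_into_left)
  show ?thesis
  proof (rule linear_mapsI)
    show "?g (x \<oplus>\<^bsub>N\<^esub> y) = ?g x \<oplus>\<^bsub>M\<^esub> ?g y" if "x \<in> carrier N" "y \<in> carrier N" for x y
      using g[OF that(1)] g[OF that(2)] gh[of "?g x \<oplus>\<^bsub>M\<^esub> ?g y"] linear_maps_add[OF assms(1)]
      by (metis M.a_closed)
    show "?g (a \<odot>\<^bsub>N\<^esub> x) = a \<odot>\<^bsub>M\<^esub> ?g x" if "a \<in> carrier R" "x \<in> carrier N" for a x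
      using g[OF that(2)] gh[of "a \<odot>\<^bsub>M\<^esub> ?g x"] linear_maps_smult[OF assms(1)] that
      by (metis M.smult_closed)
  qed (use g in auto)
qed

lemma linear_maps_zero:
  assumes h: "h \<in> linear_maps R M N" and "Module.module R M" "Module.module R N"
  shows "h \<zero>\<^bsub>M\<^esub> = \<zero>\<^bsub>N\<^esub>"
proof -
  interpret M: Module.module R M by fact
  interpret N: Module.module R N by fact
  show ?thesis
    using linear_maps_smult[OF h M.R.zero_closed M.M.zero_closed] linear_maps_closed[OF h M.M.zero_closed]
    by simp
qed

lemma linear_maps_uminus:
  assumes h: "h \<in> linear_maps R M N" and "Module.module R M" "Module.module R N"
    and x: "x \<in> carrier M"
  shows "h (\<ominus>\<^bsub>M\<^esub> x) = \<ominus>\<^bsub>N\<^esub> h x"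
proof -
  interpret M: Module.module R M by fact
  interpret N: Module.module R N by fact
  have "h x \<oplus>\<^bsub>N\<^esub> h (\<ominus>\<^bsub>M\<^esub> x) = \<zero>\<^bsub>N\<^esub>"
    using linear_maps_add[OF h x, of "\<ominus>\<^bsub>M\<^esub> x"] linear_maps_zero[OF assms(1-3)] x
    by (simp add: M.M.r_neg)
  then show ?thesis
    using linear_maps_closed[OF h] x
    by (metis M.M.a_inv_closed N.M.minus_equality N.M.a_comm)
qed

lemma linear_maps_diff:
  assumes h: "h \<in> linear_maps R M N" and "Module.module R M" "Module.module R N"
    and x: "x \<in> carrier M" "y \<in> carrier M"
  shows "h (x \<ominus>\<^bsub>M\<^esub> y) = h x \<ominus>\<^bsub>N\<^esub> h y"
proof -
  interpret M: Module.module R M by fact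
  show ?thesis
    unfolding a_minus_def using assms by (simp add: linear_maps_add linear_maps_uminus)
qed

lemma linear_maps_finsum:
  assumes h: "h \<in> linear_maps R M N" and M: "Module.module R M" and N: "Module.module R N"
    and "finite I" "x \<in> I \<rightarrow> carrier M"
  shows "h (finsum M x I) = finsum N (\<lambda>i. h (x i)) I"
proof -
  interpret M: Module.module R M by fact
  interpret N: Module.module R N by fact
  have *: "\<And>i. i \<in> I \<Longrightarrow> h (x i) \<in> carrier N"
    using linear_maps_closed[OF h] assms(5) by auto
  show ?thesis
    using assms(4,5) *
  proof (induction I)
    case empty
    then show ?case using linear_maps_zero[OF h M N] by simp
  next
    case (insert i I)
    then have "finsum M x (insert i I) = x i \<oplus>\<^bsub>M\<^esub> finsum M x I"
      "finsum N (\<lambda>i. h (x i)) (insert i I) = h (x i) \<oplus>\<^bsub>N\<^esub> finsum N (\<lambda>i. h (x i)) I"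
      by (auto intro!: M.M.finsum_insert N.M.finsum_insert)
    moreover have "finsum M x I \<in> carrier M"
      using insert.prems by (intro M.M.finsum_closed) auto
    ultimately show ?case
      using insert linear_maps_add[OF h] by auto
  qed
qed

text \<open>\<open>linear_maps\<close> constrains a function only on the carrier. Maps on colimits
  are known only there, through representatives, and inherit linearity from a formula that is valid
  on the carrier.\<close>

lemma linear_maps_cong:
  assumes "f \<in> linear_maps R M N" "\<And>x. x \<in> carrier M \<Longrightarrow> f x = g x" "Module.module R M"
  shows "g \<in> linear_maps R M N"
proof -
  interpret M: Module.module R M by fact
  show ?thesis
    by (rule linear_mapsI)
      (use assms in \<open>auto simp flip: assms(2) simp: linear_maps_closed linear_maps_add linear_maps_smult\<close>)
qed

lemma kernel_submodule:
  assumes h: "h \<in> linear_maps R M N" and "Module.module R M" "Module.module R N"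
  shows "submodule {x \<in> carrier M. h x = \<zero>\<^bsub>N\<^esub>} R M"
proof -
  interpret M: Module.module R M by fact
  interpret N: Module.module R N by fact
  show ?thesis
    by (rule M.submoduleI)
      (use assms in \<open>auto simp: linear_maps_zero linear_maps_uminus linear_maps_add linear_maps_smult\<close>)
qed

lemma vimage_submodule:
  assumes h: "h \<in> linear_maps R M N" and M: "Module.module R M" and N: "Module.module R N"
    and A: "submodule A R N"
  shows "submodule {x \<in> carrier M. h x \<in> A} R M"
proof -
  interpret M: Module.module R M by fact
  interpret N: Module.module R N by fact
  have "\<zero>\<^bsub>N\<^esub> \<in> A"
    using N.submoduleE[OF A] N.smult_l_null by (metis M.R.zero_closed ex_in_conv subsetD)
  then show ?thesis
    by (intro M.submoduleI)
      (use N.submoduleE[OF A] in \<open>auto simp: linear_maps_zero[OF h M N] linear_maps_uminus[OF h M N]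
          linear_maps_add[OF h] linear_maps_smult[OF h]\<close>)
qed

lemma cyclic_submodule:
  assumes M: "Module.module R M" and s: "s \<in> carrier M"
  shows "submodule {a \<odot>\<^bsub>M\<^esub> s |a. a \<in> carrier R} R M"
proof -
  interpret M: Module.module R M by fact
  show ?thesis
  proof (rule M.submoduleI)
    show "\<zero>\<^bsub>M\<^esub> \<in> {a \<odot>\<^bsub>M\<^esub> s |a. a \<in> carrier R}"
      using M.smult_l_null[OF s] M.R.zero_closed by (metis (mono_tags, lifting) mem_Collect_eq)
    fix x assume "x \<in> {a \<odot>\<^bsub>M\<^esub> s |a. a \<in> carrier R}"
    then obtain a where a: "a \<in> carrier R" "x = a \<odot>\<^bsub>M\<^esub> s" by blast
    show "\<ominus>\<^bsub>M\<^esub> x \<in> {a \<odot>\<^bsub>M\<^esub> s |a. a \<in> carrier R}"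
      using a s M.smult_l_minus[of a s, symmetric] by auto
    show "r \<odot>\<^bsub>M\<^esub> x \<in> {a \<odot>\<^bsub>M\<^esub> s |a. a \<in> carrier R}" if "r \<in> carrier R" for r
      using a s that M.smult_assoc1[of r a s, symmetric] by auto
    fix y assume "y \<in> {a \<odot>\<^bsub>M\<^esub> s |a. a \<in> carrier R}"
    then obtain b where "b \<in> carrier R" "y = b \<odot>\<^bsub>M\<^esub> s" by blast
    then show "x \<oplus>\<^bsub>M\<^esub> y \<in> {a \<odot>\<^bsub>M\<^esub> s |a. a \<in> carrier R}"
      using a s M.smult_l_distr[of a b s, symmetric] by auto
  qed (use s in auto)
qed

section \<open>Scalars as a module, and direct sums with finite support\<close>

lemma regular_module_simps [simp]:
  "carrier (regular_module R) = carrier R" "\<zero>\<^bsub>regular_module R\<^esub> = \<zero>\<^bsub>R\<^esub>"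
  "x \<oplus>\<^bsub>regular_module R\<^esub> y = x \<oplus>\<^bsub>R\<^esub> y" "a \<odot>\<^bsub>regular_module R\<^esub> x = a \<otimes>\<^bsub>R\<^esub> x"
  by (auto simp: regular_module_def)

lemma regular_module_uminus [simp]: "\<ominus>\<^bsub>regular_module R\<^esub> x = \<ominus>\<^bsub>R\<^esub> x"
  by (simp add: regular_module_def a_inv_def m_inv_def)

lemma regular_module_minus [simp]: "x \<ominus>\<^bsub>regular_module R\<^esub> y = x \<ominus>\<^bsub>R\<^esub> y"
  by (simp add: a_minus_def)

lemma regular_module_module:
  assumes "cring R"
  shows "Module.module R (regular_module R)"
proof -
  interpret R: cring R by fact
  show ?thesis
    by (intro moduleI abelian_groupI \<open>cring R\<close>)
      (auto simp: R.a_ac R.l_distr R.r_distr R.m_assoc intro: R.l_neg exI[of _ "\<ominus>\<^bsub>R\<^esub> _"])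
qed

lemma direct_sum_simps:
  "x \<in> carrier (direct_sum I M) \<longleftrightarrow>
     x \<in> (\<Pi>\<^sub>E i\<in>I. carrier (M i)) \<and> finite {i \<in> I. x i \<noteq> \<zero>\<^bsub>M i\<^esub>}"
  "\<zero>\<^bsub>direct_sum I M\<^esub> = (\<lambda>i\<in>I. \<zero>\<^bsub>M i\<^esub>)"
  "x \<oplus>\<^bsub>direct_sum I M\<^esub> y = (\<lambda>i\<in>I. x i \<oplus>\<^bsub>M i\<^esub> y i)"
  "a \<odot>\<^bsub>direct_sum I M\<^esub> x = (\<lambda>i\<in>I. a \<odot>\<^bsub>M i\<^esub> x i)"
  by (auto simp: direct_sum_def)

lemma direct_sum_module:
  assumes "cring R" and M: "\<And>i. i \<in> I \<Longrightarrow> Module.module R (M i)"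
  shows "Module.module R (direct_sum I M)"
proof -
  interpret R: cring R by fact
  have grp: "abelian_group (M i)" if "i \<in> I" for i
    using M[OF that] by (simp add: Module.module_def)
  note [simp] = abelian_group.l_neg abelian_groupE(1,2,5) Module.module.smult_closed
    Module.module.smult_one
  have fin_add: "finite {i \<in> I. x i \<oplus>\<^bsub>M i\<^esub> y i \<noteq> \<zero>\<^bsub>M i\<^esub>}"
    if "finite {i \<in> I. x i \<noteq> \<zero>\<^bsub>M i\<^esub>}" "finite {i \<in> I. y i \<noteq> \<zero>\<^bsub>M i\<^esub>}" for x y
    by (rule finite_subset[OF _ finite_UnI[OF that]]) (use grp in auto)
  have fin_smult: "finite {i \<in> I. a \<odot>\<^bsub>M i\<^esub> x i \<noteq> \<zero>\<^bsub>M i\<^esub>}"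
    if "finite {i \<in> I. x i \<noteq> \<zero>\<^bsub>M i\<^esub>}" "a \<in> carrier R" for x a
    by (rule finite_subset[OF _ that(1)]) (use that(2) M Module.module.smult_r_null in fastforce)
  show ?thesis
  proof (intro moduleI abelian_groupI \<open>cring R\<close>)
    fix x y assume xy: "x \<in> carrier (direct_sum I M)" "y \<in> carrier (direct_sum I M)"
    show "x \<oplus>\<^bsub>direct_sum I M\<^esub> y \<in> carrier (direct_sum I M)"
      using xy fin_add[of x y] grp by (auto simp: direct_sum_simps PiE_iff cong: conj_cong)
    show "x \<oplus>\<^bsub>direct_sum I M\<^esub> y = y \<oplus>\<^bsub>direct_sum I M\<^esub> x"
      using xy grp by (auto simp: direct_sum_simps PiE_iff abelian_groupE(4) intro!: restrict_ext)
    fix z assume z: "z \<in> carrier (direct_sum I M)"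
    show "x \<oplus>\<^bsub>direct_sum I M\<^esub> y \<oplus>\<^bsub>direct_sum I M\<^esub> z = x \<oplus>\<^bsub>direct_sum I M\<^esub> (y \<oplus>\<^bsub>direct_sum I M\<^esub> z)"
      using xy z grp by (auto simp: direct_sum_simps PiE_iff abelian_groupE(3) intro!: restrict_ext)
  next
    fix x assume x: "x \<in> carrier (direct_sum I M)"
    show "\<zero>\<^bsub>direct_sum I M\<^esub> \<oplus>\<^bsub>direct_sum I M\<^esub> x = x"
      using x grp by (auto simp: direct_sum_simps PiE_iff extensional_def intro!: ext)
    have "finite {i \<in> I. \<ominus>\<^bsub>M i\<^esub> x i \<noteq> \<zero>\<^bsub>M i\<^esub>}"
    proof (rule finite_subset)
      show "{i \<in> I. \<ominus>\<^bsub>M i\<^esub> x i \<noteq> \<zero>\<^bsub>M i\<^esub>} \<subseteq> {i \<in> I. x i \<noteq> \<zero>\<^bsub>M i\<^esub>}"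
        using abelian_group.minus_equality[OF grp] grp by force
    qed (use x in \<open>simp add: direct_sum_simps\<close>)
    then have "(\<lambda>i\<in>I. \<ominus>\<^bsub>M i\<^esub> x i) \<in> carrier (direct_sum I M)"
      using x grp abelian_group.a_inv_closed[OF grp]
      by (auto simp: direct_sum_simps PiE_iff cong: conj_cong)
    moreover have "(\<lambda>i\<in>I. \<ominus>\<^bsub>M i\<^esub> x i) \<oplus>\<^bsub>direct_sum I M\<^esub> x = \<zero>\<^bsub>direct_sum I M\<^esub>"
      using x grp by (auto simp: direct_sum_simps PiE_iff intro!: restrict_ext)
    ultimately show "\<exists>y\<in>carrier (direct_sum I M). y \<oplus>\<^bsub>direct_sum I M\<^esub> x = \<zero>\<^bsub>direct_sum I M\<^esub>"
      by blast
    show "\<one>\<^bsub>R\<^esub> \<odot>\<^bsub>direct_sum I M\<^esub> x = x"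
      using x M by (auto simp: direct_sum_simps PiE_iff extensional_def intro!: ext)
    fix a assume a: "a \<in> carrier R"
    show "a \<odot>\<^bsub>direct_sum I M\<^esub> x \<in> carrier (direct_sum I M)"
      using x Module.module.smult_closed[OF M a] fin_smult[OF _ a, of x]
      by (auto simp: direct_sum_simps PiE_iff cong: conj_cong)
    fix b assume b: "b \<in> carrier R"
    show "(a \<oplus>\<^bsub>R\<^esub> b) \<odot>\<^bsub>direct_sum I M\<^esub> x = a \<odot>\<^bsub>direct_sum I M\<^esub> x \<oplus>\<^bsub>direct_sum I M\<^esub> b \<odot>\<^bsub>direct_sum I M\<^esub> x"
      using x a b M Module.module.smult_l_distr[OF M]
      by (auto simp: direct_sum_simps PiE_iff intro!: restrict_ext)
    show "(a \<otimes>\<^bsub>R\<^esub> b) \<odot>\<^bsub>direct_sum I M\<^esub> x = a \<odot>\<^bsub>direct_sum I M\<^esub> (b \<odot>\<^bsub>direct_sum I M\<^esub> x)"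
      using x a b M Module.module.smult_assoc1[OF M]
      by (auto simp: direct_sum_simps PiE_iff intro!: restrict_ext)
  next
    fix a x y assume "a \<in> carrier R" "x \<in> carrier (direct_sum I M)" "y \<in> carrier (direct_sum I M)"
    then show "a \<odot>\<^bsub>direct_sum I M\<^esub> (x \<oplus>\<^bsub>direct_sum I M\<^esub> y) =
        a \<odot>\<^bsub>direct_sum I M\<^esub> x \<oplus>\<^bsub>direct_sum I M\<^esub> a \<odot>\<^bsub>direct_sum I M\<^esub> y"
      using Module.module.smult_r_distr[OF M]
      by (auto simp: direct_sum_simps PiE_iff intro!: restrict_ext)
  qed (use grp in \<open>auto simp: direct_sum_simps\<close>)
qed

lemma direct_sum_inj_linear:
  assumes M: "\<And>i. i \<in> I \<Longrightarrow> Module.module R (M i)"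
  shows "direct_sum_inj I M i \<in> linear_maps R (M i) (direct_sum I M)"
proof (rule linear_mapsI)
  have grp: "abelian_group (M i)" if "i \<in> I" for i
    using M[OF that] by (simp add: Module.module_def)
  fix x assume x: "x \<in> carrier (M i)"
  have "finite {j \<in> I. direct_sum_inj I M i x j \<noteq> \<zero>\<^bsub>M j\<^esub>}"
    by (rule finite_subset[of _ "{i}"]) (auto simp: direct_sum_inj_def)
  then show "direct_sum_inj I M i x \<in> carrier (direct_sum I M)"
    using x abelian_groupE(2)[OF grp] by (auto simp: direct_sum_simps direct_sum_inj_def)
  show "direct_sum_inj I M i (a \<odot>\<^bsub>M i\<^esub> x) = a \<odot>\<^bsub>direct_sum I M\<^esub> direct_sum_inj I M i x"
    if "a \<in> carrier R" for a
    using x that Module.module.smult_r_null[OF M that]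
    by (auto simp: direct_sum_simps direct_sum_inj_def intro!: restrict_ext)
  fix y assume y: "y \<in> carrier (M i)"
  show "direct_sum_inj I M i (x \<oplus>\<^bsub>M i\<^esub> y) =
      direct_sum_inj I M i x \<oplus>\<^bsub>direct_sum I M\<^esub> direct_sum_inj I M i y"
    using x y abelian_groupE(5)[OF grp abelian_groupE(2)[OF grp]]
    by (auto simp: direct_sum_simps direct_sum_inj_def intro!: restrict_ext)
qed

lemma direct_sum_coord_linear:
  assumes "i \<in> I"
  shows "(\<lambda>x. x i) \<in> linear_maps R (direct_sum I M) (M i)"
  using assms by (intro linear_mapsI) (auto simp: direct_sum_simps)

text \<open>Used in contrapositive form: a map that does not kill \<open>x\<close> does not kill
  some component of \<open>x\<close>. This selects the summand that becomes the long
  barcode.\<close>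

lemma linear_map_direct_sum_eq_zero:
  assumes "cring R" and "finite I" and M: "\<And>i. i \<in> I \<Longrightarrow> Module.module R (M i)"
    and N: "Module.module R N" and h: "h \<in> linear_maps R (direct_sum I M) N"
    and x: "x \<in> carrier (direct_sum I M)"
    and 0: "\<And>i. i \<in> I \<Longrightarrow> h (direct_sum_inj I M i (x i)) = \<zero>\<^bsub>N\<^esub>"
  shows "h x = \<zero>\<^bsub>N\<^esub>"
proof -
  interpret N: Module.module R N by fact
  interpret S: Module.module R "direct_sum I M"
    by (rule direct_sum_module[OF assms(1) M])
  have grp: "abelian_group (M i)" if "i \<in> I" for i
    using M[OF that] by (simp add: Module.module_def)
  \<comment> \<open>\<open>y A\<close> is the truncation of \<open>x\<close> to the coordinates in
    \<open>A\<close>. A new index in \<open>A\<close> adds one component, so induction on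
    \<open>A\<close> leads from zero to \<open>y I = x\<close>.\<close>
  define y where "y A = (\<lambda>i\<in>I. if i \<in> A then x i else \<zero>\<^bsub>M i\<^esub>)" for A
  have y: "y A \<in> carrier (direct_sum I M)" for A
    using x \<open>finite I\<close> abelian_groupE(2)[OF grp] by (auto simp: y_def direct_sum_simps PiE_iff)
  have xi: "x i \<in> carrier (M i)" if "i \<in> I" for i
    using x that by (auto simp: direct_sum_simps)
  have inj: "direct_sum_inj I M i (x i) \<in> carrier (direct_sum I M)" if "i \<in> I" for i
    using direct_sum_inj_linear[OF M] xi[OF that] linear_maps_closed by fast
  have "h (y A) = \<zero>\<^bsub>N\<^esub>" if "finite A" "A \<subseteq> I" for A
    using that
  proof (induction A)
    case empty
    have "y {} = \<zero>\<^bsub>direct_sum I M\<^esub>" by (simp add: y_def direct_sum_simps)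
    then show ?case
      using linear_maps_zero[OF h S.module_axioms N] by simp
  next
    case (insert i A)
    have "y (insert i A) = direct_sum_inj I M i (x i) \<oplus>\<^bsub>direct_sum I M\<^esub> y A"
      using insert.hyps insert.prems xi abelian_groupE(5)[OF grp] abelian_groupE(2)[OF grp]
        abelian_groupE(4)[OF grp]
      by (auto simp: y_def direct_sum_simps direct_sum_inj_def intro!: restrict_ext)
    then show ?case
      using insert linear_maps_add[OF h inj y] 0 by auto
  qed
  from this[of I] have "h (y I) = \<zero>\<^bsub>N\<^esub>" using \<open>finite I\<close> by simp
  moreover have "y I = x"
    using x by (auto simp: y_def direct_sum_simps PiE_iff extensional_def)
  ultimately show ?thesis by simp
qed

section \<open>Quotients and colimits\<close>

lemma submodule_abelian_subgroup:
  assumes "Module.module R M" "submodule N R M"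
  shows "abelian_subgroup N M"
  using assms
  by (intro abelian_subgroupI3 additive_subgroupI) (auto simp: Module.module_def submodule_def)

lemma submodule_zero:
  assumes "Module.module R M" "submodule N R M"
  shows "\<zero>\<^bsub>M\<^esub> \<in> N"
proof -
  interpret abelian_subgroup N M by (rule submodule_abelian_subgroup[OF assms])
  show ?thesis by simp
qed

lemma submodule_coset_eq_iff:
  assumes "Module.module R M" "submodule N R M" "x \<in> carrier M" "y \<in> carrier M"
  shows "N +>\<^bsub>M\<^esub> x = N +>\<^bsub>M\<^esub> y \<longleftrightarrow> x \<ominus>\<^bsub>M\<^esub> y \<in> N"
proof -
  interpret abelian_subgroup N M by (rule submodule_abelian_subgroup[OF assms(1,2)])
  show ?thesis
    using a_repr_independence'[of x y] a_repr_independenceD[of y x] a_rcos_self[of x]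
      a_rcos_module[of y x] assms(3,4) unfolding a_minus_def by metis
qed

lemma submodule_coset_memD:
  assumes "Module.module R M" "submodule N R M" "x \<in> carrier M" "z \<in> N +>\<^bsub>M\<^esub> x"
  shows "z \<in> carrier M" "z \<ominus>\<^bsub>M\<^esub> x \<in> N"
proof -
  interpret abelian_subgroup N M by (rule submodule_abelian_subgroup[OF assms(1,2)])
  show "z \<in> carrier M"
    using assms(3,4) by (rule a_elemrcos_carrier)
  then show "z \<ominus>\<^bsub>M\<^esub> x \<in> N"
    using assms(3,4) a_rcos_module unfolding a_minus_def by blast
qed

lemma submodule_coset_self:
  assumes "Module.module R M" "submodule N R M" "x \<in> carrier M"
  shows "x \<in> N +>\<^bsub>M\<^esub> x"
proof -
  interpret abelian_subgroup N M by (rule submodule_abelian_subgroup[OF assms(1,2)])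
  show ?thesis using assms(3) by (rule a_rcos_self)
qed

lemma quotient_module_carrier:
  "carrier (quotient_module M N) = (\<lambda>x. N +>\<^bsub>M\<^esub> x) ` carrier M"
  by (auto simp: quotient_module_def A_RCOSETS_def')

lemma quotient_module_zero: "\<zero>\<^bsub>quotient_module M N\<^esub> = N"
  by (simp add: quotient_module_def)

lemma quotient_module_add:
  assumes "Module.module R M" "submodule N R M" "x \<in> carrier M" "y \<in> carrier M"
  shows "(N +>\<^bsub>M\<^esub> x) \<oplus>\<^bsub>quotient_module M N\<^esub> (N +>\<^bsub>M\<^esub> y) = N +>\<^bsub>M\<^esub> (x \<oplus>\<^bsub>M\<^esub> y)"
proof -
  interpret abelian_subgroup N M by (rule submodule_abelian_subgroup[OF assms(1,2)])
  show ?thesis using assms(3,4) by (simp add: quotient_module_def a_rcos_sum)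
qed

text \<open>Scalar multiplication on quotients and \<open>colimit_map\<close> are defined as unions
  over all representatives of a coset. Such a union collapses to the value at one representative as
  soon as the value is the same along the coset.\<close>

lemma coset_Union_eq:
  assumes "Module.module R M" "submodule N R M" and x: "x \<in> carrier M"
    and "\<And>z. z \<in> carrier M \<Longrightarrow> z \<ominus>\<^bsub>M\<^esub> x \<in> N \<Longrightarrow> f z = f x"
  shows "(\<Union>z\<in>N +>\<^bsub>M\<^esub> x. f z) = f x"
  using submodule_coset_memD[OF assms(1-3)] submodule_coset_self[OF assms(1-3)] assms(4) by blast

lemma quotient_module_smult:
  assumes "Module.module R M" "submodule N R M" "a \<in> carrier R" "x \<in> carrier M"
  shows "a \<odot>\<^bsub>quotient_module M N\<^esub> (N +>\<^bsub>M\<^esub> x) = N +>\<^bsub>M\<^esub> (a \<odot>\<^bsub>M\<^esub> x)"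
proof -
  interpret M: Module.module R M by fact
  have "N +>\<^bsub>M\<^esub> (a \<odot>\<^bsub>M\<^esub> z) = N +>\<^bsub>M\<^esub> (a \<odot>\<^bsub>M\<^esub> x)" if "z \<in> carrier M" "z \<ominus>\<^bsub>M\<^esub> x \<in> N" for z
  proof -
    have "a \<odot>\<^bsub>M\<^esub> z \<ominus>\<^bsub>M\<^esub> a \<odot>\<^bsub>M\<^esub> x = a \<odot>\<^bsub>M\<^esub> (z \<ominus>\<^bsub>M\<^esub> x)"
      using assms that by (simp add: a_minus_def M.smult_r_distr M.smult_r_minus)
    then show ?thesis
      using M.submoduleE(4)[OF assms(2,3) that(2)] assms that submodule_coset_eq_iff[OF assms(1,2)] by simp
  qed
  then show ?thesis
    using coset_Union_eq[OF assms(1,2,4), of "\<lambda>z. N +>\<^bsub>M\<^esub> (a \<odot>\<^bsub>M\<^esub> z)"] by (simp add: quotient_module_def)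
qed

lemma quotient_module_module:
  assumes M: "Module.module R M" and N: "submodule N R M"
  shows "Module.module R (quotient_module M N)"
proof -
  interpret M: Module.module R M by fact
  interpret abelian_subgroup N M by (rule submodule_abelian_subgroup[OF assms])
  note [simp] = quotient_module_add[OF assms] quotient_module_smult[OF assms]
  have zero: "\<zero>\<^bsub>quotient_module M N\<^esub> = N +>\<^bsub>M\<^esub> \<zero>\<^bsub>M\<^esub>"
    using M.M.a_coset_add_zero[OF a_subset] by (simp add: quotient_module_zero)
  show ?thesis
    by (intro moduleI abelian_groupI Module.module.axioms(1)[OF M])
      (auto simp: quotient_module_carrier zero M.M.a_ac M.smult_l_distr M.smult_r_distr M.smult_assoc1
        M.M.r_neg intro!: imageI bexI[of _ "\<ominus>\<^bsub>M\<^esub> _"])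
qed

lemma quotient_map_linear:
  assumes M: "Module.module R M" and N: "submodule N R M"
  shows "(\<lambda>x. N +>\<^bsub>M\<^esub> x) \<in> linear_maps R M (quotient_module M N)"
  by (rule linear_mapsI)
    (auto simp: quotient_module_carrier quotient_module_add[OF assms] quotient_module_smult[OF assms])

text \<open>Well-definedness is no issue, since \<open>h\<close> is given on cosets from the start.
  Linearity can be checked on representatives because every element of the quotient has one.\<close>

lemma linear_maps_quotientI:
  assumes M: "Module.module R M" and N: "submodule N R M"
    and h: "(\<lambda>x. h (N +>\<^bsub>M\<^esub> x)) \<in> linear_maps R M L"
  shows "h \<in> linear_maps R (quotient_module M N) L"
  by (rule linear_mapsI)
    (use linear_maps_closed[OF h] linear_maps_add[OF h] linear_maps_smult[OF h] in
      \<open>auto simp: quotient_module_carrier quotient_module_add[OF assms(1,2)] quotient_module_smult[OF assms(1,2)]\<close>)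

section \<open>Spans of subsets of a module\<close>

lemma submodule_span_submodule:
  assumes "Module.module R M" "A \<subseteq> carrier M"
  shows "submodule (submodule_span R M A) R M"
proof -
  interpret M: Module.module R M by fact
  note E = M.submoduleE submodule_zero[OF assms(1)]
  show ?thesis
    unfolding submodule_span_def
    by (rule M.submoduleI) (use M.carrier_is_submodule assms(2) in \<open>auto intro: E\<close>)
qed

lemma submodule_span_superset: "A \<subseteq> submodule_span R M A"
  by (auto simp: submodule_span_def)

lemma submodule_span_least: "submodule N R M \<Longrightarrow> A \<subseteq> N \<Longrightarrow> submodule_span R M A \<subseteq> N"
  by (auto simp: submodule_span_def)

text \<open>The preimage of \<open>B\<close> is a submodule that contains \<open>A\<close>, hence
  the span; no linear combinations have to be written down.\<close>

lemma linear_maps_submodule_span: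
  assumes h: "h \<in> linear_maps R M L" "Module.module R M" "Module.module R L"
    and B: "submodule B R L" and A: "A \<subseteq> carrier M" "\<And>a. a \<in> A \<Longrightarrow> h a \<in> B"
    and x: "x \<in> submodule_span R M A"
  shows "h x \<in> B"
proof -
  have "submodule_span R M A \<subseteq> {x \<in> carrier M. h x \<in> B}"
    using A by (intro submodule_span_least vimage_submodule[OF h B]) auto
  then show ?thesis using x by auto
qed

section \<open>Colimits of one cosheaf over varying sets of cells\<close>

locale cosheaf_colimits =
  fixes R :: "('k, 'm) ring_scheme" and K :: "'a::topological_space set set"
    and F :: "('a set, 'k, 'v) cosheaf"
  assumes cring_R: "cring R" and cosheaf_F: "cellular_cosheaf R K F"
begin

abbreviation "sumK I \<equiv> direct_sum I (stalk F)"
abbreviation "gen I \<equiv> direct_sum_inj I (stalk F)"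
abbreviation "rel I \<equiv> colimit_relations R I F"
abbreviation "clas I x \<equiv> rel I +>\<^bsub>sumK I\<^esub> x"
abbreviation "ext_zero I J x \<equiv> (\<lambda>\<sigma>\<in>J. if \<sigma> \<in> I then x \<sigma> else \<zero>\<^bsub>stalk F \<sigma>\<^esub>)"

lemma stalk_module: "\<sigma> \<in> K \<Longrightarrow> Module.module R (stalk F \<sigma>)"
  using cosheaf_F by (auto simp: cellular_cosheaf_def)

lemma ext_linear:
  "\<sigma> \<in> K \<Longrightarrow> \<tau> \<in> K \<Longrightarrow> face \<sigma> \<tau> \<Longrightarrow> ext_map F \<tau> \<sigma> \<in> linear_maps R (stalk F \<tau>) (stalk F \<sigma>)"
  using cosheaf_F by (auto simp: cellular_cosheaf_def)

lemma sum_module: "I \<subseteq> K \<Longrightarrow> Module.module R (sumK I)"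
  using direct_sum_module[OF cring_R] stalk_module by blast

lemma gen_linear: "I \<subseteq> K \<Longrightarrow> gen I \<sigma> \<in> linear_maps R (stalk F \<sigma>) (sumK I)"
  by (rule direct_sum_inj_linear) (use stalk_module in auto)

lemma gen_closed: "I \<subseteq> K \<Longrightarrow> v \<in> carrier (stalk F \<sigma>) \<Longrightarrow> gen I \<sigma> v \<in> carrier (sumK I)"
  by (rule linear_maps_closed[OF gen_linear])

lemma gen_ext_closed:
  assumes "I \<subseteq> K" "\<sigma> \<in> I" "\<tau> \<in> I" "face \<sigma> \<tau>" "v \<in> carrier (stalk F \<tau>)"
  shows "gen I \<sigma> (ext_map F \<tau> \<sigma> v) \<in> carrier (sumK I)"
  by (rule gen_closed[OF assms(1) linear_maps_closed[OF ext_linear]]) (use assms in auto)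

lemma relations_subset:
  assumes "I \<subseteq> K"
  shows "{gen I \<tau> v \<ominus>\<^bsub>sumK I\<^esub> gen I \<sigma> (ext_map F \<tau> \<sigma> v) | \<sigma> \<tau> v.
        \<sigma> \<in> I \<and> \<tau> \<in> I \<and> face \<sigma> \<tau> \<and> v \<in> carrier (stalk F \<tau>)} \<subseteq> carrier (sumK I)"
proof -
  interpret S: Module.module R "sumK I" by (rule sum_module[OF assms])
  show ?thesis
    using gen_closed[OF assms] gen_ext_closed[OF assms] by auto
qed

lemma rel_submodule: "I \<subseteq> K \<Longrightarrow> submodule (rel I) R (sumK I)"
  unfolding colimit_relations_def
  by (intro submodule_span_submodule sum_module relations_subset)

lemma rel_generator:
  assumes "\<sigma> \<in> I" "\<tau> \<in> I" "face \<sigma> \<tau>" "v \<in> carrier (stalk F \<tau>)"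
  shows "gen I \<tau> v \<ominus>\<^bsub>sumK I\<^esub> gen I \<sigma> (ext_map F \<tau> \<sigma> v) \<in> rel I"
  unfolding colimit_relations_def
  by (rule subsetD[OF submodule_span_superset]) (use assms in blast)

text \<open>This carries the universal property of the colimit. With \<open>B\<close> zero, a map on
  the direct sum descends to the colimit; with \<open>B\<close> the relations over a larger index
  set, a map between colimits is well defined.\<close>

lemma rel_map:
  assumes I: "I \<subseteq> K" and h: "h \<in> linear_maps R (sumK I) L" and L: "Module.module R L"
    and B: "submodule B R L" and x: "x \<in> rel I"
    and gen: "\<And>\<sigma> \<tau> v. \<sigma> \<in> I \<Longrightarrow> \<tau> \<in> I \<Longrightarrow> face \<sigma> \<tau> \<Longrightarrow> v \<in> carrier (stalk F \<tau>) \<Longrightarrow>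
      h (gen I \<tau> v) \<ominus>\<^bsub>L\<^esub> h (gen I \<sigma> (ext_map F \<tau> \<sigma> v)) \<in> B"
  shows "h x \<in> B"
proof (rule linear_maps_submodule_span[OF h sum_module[OF I] L B relations_subset[OF I]])
  show "x \<in> submodule_span R (sumK I)
     {gen I \<tau> v \<ominus>\<^bsub>sumK I\<^esub> gen I \<sigma> (ext_map F \<tau> \<sigma> v) |\<sigma> \<tau> v.
      \<sigma> \<in> I \<and> \<tau> \<in> I \<and> face \<sigma> \<tau> \<and> v \<in> carrier (stalk F \<tau>)}"
    using x by (simp add: colimit_relations_def)
  fix a assume "a \<in> {gen I \<tau> v \<ominus>\<^bsub>sumK I\<^esub> gen I \<sigma> (ext_map F \<tau> \<sigma> v) |\<sigma> \<tau> v.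
      \<sigma> \<in> I \<and> \<tau> \<in> I \<and> face \<sigma> \<tau> \<and> v \<in> carrier (stalk F \<tau>)}"
  then obtain \<sigma> \<tau> v where *: "a = gen I \<tau> v \<ominus>\<^bsub>sumK I\<^esub> gen I \<sigma> (ext_map F \<tau> \<sigma> v)"
      "\<sigma> \<in> I" "\<tau> \<in> I" "face \<sigma> \<tau>" "v \<in> carrier (stalk F \<tau>)"
    by blast
  have "gen I \<tau> v \<in> carrier (sumK I)" "gen I \<sigma> (ext_map F \<tau> \<sigma> v) \<in> carrier (sumK I)"
    using gen_closed[OF I] gen_ext_closed[OF I] * by auto
  then show "h a \<in> B"
    using * gen by (simp add: linear_maps_diff[OF h sum_module[OF I] L])
qed

lemma colimit_module: "I \<subseteq> K \<Longrightarrow> Module.module R (cosheaf_colimit R I F)"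
  unfolding cosheaf_colimit_def by (intro quotient_module_module sum_module rel_submodule)

lemma colimit_carrier: "carrier (cosheaf_colimit R I F) = (\<lambda>x. clas I x) ` carrier (sumK I)"
  by (simp add: cosheaf_colimit_def quotient_module_carrier)

lemma clas_linear: "I \<subseteq> K \<Longrightarrow> (\<lambda>x. clas I x) \<in> linear_maps R (sumK I) (cosheaf_colimit R I F)"
  unfolding cosheaf_colimit_def by (intro quotient_map_linear sum_module rel_submodule)

lemma clas_eq_iff:
  "I \<subseteq> K \<Longrightarrow> x \<in> carrier (sumK I) \<Longrightarrow> y \<in> carrier (sumK I) \<Longrightarrow>
    clas I x = clas I y \<longleftrightarrow> x \<ominus>\<^bsub>sumK I\<^esub> y \<in> rel I"
  using submodule_coset_eq_iff[OF sum_module rel_submodule] by blast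

text \<open>A generating relation read in the quotient: a value may be moved to a face along the
  extension map without changing its class. In a constant cosheaf, cells joined by faces and cofaces
  inside \<open>I\<close> thus become equal.\<close>

lemma clas_gen:
  assumes "I \<subseteq> K" "\<sigma> \<in> I" "\<tau> \<in> I" "face \<sigma> \<tau>" "v \<in> carrier (stalk F \<tau>)"
  shows "clas I (gen I \<tau> v) = clas I (gen I \<sigma> (ext_map F \<tau> \<sigma> v))"
  using clas_eq_iff[OF assms(1) gen_closed[OF assms(1,5)] gen_ext_closed[OF assms]]
    rel_generator[OF assms(2-5)] by simp

lemma extend_linear:
  assumes "I \<subseteq> J" "J \<subseteq> K"
  shows "(\<lambda>x. ext_zero I J x) \<in> linear_maps R (sumK I) (sumK J)"
proof (rule linear_mapsI)
  have mod: "Module.module R (stalk F \<sigma>)" if "\<sigma> \<in> J" for \<sigma>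
    using stalk_module assms that by auto
  have grp: "abelian_group (stalk F \<sigma>)" if "\<sigma> \<in> J" for \<sigma>
    using mod[OF that] by (auto simp: Module.module_def)
  fix x assume x: "x \<in> carrier (sumK I)"
  have "finite {i \<in> J. ext_zero I J x i \<noteq> \<zero>\<^bsub>stalk F i\<^esub>}"
    by (rule finite_subset[of _ "{i \<in> I. x i \<noteq> \<zero>\<^bsub>stalk F i\<^esub>}"]) (use x in \<open>auto simp: direct_sum_simps\<close>)
  then show "ext_zero I J x \<in> carrier (sumK J)"
    using x assms abelian_groupE(2)[OF grp] by (auto simp: direct_sum_simps PiE_iff)
  show "ext_zero I J (a \<odot>\<^bsub>sumK I\<^esub> x) = a \<odot>\<^bsub>sumK J\<^esub> ext_zero I J x" if "a \<in> carrier R" for a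
    using x that Module.module.smult_r_null[OF mod that]
    by (auto simp: direct_sum_simps intro!: restrict_ext)
  fix y assume y: "y \<in> carrier (sumK I)"
  show "ext_zero I J (x \<oplus>\<^bsub>sumK I\<^esub> y) = ext_zero I J x \<oplus>\<^bsub>sumK J\<^esub> ext_zero I J y"
    using x y abelian_groupE(5)[OF grp abelian_groupE(2)[OF grp]]
    by (auto simp: direct_sum_simps intro!: restrict_ext)
qed

lemma extend_gen:
  assumes "I \<subseteq> J" "\<sigma> \<in> I"
  shows "ext_zero I J (gen I \<sigma> v) = gen J \<sigma> v"
  using assms by (auto simp: direct_sum_inj_def intro!: restrict_ext)

text \<open>Extension by zero sends a generator of the relations over \<open>I\<close> to the
  generator over \<open>J\<close> that belongs to the same pair of cells.\<close>

lemma extend_rel: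
  assumes "I \<subseteq> J" "J \<subseteq> K" "x \<in> rel I"
  shows "ext_zero I J x \<in> rel J"
proof (rule rel_map[OF _ extend_linear[OF assms(1,2)] sum_module[OF assms(2)] rel_submodule[OF assms(2)] assms(3)])
  fix \<sigma> \<tau> v assume *: "\<sigma> \<in> I" "\<tau> \<in> I" "face \<sigma> \<tau>" "v \<in> carrier (stalk F \<tau>)"
  then show "ext_zero I J (gen I \<tau> v) \<ominus>\<^bsub>sumK J\<^esub> ext_zero I J (gen I \<sigma> (ext_map F \<tau> \<sigma> v)) \<in> rel J"
    using assms(1) by (simp only: extend_gen[OF assms(1)]) (auto intro!: rel_generator)
qed (use assms in auto)

lemma colimit_map_clas:
  assumes "I \<subseteq> J" "J \<subseteq> K" "x \<in> carrier (sumK I)"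
  shows "colimit_map R I J F (clas I x) = clas J (ext_zero I J x)"
  unfolding colimit_map_def
proof (rule coset_Union_eq[OF sum_module rel_submodule assms(3)])
  have I: "I \<subseteq> K" using assms by auto
  note lin = extend_linear[OF assms(1,2)]
  fix z assume z: "z \<in> carrier (sumK I)" "z \<ominus>\<^bsub>sumK I\<^esub> x \<in> rel I"
  have "ext_zero I J z \<ominus>\<^bsub>sumK J\<^esub> ext_zero I J x = ext_zero I J (z \<ominus>\<^bsub>sumK I\<^esub> x)"
    using linear_maps_diff[OF lin sum_module[OF I] sum_module[OF assms(2)] z(1) assms(3)] by simp
  also have "\<dots> \<in> rel J" by (rule extend_rel[OF assms(1,2) z(2)])
  finally show "clas J (ext_zero I J z) = clas J (ext_zero I J x)"
    using clas_eq_iff[OF assms(2)] linear_maps_closed[OF lin z(1)] linear_maps_closed[OF lin assms(3)] by simp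
qed (use assms in auto)

lemma colimit_map_linear:
  assumes "I \<subseteq> J" "J \<subseteq> K"
  shows "colimit_map R I J F \<in> linear_maps R (cosheaf_colimit R I F) (cosheaf_colimit R J F)"
  unfolding cosheaf_colimit_def[of R I]
proof (rule linear_maps_quotientI)
  have I: "I \<subseteq> K" using assms by auto
  show "Module.module R (sumK I)" "submodule (rel I) R (sumK I)"
    by (rule sum_module[OF I], rule rel_submodule[OF I])
  show "(\<lambda>x. colimit_map R I J F (clas I x)) \<in> linear_maps R (sumK I) (cosheaf_colimit R J F)"
    by (rule linear_maps_cong[OF linear_maps_comp[OF extend_linear[OF assms] clas_linear[OF assms(2)]]])
      (simp_all add: colimit_map_clas[OF assms] sum_module[OF I])
qed

text \<open>Contravariance comes from \<open>mono\<close>: whatever lies over a cell also lies over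
  its faces, so extension by zero goes from the stalk at a cell to the stalks at its faces.
  Functoriality holds since extending by zero twice is extending once.\<close>

lemma pushforward_cosheaf:
  assumes mono: "\<And>\<rho> \<tau>. \<rho> \<in> T \<Longrightarrow> \<tau> \<in> T \<Longrightarrow> face \<rho> \<tau> \<Longrightarrow> cells_over f K \<tau> \<subseteq> cells_over f K \<rho>"
  shows "cellular_cosheaf R T (pushforward R f K F)"
proof -
  have sub: "cells_over f K \<tau> \<subseteq> K" for \<tau> by (auto simp: cells_over_def)
  have ext_self: "ext_zero I I x = x" if "x \<in> carrier (sumK I)" for I x
    using that by (auto simp: direct_sum_simps PiE_iff extensional_def)
  have ext_ext: "ext_zero J L (ext_zero I J x) = ext_zero I L x" if "I \<subseteq> J" "J \<subseteq> L" for I J L and x :: "'a set \<Rightarrow> 'v"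
    using that by (auto intro!: restrict_ext)
  show ?thesis
    unfolding cellular_cosheaf_def pushforward_def
  proof (simp, intro conjI ballI impI)
    fix \<sigma> assume \<sigma>: "\<sigma> \<in> T"
    show "Module.module R (cosheaf_colimit R (cells_over f K \<sigma>) F)"
      by (rule colimit_module[OF sub])
    show "colimit_map R (cells_over f K \<sigma>) (cells_over f K \<sigma>) F x = x"
      if "x \<in> carrier (cosheaf_colimit R (cells_over f K \<sigma>) F)" for x
      using that colimit_map_clas[OF subset_refl sub] ext_self by (auto simp: colimit_carrier)
    fix \<tau> assume \<tau>: "\<tau> \<in> T" "face \<sigma> \<tau>"
    show "colimit_map R (cells_over f K \<tau>) (cells_over f K \<sigma>) F
        \<in> linear_maps R (cosheaf_colimit R (cells_over f K \<tau>) F) (cosheaf_colimit R (cells_over f K \<sigma>) F)"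
      by (rule colimit_map_linear[OF mono[OF \<sigma> \<tau>] sub])
  next
    fix \<rho> \<sigma> \<tau> x assume T: "\<rho> \<in> T" "\<sigma> \<in> T" "\<tau> \<in> T" "face \<rho> \<sigma>" "face \<sigma> \<tau>"
      and "x \<in> carrier (cosheaf_colimit R (cells_over f K \<tau>) F)"
    then obtain y where y: "y \<in> carrier (sumK (cells_over f K \<tau>))" "x = clas (cells_over f K \<tau>) y"
      by (auto simp: colimit_carrier)
    have 1: "cells_over f K \<tau> \<subseteq> cells_over f K \<sigma>" and 2: "cells_over f K \<sigma> \<subseteq> cells_over f K \<rho>"
      using mono T by auto
    show "colimit_map R (cells_over f K \<sigma>) (cells_over f K \<rho>) F
          (colimit_map R (cells_over f K \<tau>) (cells_over f K \<sigma>) F x) =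
        colimit_map R (cells_over f K \<tau>) (cells_over f K \<rho>) F x"
      unfolding y(2) colimit_map_clas[OF 1 sub y(1)] colimit_map_clas[OF order_trans[OF 1 2] sub y(1)]
        colimit_map_clas[OF 2 sub linear_maps_closed[OF extend_linear[OF 1 sub] y(1)]]
        ext_ext[OF 1 2] by (rule refl)
  qed
qed

end

section \<open>Connectedness of the face relation\<close>

text \<open>This replaces explicit walks by an induction rule. If \<open>P\<close> failed at
  \<open>\<sigma>\<close>, the closures of the cells with \<open>P\<close> and of those without
  would form two closed sets covering the union, closed because \<open>K\<close> is finite. A common
  point of the union lies in a cell \<open>\<rho>\<close> that by \<open>frontier\<close> is a face
  of cells of both kinds, and two steps through \<open>\<rho>\<close> would carry \<open>P\<close>
  from one kind to the other. So the two sets would disconnect the union.\<close>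

lemma face_connected_induct [consumes 4, case_names frontier start step]:
  fixes K :: "'a::topological_space set set"
  assumes "finite K" "connected (\<Union>K)" and \<sigma>\<^sub>0: "\<sigma>\<^sub>0 \<in> K" and \<sigma>: "\<sigma> \<in> K"
    and frontier: "\<And>\<sigma> \<tau>. \<sigma> \<in> K \<Longrightarrow> \<tau> \<in> K \<Longrightarrow> \<sigma> \<inter> closure \<tau> \<noteq> {} \<Longrightarrow> face \<sigma> \<tau>"
    and start: "P \<sigma>\<^sub>0"
    and step: "\<And>\<sigma> \<tau>. \<sigma> \<in> K \<Longrightarrow> \<tau> \<in> K \<Longrightarrow> face \<sigma> \<tau> \<or> face \<tau> \<sigma> \<Longrightarrow> P \<sigma> \<Longrightarrow> P \<tau>"
    and ne: "{} \<notin> K"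
  shows "P \<sigma>"
proof (rule ccontr)
  assume "\<not> P \<sigma>"
  define A where "A = (\<Union>\<tau>\<in>{\<tau> \<in> K. P \<tau>}. closure \<tau>)"
  define B where "B = (\<Union>\<tau>\<in>{\<tau> \<in> K. \<not> P \<tau>}. closure \<tau>)"
  have "closed A" "closed B"
    using \<open>finite K\<close> by (auto simp: A_def B_def)
  moreover have "\<Union>K \<subseteq> A \<union> B"
    using closure_subset by (fastforce simp: A_def B_def)
  moreover have "A \<inter> B \<inter> \<Union>K = {}"
  proof (rule ccontr)
    assume "A \<inter> B \<inter> \<Union>K \<noteq> {}"
    then obtain x \<rho> \<tau> \<tau>' where x: "x \<in> \<rho>" "\<rho> \<in> K" "\<tau> \<in> K" "P \<tau>" "x \<in> closure \<tau>"
        "\<tau>' \<in> K" "\<not> P \<tau>'" "x \<in> closure \<tau>'"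
      by (auto simp: A_def B_def)
    then have "face \<rho> \<tau>" "face \<rho> \<tau>'"
      using frontier by blast+
    then show False
      using step x by metis
  qed
  moreover have "A \<inter> \<Union>K \<noteq> {}"
  proof -
    obtain x where "x \<in> \<sigma>\<^sub>0" using \<sigma>\<^sub>0 ne by (metis ex_in_conv)
    then show ?thesis using \<sigma>\<^sub>0 start closure_subset[of \<sigma>\<^sub>0] by (auto simp: A_def)
  qed
  moreover have "B \<inter> \<Union>K \<noteq> {}"
  proof -
    obtain x where "x \<in> \<sigma>" using \<sigma> ne by (metis ex_in_conv)
    then show ?thesis using \<sigma> \<open>\<not> P \<sigma>\<close> closure_subset[of \<sigma>] by (auto simp: B_def)
  qed
  ultimately show False
    using \<open>connected (\<Union>K)\<close> unfolding connected_closed by blast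
qed

section \<open>Sections and functionals\<close>

text \<open>A section of \<open>F\<close> is a map from the constant cosheaf to \<open>F\<close>, and a functional is a map
  from \<open>F\<close> to the constant cosheaf.\<close>

definition cosheaf_section ::
  "'a::topological_space set set \<Rightarrow> ('a set, 'k, 'v) cosheaf \<Rightarrow> ('a set \<Rightarrow> 'v) \<Rightarrow> bool" where
  "cosheaf_section Z F s \<longleftrightarrow>
     (\<forall>\<sigma>\<in>Z. s \<sigma> \<in> carrier (stalk F \<sigma>)) \<and>
     (\<forall>\<sigma>\<in>Z. \<forall>\<tau>\<in>Z. face \<sigma> \<tau> \<longrightarrow> ext_map F \<tau> \<sigma> (s \<tau>) = s \<sigma>)"

definition cosheaf_functional ::
  "('k, 'm) ring_scheme \<Rightarrow> 'a::topological_space set set \<Rightarrow> ('a set, 'k, 'v) cosheaf \<Rightarrow>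
   ('a set \<Rightarrow> 'v \<Rightarrow> 'k) \<Rightarrow> bool" where
  "cosheaf_functional R Z F e \<longleftrightarrow>
     (\<forall>\<sigma>\<in>Z. e \<sigma> \<in> linear_maps R (stalk F \<sigma>) (regular_module R)) \<and>
     (\<forall>\<sigma>\<in>Z. \<forall>\<tau>\<in>Z. face \<sigma> \<tau> \<longrightarrow>
        (\<forall>x\<in>carrier (stalk F \<tau>). e \<sigma> (ext_map F \<tau> \<sigma> x) = e \<tau> x))"

lemma cellular_cosheafD:
  assumes "cellular_cosheaf R Z F" "\<sigma> \<in> Z"
  shows "Module.module R (stalk F \<sigma>)"
    and "\<tau> \<in> Z \<Longrightarrow> face \<sigma> \<tau> \<Longrightarrow> ext_map F \<tau> \<sigma> \<in> linear_maps R (stalk F \<tau>) (stalk F \<sigma>)"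
  using assms by (auto simp: cellular_cosheaf_def)

text \<open>Only the carriers shrink, so the stalks keep the type of those of \<open>F\<close>. This
  is the type in which \<open>indecomposable\<close> looks for the two summands.\<close>

definition subcosheaf ::
  "('c, 'k, 'v) cosheaf \<Rightarrow> ('c \<Rightarrow> 'v set) \<Rightarrow> ('c, 'k, 'v) cosheaf" where
  "subcosheaf F A = F\<lparr>stalk := \<lambda>\<sigma>. (stalk F \<sigma>)\<lparr>carrier := A \<sigma>\<rparr>\<rparr>"

lemma subcosheaf_cellular:
  assumes F: "cellular_cosheaf R Z F" and A: "\<And>\<sigma>. \<sigma> \<in> Z \<Longrightarrow> submodule (A \<sigma>) R (stalk F \<sigma>)"
    and ext: "\<And>\<sigma> \<tau> x. \<sigma> \<in> Z \<Longrightarrow> \<tau> \<in> Z \<Longrightarrow> face \<sigma> \<tau> \<Longrightarrow> x \<in> A \<tau> \<Longrightarrow> ext_map F \<tau> \<sigma> x \<in> A \<sigma>"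
  shows "cellular_cosheaf R Z (subcosheaf F A)"
proof -
  have sub: "A \<sigma> \<subseteq> carrier (stalk F \<sigma>)" if "\<sigma> \<in> Z" for \<sigma>
    using Module.module.submoduleE(1)[OF cellular_cosheafD(1)[OF F that] A[OF that]] .
  have "Module.module R (stalk (subcosheaf F A) \<sigma>)" if "\<sigma> \<in> Z" for \<sigma>
    using submodule.submodule_is_module[OF A cellular_cosheafD(1)[OF F]] that by (simp add: subcosheaf_def)
  moreover have "ext_map (subcosheaf F A) \<tau> \<sigma> \<in>
      linear_maps R (stalk (subcosheaf F A) \<tau>) (stalk (subcosheaf F A) \<sigma>)"
    if "\<sigma> \<in> Z" "\<tau> \<in> Z" "face \<sigma> \<tau>" for \<sigma> \<tau>
    using cellular_cosheafD(2)[OF F that] sub[OF that(2)] ext[OF that]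
    by (auto simp: linear_maps_def subcosheaf_def subset_iff)
  ultimately show ?thesis
    using F sub by (auto simp: cellular_cosheaf_def subcosheaf_def subset_iff)
qed

text \<open>The composite of \<open>s\<close> and \<open>e\<close> is an endomorphism of the
  constant cosheaf. It has the same value at a cell and at a face of it, so over a connected complex
  it is a single scalar.\<close>

lemma cosheaf_section_functional_const:
  assumes "finite Z" "connected (\<Union>Z)" "{} \<notin> Z"
    and frontier: "\<And>\<sigma> \<tau>. \<sigma> \<in> Z \<Longrightarrow> \<tau> \<in> Z \<Longrightarrow> \<sigma> \<inter> closure \<tau> \<noteq> {} \<Longrightarrow> face \<sigma> \<tau>"
    and s: "cosheaf_section Z F s" and e: "cosheaf_functional R Z F e"
    and "\<rho> \<in> Z" "\<sigma> \<in> Z"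
  shows "e \<sigma> (s \<sigma>) = e \<rho> (s \<rho>)"
  using assms(1,2,7,8)
proof (induction rule: face_connected_induct)
  case (step \<sigma> \<tau>)
  have "e \<sigma> (s \<sigma>) = e \<tau> (s \<tau>)" if "face \<sigma> \<tau>" "\<sigma> \<in> Z" "\<tau> \<in> Z" for \<sigma> \<tau>
    using s e that unfolding cosheaf_section_def cosheaf_functional_def by metis
  then show ?case using step by metis
qed (use assms in auto)

section \<open>Splitting off a constant summand\<close>

lemma (in abelian_group) add_minus_add:
  assumes "x \<in> carrier G" "y \<in> carrier G" "u \<in> carrier G" "v \<in> carrier G"
  shows "(x \<oplus> y) \<ominus> (u \<oplus> v) = (x \<ominus> u) \<oplus> (y \<ominus> v)"
  using assms by (simp add: a_minus_def minus_add a_ac)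

lemma (in abelian_group) add_minus_cancel:
  assumes "x \<in> carrier G" "y \<in> carrier G"
  shows "x \<oplus> (y \<ominus> x) = y" and "(x \<oplus> y) \<ominus> x = y"
  using assms r_neg1 r_neg2 by (simp_all add: a_minus_def a_ac)

lemma (in Module.module) smult_minus:
  assumes "a \<in> carrier R" "x \<in> carrier M" "y \<in> carrier M"
  shows "a \<odot>\<^bsub>M\<^esub> (x \<ominus>\<^bsub>M\<^esub> y) = a \<odot>\<^bsub>M\<^esub> x \<ominus>\<^bsub>M\<^esub> a \<odot>\<^bsub>M\<^esub> y"
  using assms by (simp add: a_minus_def smult_r_distr smult_r_minus)

text \<open>The composite of the section and the functional is multiplication by the unit \<open>c\<close>, so \<open>G\<close>
  splits into the image of \<open>s\<close> and the kernel of \<open>e\<close>, and the kernel has to vanish.\<close>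

lemma indecomposable_constant:
  assumes "field R" and G: "indecomposable R Z G"
    and s: "cosheaf_section Z G s" and e: "cosheaf_functional R Z G e"
    and c: "\<And>\<sigma>. \<sigma> \<in> Z \<Longrightarrow> e \<sigma> (s \<sigma>) = c" and c0: "c \<noteq> \<zero>\<^bsub>R\<^esub>" and "Z \<noteq> {}"
  shows "cosheaf_iso R Z G (constant_cosheaf R Z)"
    and "\<sigma> \<in> Z \<Longrightarrow> carrier (stalk G \<sigma>) \<noteq> {\<zero>\<^bsub>stalk G \<sigma>\<^esub>}"
proof -
  interpret R: field R by fact
  have cosh: "cellular_cosheaf R Z G"
    using G by (simp add: indecomposable_def)
  note mod = cellular_cosheafD(1)[OF cosh] and ext = cellular_cosheafD(2)[OF cosh]
  have reg: "Module.module R (regular_module R)"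
    by (rule regular_module_module) (rule R.is_cring)
  have sc: "s \<sigma> \<in> carrier (stalk G \<sigma>)" if "\<sigma> \<in> Z" for \<sigma>
    using s that by (auto simp: cosheaf_section_def)
  have es: "ext_map G \<tau> \<sigma> (s \<tau>) = s \<sigma>" if "\<sigma> \<in> Z" "\<tau> \<in> Z" "face \<sigma> \<tau>" for \<sigma> \<tau>
    using s that by (auto simp: cosheaf_section_def)
  have lin: "e \<sigma> \<in> linear_maps R (stalk G \<sigma>) (regular_module R)" if "\<sigma> \<in> Z" for \<sigma>
    using e that by (auto simp: cosheaf_functional_def)
  have ee: "e \<sigma> (ext_map G \<tau> \<sigma> x) = e \<tau> x"
    if "\<sigma> \<in> Z" "\<tau> \<in> Z" "face \<sigma> \<tau>" "x \<in> carrier (stalk G \<tau>)" for \<sigma> \<tau> x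
    using e that by (auto simp: cosheaf_functional_def)
  note ec = linear_maps_closed[OF lin, simplified] and ea = linear_maps_add[OF lin, simplified]
    and em = linear_maps_smult[OF lin, simplified]
  have e0: "e \<sigma> \<zero>\<^bsub>stalk G \<sigma>\<^esub> = \<zero>\<^bsub>R\<^esub>" if "\<sigma> \<in> Z" for \<sigma>
    using linear_maps_zero[OF lin mod reg] that by simp
  have ed: "e \<sigma> (x \<ominus>\<^bsub>stalk G \<sigma>\<^esub> y) = e \<sigma> x \<ominus>\<^bsub>R\<^esub> e \<sigma> y"
    if "\<sigma> \<in> Z" "x \<in> carrier (stalk G \<sigma>)" "y \<in> carrier (stalk G \<sigma>)" for \<sigma> x y
    using linear_maps_diff[OF lin mod reg] that by simp
  obtain \<sigma>\<^sub>0 where "\<sigma>\<^sub>0 \<in> Z" using \<open>Z \<noteq> {}\<close> by auto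
  then have cR: "c \<in> carrier R" using c ec sc by metis
  define d where "d = inv\<^bsub>R\<^esub> c"
  have dR: "d \<in> carrier R" and dc: "d \<otimes>\<^bsub>R\<^esub> c = \<one>\<^bsub>R\<^esub>" and cd: "c \<otimes>\<^bsub>R\<^esub> d = \<one>\<^bsub>R\<^esub>"
    using cR c0 R.field_Units by (auto simp: d_def)
  have s0: "s \<sigma> \<noteq> \<zero>\<^bsub>stalk G \<sigma>\<^esub>" if "\<sigma> \<in> Z" for \<sigma>
    using e0[OF that] c[OF that] c0 by auto
  then show "carrier (stalk G \<sigma>) \<noteq> {\<zero>\<^bsub>stalk G \<sigma>\<^esub>}" if "\<sigma> \<in> Z"
    using sc[OF that] that by auto
  \<comment> \<open>\<open>p\<close> applies \<open>e\<close>, divides by \<open>c\<close> and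
    applies \<open>s\<close>. The factor \<open>d\<close> makes it the projection onto the multiples
    of \<open>s\<close> along the kernel of \<open>e\<close>.\<close>
  define p where "p \<sigma> x = (d \<otimes>\<^bsub>R\<^esub> e \<sigma> x) \<odot>\<^bsub>stalk G \<sigma>\<^esub> s \<sigma>" for \<sigma> x
  \<comment> \<open>The summands are indexed by \<open>bool\<close> as in the definition of
    \<open>indecomposable\<close>: \<open>True\<close> stands for the image of \<open>s\<close>,
    \<open>False\<close> for the kernel of \<open>e\<close>.\<close>
  define A where "A b \<sigma> = (if b then {a \<odot>\<^bsub>stalk G \<sigma>\<^esub> s \<sigma> |a. a \<in> carrier R}
      else {x \<in> carrier (stalk G \<sigma>). e \<sigma> x = \<zero>\<^bsub>R\<^esub>})" for b \<sigma>
  have pc: "p \<sigma> x \<in> carrier (stalk G \<sigma>)" if "\<sigma> \<in> Z" "x \<in> carrier (stalk G \<sigma>)" for \<sigma> x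
    using Module.module.smult_closed[OF mod[OF that(1)]] sc ec that dR by (simp add: p_def)
  have ep: "e \<sigma> (p \<sigma> x) = e \<sigma> x" if "\<sigma> \<in> Z" "x \<in> carrier (stalk G \<sigma>)" for \<sigma> x
  proof -
    have "e \<sigma> (p \<sigma> x) = (d \<otimes>\<^bsub>R\<^esub> e \<sigma> x) \<otimes>\<^bsub>R\<^esub> c"
      using em[OF that(1)] sc ec that dR c by (simp add: p_def)
    also have "\<dots> = (d \<otimes>\<^bsub>R\<^esub> c) \<otimes>\<^bsub>R\<^esub> e \<sigma> x"
      using ec that dR cR by (simp add: R.m_ac)
    finally show ?thesis using ec that dc by simp
  qed
  have pl: "p \<sigma> \<in> linear_maps R (stalk G \<sigma>) (stalk G \<sigma>)" if "\<sigma> \<in> Z" for \<sigma>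
  proof (rule linear_mapsI)
    interpret M: Module.module R "stalk G \<sigma>" by (rule mod[OF that])
    show "p \<sigma> (x \<oplus>\<^bsub>stalk G \<sigma>\<^esub> y) = p \<sigma> x \<oplus>\<^bsub>stalk G \<sigma>\<^esub> p \<sigma> y"
      if "x \<in> carrier (stalk G \<sigma>)" "y \<in> carrier (stalk G \<sigma>)" for x y
      using ea[OF \<open>\<sigma> \<in> Z\<close>] ec[OF \<open>\<sigma> \<in> Z\<close>] sc[OF \<open>\<sigma> \<in> Z\<close>] dR that
      by (simp add: p_def R.r_distr M.smult_l_distr)
    show "p \<sigma> (a \<odot>\<^bsub>stalk G \<sigma>\<^esub> x) = a \<odot>\<^bsub>stalk G \<sigma>\<^esub> p \<sigma> x"
      if "a \<in> carrier R" "x \<in> carrier (stalk G \<sigma>)" for a x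
      using em[OF \<open>\<sigma> \<in> Z\<close>] ec[OF \<open>\<sigma> \<in> Z\<close>] sc[OF \<open>\<sigma> \<in> Z\<close>] dR that
      by (simp add: p_def R.m_lcomm flip: M.smult_assoc1)
  qed (use pc[OF that] in auto)
  have p_ext: "p \<sigma> (ext_map G \<tau> \<sigma> x) = ext_map G \<tau> \<sigma> (p \<tau> x)"
    if "\<sigma> \<in> Z" "\<tau> \<in> Z" "face \<sigma> \<tau>" "x \<in> carrier (stalk G \<tau>)" for \<sigma> \<tau> x
    using that ee[OF that] es[OF that(1-3)] linear_maps_smult[OF ext[OF that(1-3)]] dR ec sc
    by (simp add: p_def)
  have pA: "p \<sigma> x \<in> A True \<sigma>" if "\<sigma> \<in> Z" "x \<in> carrier (stalk G \<sigma>)" for \<sigma> x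
    using ec[OF that] dR by (auto simp: p_def A_def)
  have qA: "x \<ominus>\<^bsub>stalk G \<sigma>\<^esub> p \<sigma> x \<in> A False \<sigma>" if "\<sigma> \<in> Z" "x \<in> carrier (stalk G \<sigma>)" for \<sigma> x
  proof -
    interpret M: Module.module R "stalk G \<sigma>" by (rule mod[OF that(1)])
    show ?thesis
      using ed[OF that pc[OF that]] ep[OF that] ec[OF that] that pc[OF that] by (simp add: A_def a_minus_def R.r_neg)
  qed
  have pT: "p \<sigma> x = x" if "\<sigma> \<in> Z" "x \<in> A True \<sigma>" for \<sigma> x
  proof -
    obtain a where a: "a \<in> carrier R" "x = a \<odot>\<^bsub>stalk G \<sigma>\<^esub> s \<sigma>"
      using \<open>x \<in> A True \<sigma>\<close> by (auto simp: A_def)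
    have "d \<otimes>\<^bsub>R\<^esub> (a \<otimes>\<^bsub>R\<^esub> c) = a"
      using dc a cR dR by (metis R.m_lcomm R.r_one)
    then show ?thesis
      using em[OF that(1)] sc[OF that(1)] c[OF that(1)] a by (simp add: p_def)
  qed
  have pF: "p \<sigma> x = \<zero>\<^bsub>stalk G \<sigma>\<^esub>" if "\<sigma> \<in> Z" "x \<in> A False \<sigma>" for \<sigma> x
  proof -
    interpret M: Module.module R "stalk G \<sigma>" by (rule mod[OF that(1)])
    show ?thesis using that sc dR by (simp add: A_def p_def)
  qed
  define H where "H b = subcosheaf G (A b)" for b
  have Asub: "submodule (A b \<sigma>) R (stalk G \<sigma>)" if "\<sigma> \<in> Z" for b \<sigma>
    using cyclic_submodule[OF mod sc] kernel_submodule[OF lin mod reg] that by (simp add: A_def)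
  have AG: "x \<in> carrier (stalk G \<sigma>)" if "\<sigma> \<in> Z" "x \<in> A b \<sigma>" for b \<sigma> x
    using Module.module.submoduleE(1)[OF mod Asub] that by blast
  have "cellular_cosheaf R Z (H b)" for b
    unfolding H_def
  proof (rule subcosheaf_cellular[OF cosh Asub])
    fix \<sigma> \<tau> x assume Z: "\<sigma> \<in> Z" "\<tau> \<in> Z" "face \<sigma> \<tau>" and x: "x \<in> A b \<tau>"
    show "ext_map G \<tau> \<sigma> x \<in> A b \<sigma>"
    proof (cases b)
      case True
      \<comment> \<open>\<open>p\<close> fixes the elements of the image and commutes with the
        extension maps, so these preserve the image.\<close>
      then have "ext_map G \<tau> \<sigma> x = p \<sigma> (ext_map G \<tau> \<sigma> x)"
        using pT[OF Z(2)] x p_ext[OF Z AG[OF Z(2) x]] by simp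
      then show ?thesis
        using pA[OF Z(1) linear_maps_closed[OF ext[OF Z] AG[OF Z(2) x]]] True by simp
    next
      case False
      then show ?thesis
        using x ee[OF Z AG[OF Z(2) x]] linear_maps_closed[OF ext[OF Z] AG[OF Z(2) x]] by (simp add: A_def)
    qed
  qed auto
  moreover have "cosheaf_iso R Z G (cosheaf_sum UNIV H)"
    unfolding cosheaf_iso_def
  \<comment> \<open>Each \<open>x\<close> is sent to the pair of \<open>p x\<close> and
    \<open>x - p x\<close>; the inverse adds the two components.\<close>
  proof (intro exI[of _ "\<lambda>\<sigma> x b. if b then p \<sigma> x else x \<ominus>\<^bsub>stalk G \<sigma>\<^esub> p \<sigma> x"] conjI ballI impI)
    fix \<sigma> assume \<sigma>: "\<sigma> \<in> Z"
    interpret M: Module.module R "stalk G \<sigma>" by (rule mod[OF \<sigma>])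
    let ?f = "\<lambda>x b. if b then p \<sigma> x else x \<ominus>\<^bsub>stalk G \<sigma>\<^esub> p \<sigma> x"
    let ?S = "stalk (cosheaf_sum UNIV H) \<sigma>"
    have Sc: "y \<in> carrier ?S \<longleftrightarrow> y True \<in> A True \<sigma> \<and> y False \<in> A False \<sigma>" for y
    proof -
      have "finite B" for B :: "bool set" by (rule finite_subset[OF subset_UNIV]) simp
      then show ?thesis
        by (auto simp: cosheaf_sum_def direct_sum_simps H_def subcosheaf_def PiE_iff all_bool_eq)
    qed
    show "?f \<in> linear_maps R (stalk G \<sigma>) ?S"
    proof (rule linear_mapsI)
      fix x assume x: "x \<in> carrier (stalk G \<sigma>)"
      show "?f x \<in> carrier ?S"
        using pA[OF \<sigma> x] qA[OF \<sigma> x] by (simp add: Sc)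
      show "?f (x \<oplus>\<^bsub>stalk G \<sigma>\<^esub> y) = ?f x \<oplus>\<^bsub>?S\<^esub> ?f y" if y: "y \<in> carrier (stalk G \<sigma>)" for y
        using linear_maps_add[OF pl[OF \<sigma>] x y] M.M.add_minus_add[OF x y pc[OF \<sigma> x] pc[OF \<sigma> y]]
        by (intro HOL.ext) (simp add: cosheaf_sum_def direct_sum_simps H_def subcosheaf_def)
      show "?f (a \<odot>\<^bsub>stalk G \<sigma>\<^esub> x) = a \<odot>\<^bsub>?S\<^esub> ?f x" if a: "a \<in> carrier R" for a
        using linear_maps_smult[OF pl[OF \<sigma>] a x] M.smult_minus[OF a x pc[OF \<sigma> x]]
        by (intro HOL.ext) (simp add: cosheaf_sum_def direct_sum_simps H_def subcosheaf_def)
    qed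
    show "bij_betw ?f (carrier (stalk G \<sigma>)) (carrier ?S)"
    proof (rule bij_betw_byWitness[where f' = "\<lambda>y. y True \<oplus>\<^bsub>stalk G \<sigma>\<^esub> y False"])
      show "\<forall>x\<in>carrier (stalk G \<sigma>). ?f x True \<oplus>\<^bsub>stalk G \<sigma>\<^esub> ?f x False = x"
        using pc[OF \<sigma>] M.M.add_minus_cancel(1) by simp
      show "\<forall>y\<in>carrier ?S. ?f (y True \<oplus>\<^bsub>stalk G \<sigma>\<^esub> y False) = y"
      proof
        fix y assume "y \<in> carrier ?S"
        then have y: "y True \<in> A True \<sigma>" "y False \<in> A False \<sigma>" by (simp_all add: Sc)
        have p: "p \<sigma> (y True \<oplus>\<^bsub>stalk G \<sigma>\<^esub> y False) = y True"
          using linear_maps_add[OF pl[OF \<sigma>] AG[OF \<sigma> y(1)] AG[OF \<sigma> y(2)]] pT[OF \<sigma> y(1)] pF[OF \<sigma> y(2)]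
            AG[OF \<sigma> y(1)] by simp
        have "y True \<oplus>\<^bsub>stalk G \<sigma>\<^esub> y False \<ominus>\<^bsub>stalk G \<sigma>\<^esub> y True = y False"
          by (rule M.M.add_minus_cancel(2)[OF AG[OF \<sigma> y(1)] AG[OF \<sigma> y(2)]])
        then show "?f (y True \<oplus>\<^bsub>stalk G \<sigma>\<^esub> y False) = y"
          using p by auto
      qed
      show "?f ` carrier (stalk G \<sigma>) \<subseteq> carrier ?S"
        using pA[OF \<sigma>] qA[OF \<sigma>] by (auto simp: Sc)
      show "(\<lambda>y. y True \<oplus>\<^bsub>stalk G \<sigma>\<^esub> y False) ` carrier ?S \<subseteq> carrier (stalk G \<sigma>)"
        using AG[OF \<sigma>] by (auto simp: Sc)
    qed
    fix \<tau> x assume Z: "\<tau> \<in> Z" "face \<sigma> \<tau>" and x: "x \<in> carrier (stalk G \<tau>)"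
    show "(\<lambda>b. if b then p \<sigma> (ext_map G \<tau> \<sigma> x) else ext_map G \<tau> \<sigma> x \<ominus>\<^bsub>stalk G \<sigma>\<^esub> p \<sigma> (ext_map G \<tau> \<sigma> x)) =
        ext_map (cosheaf_sum UNIV H) \<tau> \<sigma> (\<lambda>b. if b then p \<tau> x else x \<ominus>\<^bsub>stalk G \<tau>\<^esub> p \<tau> x)"
      using p_ext[OF \<sigma> Z x] linear_maps_diff[OF ext[OF \<sigma> Z] mod[OF Z(1)] mod[OF \<sigma>] x pc[OF Z(1) x]]
      by (auto simp: cosheaf_sum_def H_def subcosheaf_def)
  qed
  ultimately obtain b where b: "zero_cosheaf Z (H b)"
    using G unfolding indecomposable_def by blast
  \<comment> \<open>The summand that vanishes cannot be the one containing the nonzero element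
    \<open>s\<close>. So it is the kernel of \<open>e\<close>, and \<open>e\<close> is injective on
    every stalk.\<close>
  have "s \<sigma>\<^sub>0 \<in> A True \<sigma>\<^sub>0"
    using Module.module.smult_one[OF mod sc, symmetric] \<open>\<sigma>\<^sub>0 \<in> Z\<close> by (auto simp: A_def)
  with b s0[OF \<open>\<sigma>\<^sub>0 \<in> Z\<close>] \<open>\<sigma>\<^sub>0 \<in> Z\<close> have "\<not> b"
    by (auto simp: zero_cosheaf_def H_def subcosheaf_def)
  with b have ker: "x = \<zero>\<^bsub>stalk G \<sigma>\<^esub>" if "\<sigma> \<in> Z" "x \<in> carrier (stalk G \<sigma>)" "e \<sigma> x = \<zero>\<^bsub>R\<^esub>" for \<sigma> x
    using that by (auto simp: zero_cosheaf_def H_def subcosheaf_def A_def)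
  show "cosheaf_iso R Z G (constant_cosheaf R Z)"
    unfolding cosheaf_iso_def
  proof (intro exI[of _ e] conjI ballI impI)
    fix \<sigma> assume \<sigma>: "\<sigma> \<in> Z"
    interpret M: Module.module R "stalk G \<sigma>" by (rule mod[OF \<sigma>])
    show "e \<sigma> \<in> linear_maps R (stalk G \<sigma>) (stalk (constant_cosheaf R Z) \<sigma>)"
      using lin \<sigma> by (simp add: constant_cosheaf_def)
    have "inj_on (e \<sigma>) (carrier (stalk G \<sigma>))"
    proof (rule inj_onI)
      fix x y assume xy: "x \<in> carrier (stalk G \<sigma>)" "y \<in> carrier (stalk G \<sigma>)" "e \<sigma> x = e \<sigma> y"
      then have "e \<sigma> (x \<ominus>\<^bsub>stalk G \<sigma>\<^esub> y) = \<zero>\<^bsub>R\<^esub>"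
        using ed[OF \<sigma>] ec[OF \<sigma>] by (simp add: R.minus_eq R.r_neg)
      then have "x \<ominus>\<^bsub>stalk G \<sigma>\<^esub> y = \<zero>\<^bsub>stalk G \<sigma>\<^esub>"
        using ker[OF \<sigma>] xy by simp
      then show "x = y"
        using M.M.add_minus_cancel(1)[OF xy(2,1)] xy by simp
    qed
    moreover have "a \<in> e \<sigma> ` carrier (stalk G \<sigma>)" if "a \<in> carrier R" for a
    proof
      \<comment> \<open>As \<open>e\<close> takes \<open>s\<close> to \<open>c\<close>, a preimage
        of \<open>a\<close> is the multiple of \<open>s\<close> by \<open>a\<close> divided by
        \<open>c\<close>.\<close>
      show "a = e \<sigma> ((a \<otimes>\<^bsub>R\<^esub> d) \<odot>\<^bsub>stalk G \<sigma>\<^esub> s \<sigma>)"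
        using em[OF \<sigma>] sc[OF \<sigma>] c[OF \<sigma>] that dR dc cR by (simp add: R.m_assoc)
    qed (use sc[OF \<sigma>] that dR in auto)
    ultimately show "bij_betw (e \<sigma>) (carrier (stalk G \<sigma>)) (carrier (stalk (constant_cosheaf R Z) \<sigma>))"
      using ec[OF \<sigma>] \<sigma> by (auto simp: bij_betw_def constant_cosheaf_def)
    fix \<tau> x assume "\<tau> \<in> Z" "face \<sigma> \<tau>" "x \<in> carrier (stalk G \<tau>)"
    then show "e \<sigma> (ext_map G \<tau> \<sigma> x) = ext_map (constant_cosheaf R Z) \<tau> \<sigma> (e \<tau> x)"
      using ee \<sigma> by (simp add: constant_cosheaf_def)
  qed
qed

text \<open>\<open>s'\<close> is a coordinate of \<open>s\<close> in the direct sum and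
  \<open>e'\<close> is the restriction of \<open>e\<close> to a summand, both transported through
  the isomorphism. The values of the composites add up to that of \<open>e\<close> on
  \<open>s\<close>, so they cannot all vanish. One cell is enough for the test, as each composite is
  constant over a connected base.\<close>

lemma cosheaf_sum_section_functional:
  assumes "cring R" "finite I" and F: "cellular_cosheaf R Z F"
    and G: "\<And>i. i \<in> I \<Longrightarrow> cellular_cosheaf R Z (G i)"
    and iso: "cosheaf_iso R Z F (cosheaf_sum I G)"
    and s: "cosheaf_section Z F s" and e: "cosheaf_functional R Z F e"
    and \<sigma>\<^sub>0: "\<sigma>\<^sub>0 \<in> Z" "e \<sigma>\<^sub>0 (s \<sigma>\<^sub>0) \<noteq> \<zero>\<^bsub>R\<^esub>"
  obtains i s' e' where "i \<in> I" "cosheaf_section Z (G i) s'" "cosheaf_functional R Z (G i) e'"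
    "e' \<sigma>\<^sub>0 (s' \<sigma>\<^sub>0) \<noteq> \<zero>\<^bsub>R\<^esub>"
proof -
  let ?S = "\<lambda>\<sigma>. stalk (cosheaf_sum I G) \<sigma>"
  have S: "?S \<sigma> = direct_sum I (\<lambda>i. stalk (G i) \<sigma>)" for \<sigma>
    by (simp add: cosheaf_sum_def)
  obtain \<phi> where \<phi>: "\<And>\<sigma>. \<sigma> \<in> Z \<Longrightarrow> \<phi> \<sigma> \<in> linear_maps R (stalk F \<sigma>) (?S \<sigma>)"
      "\<And>\<sigma>. \<sigma> \<in> Z \<Longrightarrow> bij_betw (\<phi> \<sigma>) (carrier (stalk F \<sigma>)) (carrier (?S \<sigma>))"
    and nat: "\<And>\<sigma> \<tau> x. \<sigma> \<in> Z \<Longrightarrow> \<tau> \<in> Z \<Longrightarrow> face \<sigma> \<tau> \<Longrightarrow> x \<in> carrier (stalk F \<tau>) \<Longrightarrow>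
      \<phi> \<sigma> (ext_map F \<tau> \<sigma> x) = ext_map (cosheaf_sum I G) \<tau> \<sigma> (\<phi> \<tau> x)"
    using iso unfolding cosheaf_iso_def by blast
  define \<psi> where "\<psi> \<sigma> = inv_into (carrier (stalk F \<sigma>)) (\<phi> \<sigma>)" for \<sigma>
  have \<psi>: "\<psi> \<sigma> \<in> linear_maps R (?S \<sigma>) (stalk F \<sigma>)" if "\<sigma> \<in> Z" for \<sigma>
    unfolding \<psi>_def by (rule linear_maps_inverse[OF \<phi>(1,2)[OF that] cellular_cosheafD(1)[OF F that]])
  have \<psi>\<phi>: "\<psi> \<sigma> (\<phi> \<sigma> x) = x" if "\<sigma> \<in> Z" "x \<in> carrier (stalk F \<sigma>)" for \<sigma> x
    using bij_betw_inv_into_left[OF \<phi>(2)] that by (simp add: \<psi>_def)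
  have \<phi>\<psi>: "\<phi> \<sigma> (\<psi> \<sigma> y) = y" if "\<sigma> \<in> Z" "y \<in> carrier (?S \<sigma>)" for \<sigma> y
    using bij_betw_inv_into_right[OF \<phi>(2)] that by (simp add: \<psi>_def)
  have mod: "Module.module R (stalk (G i) \<sigma>)" if "i \<in> I" "\<sigma> \<in> Z" for i \<sigma>
    using cellular_cosheafD(1)[OF G] that by blast
  have inj: "direct_sum_inj I (\<lambda>i. stalk (G i) \<sigma>) i \<in> linear_maps R (stalk (G i) \<sigma>) (?S \<sigma>)"
    if "\<sigma> \<in> Z" for \<sigma> i
    unfolding S by (rule direct_sum_inj_linear[OF mod]) (use that in auto)
  have reg: "Module.module R (regular_module R)"
    by (rule regular_module_module) fact
  have lin: "e \<sigma> \<in> linear_maps R (stalk F \<sigma>) (regular_module R)" if "\<sigma> \<in> Z" for \<sigma>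
    using e that by (auto simp: cosheaf_functional_def)
  have sc: "s \<sigma> \<in> carrier (stalk F \<sigma>)" if "\<sigma> \<in> Z" for \<sigma>
    using s that by (auto simp: cosheaf_section_def)
  define s' where "s' i \<sigma> = \<phi> \<sigma> (s \<sigma>) i" for i \<sigma>
  define e' where "e' i \<sigma> x = e \<sigma> (\<psi> \<sigma> (direct_sum_inj I (\<lambda>i. stalk (G i) \<sigma>) i x))" for i \<sigma> x
  have "cosheaf_section Z (G i) (s' i)" if i: "i \<in> I" for i
    unfolding cosheaf_section_def
  proof (intro conjI ballI impI)
    show "s' i \<sigma> \<in> carrier (stalk (G i) \<sigma>)" if "\<sigma> \<in> Z" for \<sigma>
      using linear_maps_closed[OF \<phi>(1)[OF that] sc[OF that]] i by (auto simp: s'_def S direct_sum_simps)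
    fix \<sigma> \<tau> assume Z: "\<sigma> \<in> Z" "\<tau> \<in> Z" "face \<sigma> \<tau>"
    have "ext_map F \<tau> \<sigma> (s \<tau>) = s \<sigma>"
      using s Z by (auto simp: cosheaf_section_def)
    then have "\<phi> \<sigma> (s \<sigma>) = ext_map (cosheaf_sum I G) \<tau> \<sigma> (\<phi> \<tau> (s \<tau>))"
      using nat[OF Z sc[OF Z(2)]] by simp
    then show "ext_map (G i) \<tau> \<sigma> (s' i \<tau>) = s' i \<sigma>"
      using i by (simp add: s'_def cosheaf_sum_def)
  qed
  moreover have "cosheaf_functional R Z (G i) (e' i)" if i: "i \<in> I" for i
    unfolding cosheaf_functional_def
  proof (intro conjI ballI impI)
    show "e' i \<sigma> \<in> linear_maps R (stalk (G i) \<sigma>) (regular_module R)" if "\<sigma> \<in> Z" for \<sigma>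
      unfolding e'_def by (rule linear_maps_comp[OF linear_maps_comp[OF inj[OF that] \<psi>[OF that]] lin[OF that]])
    fix \<sigma> \<tau> x assume Z: "\<sigma> \<in> Z" "\<tau> \<in> Z" "face \<sigma> \<tau>" and x: "x \<in> carrier (stalk (G i) \<tau>)"
    let ?y = "direct_sum_inj I (\<lambda>i. stalk (G i) \<tau>) i x"
    have y: "?y \<in> carrier (?S \<tau>)" by (rule linear_maps_closed[OF inj[OF Z(2)] x])
    have \<psi>y: "\<psi> \<tau> ?y \<in> carrier (stalk F \<tau>)" by (rule linear_maps_closed[OF \<psi>[OF Z(2)] y])
    \<comment> \<open>The inclusion of a summand commutes with extension because the extension maps
      of the other summands send zero to zero.\<close>
    have "ext_map (G j) \<tau> \<sigma> \<zero>\<^bsub>stalk (G j) \<tau>\<^esub> = \<zero>\<^bsub>stalk (G j) \<sigma>\<^esub>" if "j \<in> I" for j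
      using linear_maps_zero[OF cellular_cosheafD(2)[OF G[OF that] Z(1,2,3)] mod mod] that Z by auto
    then have "direct_sum_inj I (\<lambda>i. stalk (G i) \<sigma>) i (ext_map (G i) \<tau> \<sigma> x) = ext_map (cosheaf_sum I G) \<tau> \<sigma> ?y"
      by (auto simp: direct_sum_inj_def cosheaf_sum_def intro!: restrict_ext)
    also have "\<dots> = \<phi> \<sigma> (ext_map F \<tau> \<sigma> (\<psi> \<tau> ?y))"
      using nat[OF Z \<psi>y] \<phi>\<psi>[OF Z(2) y] by simp
    finally have "e' i \<sigma> (ext_map (G i) \<tau> \<sigma> x) = e \<sigma> (ext_map F \<tau> \<sigma> (\<psi> \<tau> ?y))"
      using \<psi>\<phi>[OF Z(1) linear_maps_closed[OF cellular_cosheafD(2)[OF F Z] \<psi>y]] by (simp add: e'_def)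
    also have "\<dots> = e' i \<tau> x"
      using e Z \<psi>y by (simp add: cosheaf_functional_def e'_def)
    finally show "e' i \<sigma> (ext_map (G i) \<tau> \<sigma> x) = e' i \<tau> x" .
  qed
  moreover have "\<exists>i\<in>I. e' i \<sigma>\<^sub>0 (s' i \<sigma>\<^sub>0) \<noteq> \<zero>\<^bsub>R\<^esub>"
  proof (rule ccontr)
    assume *: "\<not> (\<exists>i\<in>I. e' i \<sigma>\<^sub>0 (s' i \<sigma>\<^sub>0) \<noteq> \<zero>\<^bsub>R\<^esub>)"
    have "e \<sigma>\<^sub>0 (\<psi> \<sigma>\<^sub>0 (\<phi> \<sigma>\<^sub>0 (s \<sigma>\<^sub>0))) = \<zero>\<^bsub>regular_module R\<^esub>"
    proof (rule linear_map_direct_sum_eq_zero[OF assms(1,2) mod[OF _ \<sigma>\<^sub>0(1)] reg])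
      show "(\<lambda>y. e \<sigma>\<^sub>0 (\<psi> \<sigma>\<^sub>0 y)) \<in> linear_maps R (direct_sum I (\<lambda>i. stalk (G i) \<sigma>\<^sub>0)) (regular_module R)"
        using linear_maps_comp[OF \<psi>[OF \<sigma>\<^sub>0(1)] lin[OF \<sigma>\<^sub>0(1)]] by (simp add: S)
      show "\<phi> \<sigma>\<^sub>0 (s \<sigma>\<^sub>0) \<in> carrier (direct_sum I (\<lambda>i. stalk (G i) \<sigma>\<^sub>0))"
        using linear_maps_closed[OF \<phi>(1)[OF \<sigma>\<^sub>0(1)] sc[OF \<sigma>\<^sub>0(1)]] by (simp add: S)
    qed (use * in \<open>auto simp: e'_def s'_def\<close>)
    then show False
      using \<psi>\<phi>[OF \<sigma>\<^sub>0(1) sc[OF \<sigma>\<^sub>0(1)]] \<sigma>\<^sub>0(2) by simp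
  qed
  ultimately show thesis using that by blast
qed

section \<open>Existence of Remak decompositions\<close>

text \<open>Gaussian elimination, by induction on the set \<open>J\<close> of equations. Either all
  coefficients of the new equation \<open>j\<^sub>0\<close> are zero and it holds for any
  \<open>c\<close>, or it serves to eliminate one unknown \<open>i\<^sub>0\<close> from the others.
  In the second case one unknown and one equation disappear, so the unknowns still outnumber the
  equations.\<close>

lemma homogeneous_system_solution:
  fixes R (structure)
  assumes "field R" "finite J" "finite I" "card J < card I"
    and "\<And>i j. i \<in> I \<Longrightarrow> j \<in> J \<Longrightarrow> a i j \<in> carrier R"
  shows "\<exists>c\<in>I \<rightarrow> carrier R. (\<exists>i\<in>I. c i \<noteq> \<zero>) \<and> (\<forall>j\<in>J. (\<Oplus>i\<in>I. c i \<otimes> a i j) = \<zero>)"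
  using assms(2-)
proof (induction J arbitrary: I a rule: finite_induct)
  interpret R: field R by fact
  case empty
  then have "I \<noteq> {}" by auto
  then show ?case by (intro bexI[of _ "\<lambda>_. \<one>"]) auto
next
  interpret R: field R by fact
  case (insert j\<^sub>0 J)
  note a = insert.prems(3)
  show ?case
  proof (cases "\<forall>i\<in>I. a i j\<^sub>0 = \<zero>")
    case True
    obtain c where c: "c \<in> I \<rightarrow> carrier R" "\<exists>i\<in>I. c i \<noteq> \<zero>" "\<forall>j\<in>J. (\<Oplus>i\<in>I. c i \<otimes> a i j) = \<zero>"
      using insert.IH[of I a] insert.prems insert.hyps by auto
    have "(\<Oplus>i\<in>I. c i \<otimes> a i j\<^sub>0) = (\<Oplus>i\<in>I. \<zero>)"
      using c(1) True by (intro R.finsum_cong') (auto simp: Pi_def)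
    then show ?thesis
      using c by (intro bexI[of _ c]) (auto simp: R.finsum_zero)
  next
    case False
    then obtain i\<^sub>0 where i\<^sub>0: "i\<^sub>0 \<in> I" "a i\<^sub>0 j\<^sub>0 \<noteq> \<zero>" by auto
    define I' where "I' = I - {i\<^sub>0}"
    define u where "u = inv a i\<^sub>0 j\<^sub>0"
    have u: "u \<in> carrier R" "u \<otimes> a i\<^sub>0 j\<^sub>0 = \<one>"
      using R.field_Units i\<^sub>0 a by (auto simp: u_def)
    \<comment> \<open>Adding \<open>w j\<close> times equation \<open>j\<^sub>0\<close> to equation
      \<open>j\<close> removes the unknown \<open>i\<^sub>0\<close> from it. Moreover
      \<open>w j\<^sub>0\<close> is -1, so that \<open>sj\<close> below also covers the pivot
      equation.\<close>
    define w where "w j = \<ominus> (u \<otimes> a i\<^sub>0 j)" for j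
    have w: "w j \<in> carrier R" if "j \<in> insert j\<^sub>0 J" for j
      using a i\<^sub>0 u that by (simp add: w_def)
    have I': "finite I'" "I = insert i\<^sub>0 I'" "i\<^sub>0 \<notin> I'" "card J < card I'"
      using insert.prems insert.hyps i\<^sub>0 by (auto simp: I'_def card_Diff_singleton)
    have aI: "a i j \<in> carrier R" if "i \<in> I'" "j \<in> insert j\<^sub>0 J" for i j
      using a that I' by auto
    have "\<exists>c\<in>I' \<rightarrow> carrier R. (\<exists>i\<in>I'. c i \<noteq> \<zero>) \<and>
        (\<forall>j\<in>J. (\<Oplus>i\<in>I'. c i \<otimes> (a i j \<oplus> a i j\<^sub>0 \<otimes> w j)) = \<zero>)"
      by (rule insert.IH[OF I'(1,4)]) (use aI w in auto)
    then obtain c where c: "c \<in> I' \<rightarrow> carrier R" "\<exists>i\<in>I'. c i \<noteq> \<zero>"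
      and cz: "\<And>j. j \<in> J \<Longrightarrow> (\<Oplus>i\<in>I'. c i \<otimes> (a i j \<oplus> a i j\<^sub>0 \<otimes> w j)) = \<zero>"
      by blast
    define s where "s j = (\<Oplus>i\<in>I'. c i \<otimes> a i j)" for j
    have s: "s j \<in> carrier R" if "j \<in> insert j\<^sub>0 J" for j
      unfolding s_def by (rule R.finsum_closed) (use c(1) aI that in auto)
    have sj: "s j = \<ominus> (s j\<^sub>0 \<otimes> w j)" if "j \<in> insert j\<^sub>0 J" for j
    proof (cases "j = j\<^sub>0")
      case True
      have "w j\<^sub>0 = \<ominus> \<one>" using u(2) by (simp add: w_def)
      then show ?thesis using True s[of j\<^sub>0] by (simp add: R.r_minus)
    next
      case False
      with that have j: "j \<in> J" by simp
      have "\<zero> = (\<Oplus>i\<in>I'. c i \<otimes> a i j \<oplus> (c i \<otimes> a i j\<^sub>0) \<otimes> w j)"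
        unfolding cz[OF j, symmetric]
        using c(1) aI w j by (intro R.finsum_cong') (auto simp: R.r_distr R.m_assoc Pi_def)
      also have "\<dots> = s j \<oplus> (\<Oplus>i\<in>I'. (c i \<otimes> a i j\<^sub>0) \<otimes> w j)"
        unfolding s_def using c(1) aI w j by (intro R.finsum_addf) (auto simp: Pi_def)
      also have "\<dots> = s j \<oplus> s j\<^sub>0 \<otimes> w j"
        unfolding s_def using c(1) aI w j I'(1) by (subst R.finsum_ldistr) (auto simp: Pi_def)
      finally show ?thesis
        using s w j by (metis R.m_closed R.minus_equality insertCI)
    qed
    \<comment> \<open>The value at \<open>i\<^sub>0\<close> is forced by equation
      \<open>j\<^sub>0\<close>, whose other terms add up to \<open>s j\<^sub>0\<close>.\<close>
    define c' where "c' i = (if i = i\<^sub>0 then \<ominus> (s j\<^sub>0 \<otimes> u) else c i)" for i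
    have "(\<Oplus>i\<in>I. c' i \<otimes> a i j) = \<zero>" if j: "j \<in> insert j\<^sub>0 J" for j
    proof -
      have aj: "a i\<^sub>0 j \<in> carrier R" using a i\<^sub>0 j by simp
      have c'i: "c' i\<^sub>0 \<in> carrier R" using s[of j\<^sub>0] u by (simp add: c'_def)
      have "(\<Oplus>i\<in>I. c' i \<otimes> a i j) = c' i\<^sub>0 \<otimes> a i\<^sub>0 j \<oplus> (\<Oplus>i\<in>I'. c' i \<otimes> a i j)"
        unfolding I'(2) using c(1) aI j I'(1,3) c'i aj
        by (intro R.finsum_insert) (auto simp: c'_def Pi_def)
      also have "(\<Oplus>i\<in>I'. c' i \<otimes> a i j) = s j"
        unfolding s_def using c(1) aI j I'(3) by (intro R.finsum_cong') (auto simp: c'_def Pi_def)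
      also have "c' i\<^sub>0 \<otimes> a i\<^sub>0 j = s j\<^sub>0 \<otimes> w j"
        using s[of j\<^sub>0] u aj by (simp add: c'_def w_def R.l_minus R.r_minus R.m_assoc)
      finally show ?thesis
        using sj[OF j] s[of j\<^sub>0] w[OF j] by (simp add: R.r_neg)
    qed
    moreover have "c' \<in> I \<rightarrow> carrier R"
      using c(1) s[of j\<^sub>0] u I' by (auto simp: c'_def)
    moreover have "\<exists>i\<in>I. c' i \<noteq> \<zero>"
      using c(2) I' by (auto simp: c'_def)
    ultimately show ?thesis by blast
  qed
qed

text \<open>A dimension bound without a notion of dimension: \<open>M\<close> is a quotient of the
  free module on \<open>J\<close>, and the maps \<open>p i\<close> separate the vectors
  \<open>y i\<close>. If there were more vectors than elements of \<open>J\<close>, their lifts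
  would satisfy a nontrivial linear relation. Applying \<open>p i\<close> for an index with nonzero
  coefficient leaves only \<open>c i\<close> times \<open>p i (y i)\<close>, which is nonzero over a
  field.\<close>

lemma independent_card_le:
  assumes "field R" "finite J" "finite I" and V: "\<And>j. j \<in> J \<Longrightarrow> V j = regular_module R"
    and M: "Module.module R M" and N: "\<And>i. i \<in> I \<Longrightarrow> Module.module R (N i)"
    and h: "h \<in> linear_maps R (direct_sum J V) M" "carrier M \<subseteq> h ` carrier (direct_sum J V)"
    and y: "\<And>i. i \<in> I \<Longrightarrow> y i \<in> carrier M"
    and p: "\<And>i. i \<in> I \<Longrightarrow> p i \<in> linear_maps R M (N i)"
    and py: "\<And>i. i \<in> I \<Longrightarrow> p i (y i) \<noteq> \<zero>\<^bsub>N i\<^esub>"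
      "\<And>i j. i \<in> I \<Longrightarrow> j \<in> I \<Longrightarrow> i \<noteq> j \<Longrightarrow> p i (y j) = \<zero>\<^bsub>N i\<^esub>"
  shows "card I \<le> card J"
proof (rule ccontr)
  interpret R: field R by fact
  interpret D: Module.module R "direct_sum J V"
    by (rule direct_sum_module) (use V regular_module_module R.is_cring in auto)
  assume "\<not> card I \<le> card J"
  then have card: "card J < card I" by simp
  have "\<exists>z. z \<in> carrier (direct_sum J V) \<and> h z = y i" if "i \<in> I" for i
    using h(2) y[OF that] by (metis imageE subsetD)
  then obtain z where z: "\<And>i. i \<in> I \<Longrightarrow> z i \<in> carrier (direct_sum J V)" "\<And>i. i \<in> I \<Longrightarrow> h (z i) = y i"
    by metis
  have zc: "z i j \<in> carrier R" if "i \<in> I" "j \<in> J" for i j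
    using z(1)[OF that(1)] that(2) V by (auto simp: direct_sum_simps PiE_iff)
  have "\<exists>c\<in>I \<rightarrow> carrier R. (\<exists>i\<in>I. c i \<noteq> \<zero>\<^bsub>R\<^esub>) \<and>
      (\<forall>j\<in>J. (\<Oplus>\<^bsub>R\<^esub>i\<in>I. c i \<otimes>\<^bsub>R\<^esub> z i j) = \<zero>\<^bsub>R\<^esub>)"
    by (rule homogeneous_system_solution[OF assms(1-3) card zc])
  then obtain c i\<^sub>0 where c: "c \<in> I \<rightarrow> carrier R" and i\<^sub>0: "i\<^sub>0 \<in> I" "c i\<^sub>0 \<noteq> \<zero>\<^bsub>R\<^esub>"
    and c0: "\<And>j. j \<in> J \<Longrightarrow> (\<Oplus>\<^bsub>R\<^esub>i\<in>I. c i \<otimes>\<^bsub>R\<^esub> z i j) = \<zero>\<^bsub>R\<^esub>"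
    by blast
  have cI: "c i \<in> carrier R" if "i \<in> I" for i using c that by auto
  define w where "w = finsum (direct_sum J V) (\<lambda>i. c i \<odot>\<^bsub>direct_sum J V\<^esub> z i) I"
  have cz: "(\<lambda>i. c i \<odot>\<^bsub>direct_sum J V\<^esub> z i) \<in> I \<rightarrow> carrier (direct_sum J V)"
    using cI z(1) by auto
  have wc: "w \<in> carrier (direct_sum J V)"
    unfolding w_def by (rule D.M.finsum_closed[OF cz])
  have "w j = \<zero>\<^bsub>R\<^esub>" if j: "j \<in> J" for j
  proof -
    have "w j = finsum (V j) (\<lambda>i. (c i \<odot>\<^bsub>direct_sum J V\<^esub> z i) j) I"
      unfolding w_def
      using linear_maps_finsum[OF direct_sum_coord_linear[OF j] D.module_axioms _ assms(3) cz] V[OF j]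
        regular_module_module[OF R.is_cring] by simp
    also have "\<dots> = (\<Oplus>\<^bsub>R\<^esub>i\<in>I. c i \<otimes>\<^bsub>R\<^esub> z i j)"
    proof -
      \<comment> \<open>A finite sum involves only carrier, addition and zero, and
        \<open>regular_module R\<close> takes these from \<open>R\<close>.\<close>
      have "finsum (V j) f I = finsum R f I" for f
        by (simp add: V[OF j] finsum_def regular_module_def finprod_def)
      moreover have "(c i \<odot>\<^bsub>direct_sum J V\<^esub> z i) j = c i \<otimes>\<^bsub>R\<^esub> z i j" for i
        using j V[OF j] by (simp add: direct_sum_simps)
      ultimately show ?thesis by simp
    qed
    finally show ?thesis using c0[OF j] by simp
  qed
  then have w0: "w = \<zero>\<^bsub>direct_sum J V\<^esub>"
    using wc V by (auto simp: direct_sum_simps PiE_iff extensional_def)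
  interpret N: Module.module R "N i\<^sub>0" by (rule N[OF i\<^sub>0(1)])
  define q where "q x = p i\<^sub>0 (h x)" for x
  have q: "q \<in> linear_maps R (direct_sum J V) (N i\<^sub>0)"
    unfolding q_def by (rule linear_maps_comp[OF h(1) p[OF i\<^sub>0(1)]])
  have qz: "q (c i \<odot>\<^bsub>direct_sum J V\<^esub> z i) = c i \<odot>\<^bsub>N i\<^sub>0\<^esub> p i\<^sub>0 (y i)" if "i \<in> I" for i
    using linear_maps_smult[OF q cI[OF that] z(1)[OF that]] z(2)[OF that] by (simp add: q_def)
  have pc: "p i\<^sub>0 (y i) \<in> carrier (N i\<^sub>0)" if "i \<in> I" for i
    by (rule linear_maps_closed[OF p[OF i\<^sub>0(1)] y[OF that]])
  have "\<zero>\<^bsub>N i\<^sub>0\<^esub> = finsum (N i\<^sub>0) (\<lambda>i. q (c i \<odot>\<^bsub>direct_sum J V\<^esub> z i)) I"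
    using linear_maps_finsum[OF q D.module_axioms N.module_axioms assms(3) cz]
      linear_maps_zero[OF q D.module_axioms N.module_axioms] w0 by (simp add: w_def)
  also have "\<dots> = finsum (N i\<^sub>0) (\<lambda>i. if i\<^sub>0 = i then c i\<^sub>0 \<odot>\<^bsub>N i\<^sub>0\<^esub> p i\<^sub>0 (y i\<^sub>0) else \<zero>\<^bsub>N i\<^sub>0\<^esub>) I"
    using qz cI pc py(2)[OF i\<^sub>0(1)] i\<^sub>0(1) by (intro N.M.finsum_cong') auto
  also have "\<dots> = c i\<^sub>0 \<odot>\<^bsub>N i\<^sub>0\<^esub> p i\<^sub>0 (y i\<^sub>0)"
    using i\<^sub>0(1) assms(3) cI pc
    by (intro N.M.finsum_singleton[of i\<^sub>0 I "\<lambda>_. c i\<^sub>0 \<odot>\<^bsub>N i\<^sub>0\<^esub> p i\<^sub>0 (y i\<^sub>0)"]) auto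
  finally have "c i\<^sub>0 \<odot>\<^bsub>N i\<^sub>0\<^esub> p i\<^sub>0 (y i\<^sub>0) = \<zero>\<^bsub>N i\<^sub>0\<^esub>" by simp
  moreover have u: "inv\<^bsub>R\<^esub> c i\<^sub>0 \<in> carrier R" "inv\<^bsub>R\<^esub> c i\<^sub>0 \<otimes>\<^bsub>R\<^esub> c i\<^sub>0 = \<one>\<^bsub>R\<^esub>"
    using R.field_Units i\<^sub>0 cI by auto
  ultimately have "p i\<^sub>0 (y i\<^sub>0) = \<zero>\<^bsub>N i\<^sub>0\<^esub>"
    using N.smult_assoc1[OF u(1) cI[OF i\<^sub>0(1)] pc[OF i\<^sub>0(1)]] pc[OF i\<^sub>0(1)] by simp
  then show False using py(1)[OF i\<^sub>0(1)] by simp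
qed

section \<open>Composing isomorphisms and refining decompositions\<close>

lemma cosheaf_iso_trans:
  assumes "cosheaf_iso R Z F G" "cosheaf_iso R Z G H"
  shows "cosheaf_iso R Z F H"
proof -
  obtain \<phi> where \<phi>: "\<And>\<sigma>. \<sigma> \<in> Z \<Longrightarrow> \<phi> \<sigma> \<in> linear_maps R (stalk F \<sigma>) (stalk G \<sigma>)"
      "\<And>\<sigma>. \<sigma> \<in> Z \<Longrightarrow> bij_betw (\<phi> \<sigma>) (carrier (stalk F \<sigma>)) (carrier (stalk G \<sigma>))"
      "\<And>\<sigma> \<tau> x. \<sigma> \<in> Z \<Longrightarrow> \<tau> \<in> Z \<Longrightarrow> face \<sigma> \<tau> \<Longrightarrow> x \<in> carrier (stalk F \<tau>) \<Longrightarrow>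
        \<phi> \<sigma> (ext_map F \<tau> \<sigma> x) = ext_map G \<tau> \<sigma> (\<phi> \<tau> x)"
    using assms(1) unfolding cosheaf_iso_def by blast
  obtain \<psi> where \<psi>: "\<And>\<sigma>. \<sigma> \<in> Z \<Longrightarrow> \<psi> \<sigma> \<in> linear_maps R (stalk G \<sigma>) (stalk H \<sigma>)"
      "\<And>\<sigma>. \<sigma> \<in> Z \<Longrightarrow> bij_betw (\<psi> \<sigma>) (carrier (stalk G \<sigma>)) (carrier (stalk H \<sigma>))"
      "\<And>\<sigma> \<tau> x. \<sigma> \<in> Z \<Longrightarrow> \<tau> \<in> Z \<Longrightarrow> face \<sigma> \<tau> \<Longrightarrow> x \<in> carrier (stalk G \<tau>) \<Longrightarrow>
        \<psi> \<sigma> (ext_map G \<tau> \<sigma> x) = ext_map H \<tau> \<sigma> (\<psi> \<tau> x)"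
    using assms(2) unfolding cosheaf_iso_def by blast
  show ?thesis
    unfolding cosheaf_iso_def
  proof (intro exI[of _ "\<lambda>\<sigma> x. \<psi> \<sigma> (\<phi> \<sigma> x)"] conjI ballI impI)
    fix \<sigma> assume \<sigma>: "\<sigma> \<in> Z"
    show "(\<lambda>x. \<psi> \<sigma> (\<phi> \<sigma> x)) \<in> linear_maps R (stalk F \<sigma>) (stalk H \<sigma>)"
      by (rule linear_maps_comp[OF \<phi>(1)[OF \<sigma>] \<psi>(1)[OF \<sigma>]])
    show "bij_betw (\<lambda>x. \<psi> \<sigma> (\<phi> \<sigma> x)) (carrier (stalk F \<sigma>)) (carrier (stalk H \<sigma>))"
      using bij_betw_trans[OF \<phi>(2)[OF \<sigma>] \<psi>(2)[OF \<sigma>]] by (simp add: comp_def)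
    fix \<tau> x assume "\<tau> \<in> Z" "face \<sigma> \<tau>" "x \<in> carrier (stalk F \<tau>)"
    then show "\<psi> \<sigma> (\<phi> \<sigma> (ext_map F \<tau> \<sigma> x)) = ext_map H \<tau> \<sigma> (\<psi> \<tau> (\<phi> \<tau> x))"
      using \<phi>(3)[OF \<sigma>] \<psi>(3)[OF \<sigma>] linear_maps_closed[OF \<phi>(1)] by simp
  qed
qed

lemma cosheaf_iso_singleton_sum: "cosheaf_iso R Z F (cosheaf_sum {i} (\<lambda>_. F))"
  unfolding cosheaf_iso_def
proof (intro exI[of _ "\<lambda>\<sigma> x. \<lambda>j\<in>{i}. x"] conjI ballI impI)
  fix \<sigma>
  show "(\<lambda>x. \<lambda>j\<in>{i}. x) \<in> linear_maps R (stalk F \<sigma>) (stalk (cosheaf_sum {i} (\<lambda>_. F)) \<sigma>)"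
    by (rule linear_mapsI) (auto simp: cosheaf_sum_def direct_sum_simps intro!: restrict_ext)
  show "bij_betw (\<lambda>x. \<lambda>j\<in>{i}. x) (carrier (stalk F \<sigma>)) (carrier (stalk (cosheaf_sum {i} (\<lambda>_. F)) \<sigma>))"
    by (rule bij_betw_byWitness[where f' = "\<lambda>y. y i"])
      (auto simp: cosheaf_sum_def direct_sum_simps PiE_iff extensional_def)
qed (auto simp: cosheaf_sum_def intro!: restrict_ext)

text \<open>\<open>H True\<close> takes the place of the summand \<open>i\<close> and
  \<open>H False\<close> goes to the new position \<open>n\<close>, so the index set is again an
  initial segment of the natural numbers. As \<open>i < n\<close>, the two updates do not
  collide.\<close>

lemma cosheaf_sum_split:
  fixes G :: "nat \<Rightarrow> ('a::topological_space set, 'k, 'v) cosheaf" and H :: "bool \<Rightarrow> ('a set, 'k, 'v) cosheaf"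
  assumes i: "i < n" and iso: "cosheaf_iso R Z (G i) (cosheaf_sum UNIV H)"
  shows "cosheaf_iso R Z (cosheaf_sum {..<n} G)
           (cosheaf_sum {..<Suc n} (G(i := H True, n := H False)))"
proof -
  let ?G = "G(i := H True, n := H False)"
  let ?SH = "\<lambda>\<sigma>. stalk (cosheaf_sum UNIV H) \<sigma>"
  obtain \<phi> where \<phi>: "\<And>\<sigma>. \<sigma> \<in> Z \<Longrightarrow> \<phi> \<sigma> \<in> linear_maps R (stalk (G i) \<sigma>) (?SH \<sigma>)"
      "\<And>\<sigma>. \<sigma> \<in> Z \<Longrightarrow> bij_betw (\<phi> \<sigma>) (carrier (stalk (G i) \<sigma>)) (carrier (?SH \<sigma>))"
      "\<And>\<sigma> \<tau> x. \<sigma> \<in> Z \<Longrightarrow> \<tau> \<in> Z \<Longrightarrow> face \<sigma> \<tau> \<Longrightarrow> x \<in> carrier (stalk (G i) \<tau>) \<Longrightarrow>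
        \<phi> \<sigma> (ext_map (G i) \<tau> \<sigma> x) = ext_map (cosheaf_sum UNIV H) \<tau> \<sigma> (\<phi> \<tau> x)"
    using iso unfolding cosheaf_iso_def by blast
  have SH: "y \<in> carrier (?SH \<sigma>) \<longleftrightarrow> (\<forall>b. y b \<in> carrier (stalk (H b) \<sigma>))" for y \<sigma>
  proof -
    have "finite B" for B :: "bool set" by (rule finite_subset[OF subset_UNIV]) simp
    then show ?thesis by (auto simp: cosheaf_sum_def direct_sum_simps PiE_iff)
  qed
  have SG: "y \<in> carrier (stalk (cosheaf_sum {..<m} G') \<sigma>) \<longleftrightarrow> y \<in> (\<Pi>\<^sub>E j\<in>{..<m}. carrier (stalk (G' j) \<sigma>))"
    for y m \<sigma> and G' :: "nat \<Rightarrow> ('a set, 'k, 'v) cosheaf"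
    by (auto simp: cosheaf_sum_def direct_sum_simps)
  define f where "f \<sigma> x = (\<lambda>j\<in>{..<Suc n}. if j = i then \<phi> \<sigma> (x i) True
      else if j = n then \<phi> \<sigma> (x i) False else x j)" for \<sigma> x
  \<comment> \<open>The inverse of \<open>f\<close>: it packs the coordinates \<open>i\<close> and
    \<open>n\<close> into a function on \<open>bool\<close> and takes it back through
    \<open>\<phi>\<close>.\<close>
  define g where "g \<sigma> y = (\<lambda>j\<in>{..<n}. if j = i
      then inv_into (carrier (stalk (G i) \<sigma>)) (\<phi> \<sigma>) (\<lambda>b. if b then y i else y n) else y j)"
    for \<sigma> and y :: "nat \<Rightarrow> 'v"
  have fc: "f \<sigma> x \<in> carrier (stalk (cosheaf_sum {..<Suc n} ?G) \<sigma>)"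
    if "\<sigma> \<in> Z" "x \<in> carrier (stalk (cosheaf_sum {..<n} G) \<sigma>)" for \<sigma> x
  proof -
    have "\<phi> \<sigma> (x i) \<in> carrier (?SH \<sigma>)"
      by (rule linear_maps_closed[OF \<phi>(1)[OF that(1)]]) (use that(2) i in \<open>auto simp: SG\<close>)
    then show ?thesis
      using that(2) i by (auto simp: SG SH f_def PiE_iff)
  qed
  show ?thesis
    unfolding cosheaf_iso_def
  proof (intro exI[of _ f] conjI ballI impI)
    fix \<sigma> assume \<sigma>: "\<sigma> \<in> Z"
    show "f \<sigma> \<in> linear_maps R (stalk (cosheaf_sum {..<n} G) \<sigma>) (stalk (cosheaf_sum {..<Suc n} ?G) \<sigma>)"
    proof (rule linear_mapsI)
      fix x assume x: "x \<in> carrier (stalk (cosheaf_sum {..<n} G) \<sigma>)"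
      then show "f \<sigma> x \<in> carrier (stalk (cosheaf_sum {..<Suc n} ?G) \<sigma>)" by (rule fc[OF \<sigma>])
      have xi: "x i \<in> carrier (stalk (G i) \<sigma>)" using x i by (auto simp: SG)
      show "f \<sigma> (x \<oplus>\<^bsub>stalk (cosheaf_sum {..<n} G) \<sigma>\<^esub> y) = f \<sigma> x \<oplus>\<^bsub>stalk (cosheaf_sum {..<Suc n} ?G) \<sigma>\<^esub> f \<sigma> y"
        if y: "y \<in> carrier (stalk (cosheaf_sum {..<n} G) \<sigma>)" for y
      proof -
        have "y i \<in> carrier (stalk (G i) \<sigma>)" using y i by (auto simp: SG)
        then have "\<phi> \<sigma> (x i \<oplus>\<^bsub>stalk (G i) \<sigma>\<^esub> y i) = (\<lambda>b. \<phi> \<sigma> (x i) b \<oplus>\<^bsub>stalk (H b) \<sigma>\<^esub> \<phi> \<sigma> (y i) b)"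
          using linear_maps_add[OF \<phi>(1)[OF \<sigma>] xi] by (simp add: cosheaf_sum_def direct_sum_simps restrict_UNIV)
        then show ?thesis
          using i by (auto simp: f_def cosheaf_sum_def direct_sum_simps intro!: restrict_ext)
      qed
      show "f \<sigma> (a \<odot>\<^bsub>stalk (cosheaf_sum {..<n} G) \<sigma>\<^esub> x) = a \<odot>\<^bsub>stalk (cosheaf_sum {..<Suc n} ?G) \<sigma>\<^esub> f \<sigma> x"
        if a: "a \<in> carrier R" for a
      proof -
        have "\<phi> \<sigma> (a \<odot>\<^bsub>stalk (G i) \<sigma>\<^esub> x i) = (\<lambda>b. a \<odot>\<^bsub>stalk (H b) \<sigma>\<^esub> \<phi> \<sigma> (x i) b)"
          using linear_maps_smult[OF \<phi>(1)[OF \<sigma>] a xi] by (simp add: cosheaf_sum_def direct_sum_simps restrict_UNIV)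
        then show ?thesis
          using i by (auto simp: f_def cosheaf_sum_def direct_sum_simps intro!: restrict_ext)
      qed
    qed
    show "bij_betw (f \<sigma>) (carrier (stalk (cosheaf_sum {..<n} G) \<sigma>)) (carrier (stalk (cosheaf_sum {..<Suc n} ?G) \<sigma>))"
    proof (rule bij_betw_byWitness[where f' = "g \<sigma>"])
      show "\<forall>x\<in>carrier (stalk (cosheaf_sum {..<n} G) \<sigma>). g \<sigma> (f \<sigma> x) = x"
      proof
        fix x assume x: "x \<in> carrier (stalk (cosheaf_sum {..<n} G) \<sigma>)"
        then have xi: "x i \<in> carrier (stalk (G i) \<sigma>)" using i by (auto simp: SG)
        have "(\<lambda>b. if b then f \<sigma> x i else f \<sigma> x n) = \<phi> \<sigma> (x i)"
          using i by (auto simp: f_def)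
        then have "inv_into (carrier (stalk (G i) \<sigma>)) (\<phi> \<sigma>) (\<lambda>b. if b then f \<sigma> x i else f \<sigma> x n) = x i"
          using bij_betw_inv_into_left[OF \<phi>(2)[OF \<sigma>] xi] by simp
        moreover have "f \<sigma> x j = x j" if "j < n" "j \<noteq> i" for j
          using that by (simp add: f_def)
        ultimately show "g \<sigma> (f \<sigma> x) = x"
          using x by (intro HOL.ext) (auto simp: SG PiE_iff extensional_def g_def)
      qed
      have g: "inv_into (carrier (stalk (G i) \<sigma>)) (\<phi> \<sigma>) (\<lambda>b. if b then y i else y n) \<in> carrier (stalk (G i) \<sigma>)"
        "\<phi> \<sigma> (inv_into (carrier (stalk (G i) \<sigma>)) (\<phi> \<sigma>) (\<lambda>b. if b then y i else y n)) = (\<lambda>b. if b then y i else y n)"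
        if y: "y \<in> carrier (stalk (cosheaf_sum {..<Suc n} ?G) \<sigma>)" for y
      proof -
        have "y i \<in> carrier (stalk (H True) \<sigma>)" "y n \<in> carrier (stalk (H False) \<sigma>)"
          using PiE_mem[OF y[unfolded SG], of i] PiE_mem[OF y[unfolded SG], of n] i by auto
        then have "(\<lambda>b. if b then y i else y n) \<in> carrier (?SH \<sigma>)"
          by (simp add: SH)
        then show "inv_into (carrier (stalk (G i) \<sigma>)) (\<phi> \<sigma>) (\<lambda>b. if b then y i else y n) \<in> carrier (stalk (G i) \<sigma>)"
          "\<phi> \<sigma> (inv_into (carrier (stalk (G i) \<sigma>)) (\<phi> \<sigma>) (\<lambda>b. if b then y i else y n)) = (\<lambda>b. if b then y i else y n)"
          using bij_betw_inv_into_right[OF \<phi>(2)[OF \<sigma>]] bij_betw_apply[OF bij_betw_inv_into[OF \<phi>(2)[OF \<sigma>]]] by auto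
      qed
      show "\<forall>y\<in>carrier (stalk (cosheaf_sum {..<Suc n} ?G) \<sigma>). f \<sigma> (g \<sigma> y) = y"
      proof (intro ballI HOL.ext)
        fix y j assume y: "y \<in> carrier (stalk (cosheaf_sum {..<Suc n} ?G) \<sigma>)"
        show "f \<sigma> (g \<sigma> y) j = y j"
          using y g[OF y] i by (auto simp: SG PiE_iff extensional_def f_def g_def)
      qed
      show "f \<sigma> ` carrier (stalk (cosheaf_sum {..<n} G) \<sigma>) \<subseteq> carrier (stalk (cosheaf_sum {..<Suc n} ?G) \<sigma>)"
        using fc[OF \<sigma>] by auto
      show "g \<sigma> ` carrier (stalk (cosheaf_sum {..<Suc n} ?G) \<sigma>) \<subseteq> carrier (stalk (cosheaf_sum {..<n} G) \<sigma>)"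
      proof (rule image_subsetI)
        fix y assume y: "y \<in> carrier (stalk (cosheaf_sum {..<Suc n} ?G) \<sigma>)"
        have "y j \<in> carrier (stalk (G j) \<sigma>)" if "j < n" "j \<noteq> i" for j
          using PiE_mem[OF y[unfolded SG], of j] that by auto
        then show "g \<sigma> y \<in> carrier (stalk (cosheaf_sum {..<n} G) \<sigma>)"
          using g(1)[OF y] by (auto simp: SG g_def)
      qed
    qed
    fix \<tau> x assume Z: "\<tau> \<in> Z" "face \<sigma> \<tau>" and x: "x \<in> carrier (stalk (cosheaf_sum {..<n} G) \<tau>)"
    have "x i \<in> carrier (stalk (G i) \<tau>)" using x i by (auto simp: SG)
    then have "\<phi> \<sigma> (ext_map (G i) \<tau> \<sigma> (x i)) = (\<lambda>b. ext_map (H b) \<tau> \<sigma> (\<phi> \<tau> (x i) b))"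
      using \<phi>(3)[OF \<sigma> Z] by (simp add: cosheaf_sum_def restrict_UNIV)
    then show "f \<sigma> (ext_map (cosheaf_sum {..<n} G) \<tau> \<sigma> x) = ext_map (cosheaf_sum {..<Suc n} ?G) \<tau> \<sigma> (f \<tau> x)"
      using i by (auto simp: f_def cosheaf_sum_def intro!: restrict_ext)
  qed
qed

text \<open>Each nonzero summand contributes a nonzero vector \<open>x i\<close> in its stalk at
  some cell \<open>t i\<close>. Vectors at the same cell belong to different summands, hence are
  independent in the stalk of \<open>F\<close>, which is spanned by at most \<open>k\<close>
  elements. So every cell serves at most \<open>k\<close> summands.\<close>

lemma cosheaf_sum_length_le:
  assumes "field R" "finite Z" and F: "cellular_cosheaf R Z F"
    and J: "\<And>\<sigma>. \<sigma> \<in> Z \<Longrightarrow> finite (J \<sigma>)" "\<And>\<sigma>. \<sigma> \<in> Z \<Longrightarrow> card (J \<sigma>) \<le> k"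
    and V: "\<And>\<sigma> j. \<sigma> \<in> Z \<Longrightarrow> j \<in> J \<sigma> \<Longrightarrow> V j = regular_module R"
    and h: "\<And>\<sigma>. \<sigma> \<in> Z \<Longrightarrow> h \<sigma> \<in> linear_maps R (direct_sum (J \<sigma>) V) (stalk F \<sigma>)"
      "\<And>\<sigma>. \<sigma> \<in> Z \<Longrightarrow> carrier (stalk F \<sigma>) \<subseteq> h \<sigma> ` carrier (direct_sum (J \<sigma>) V)"
    and G: "\<And>i. i < n \<Longrightarrow> cellular_cosheaf R Z (G i)" "\<And>i. i < n \<Longrightarrow> \<not> zero_cosheaf Z (G i)"
    and iso: "cosheaf_iso R Z F (cosheaf_sum {..<n} G)"
  shows "n \<le> card Z * k"
proof -
  let ?S = "\<lambda>\<sigma>. stalk (cosheaf_sum {..<n} G) \<sigma>"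
  have mod: "Module.module R (stalk (G i) \<sigma>)" if "i < n" "\<sigma> \<in> Z" for i \<sigma>
    using cellular_cosheafD(1)[OF G(1)] that by blast
  have "\<exists>\<sigma> x. \<sigma> \<in> Z \<and> x \<in> carrier (stalk (G i) \<sigma>) \<and> x \<noteq> \<zero>\<^bsub>stalk (G i) \<sigma>\<^esub>" if "i < n" for i
  proof -
    obtain \<sigma> where \<sigma>: "\<sigma> \<in> Z" "carrier (stalk (G i) \<sigma>) \<noteq> {\<zero>\<^bsub>stalk (G i) \<sigma>\<^esub>}"
      using G(2)[OF \<open>i < n\<close>] by (auto simp: zero_cosheaf_def)
    interpret Module.module R "stalk (G i) \<sigma>" by (rule mod[OF that \<sigma>(1)])
    have "\<zero>\<^bsub>stalk (G i) \<sigma>\<^esub> \<in> carrier (stalk (G i) \<sigma>)" by (rule M.zero_closed)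
    then show ?thesis using \<sigma> by auto
  qed
  then obtain t x where t: "\<And>i. i < n \<Longrightarrow> t i \<in> Z" "\<And>i. i < n \<Longrightarrow> x i \<in> carrier (stalk (G i) (t i))"
      "\<And>i. i < n \<Longrightarrow> x i \<noteq> \<zero>\<^bsub>stalk (G i) (t i)\<^esub>"
    by metis
  obtain \<phi> where \<phi>: "\<And>\<sigma>. \<sigma> \<in> Z \<Longrightarrow> \<phi> \<sigma> \<in> linear_maps R (stalk F \<sigma>) (?S \<sigma>)"
      "\<And>\<sigma>. \<sigma> \<in> Z \<Longrightarrow> bij_betw (\<phi> \<sigma>) (carrier (stalk F \<sigma>)) (carrier (?S \<sigma>))"
    using iso unfolding cosheaf_iso_def by blast
  have "card {i. i < n \<and> t i = \<sigma>} \<le> k" if \<sigma>: "\<sigma> \<in> Z" for \<sigma>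
  proof -
    let ?inj = "direct_sum_inj {..<n} (\<lambda>i. stalk (G i) \<sigma>)"
    define y where "y i = inv_into (carrier (stalk F \<sigma>)) (\<phi> \<sigma>) (?inj i (x i))" for i
    have inj: "?inj i (x i) \<in> carrier (?S \<sigma>)" if "i < n" "t i = \<sigma>" for i
    proof -
      have "x i \<in> carrier (stalk (G i) \<sigma>)" using t(2) that by auto
      then show ?thesis
        using linear_maps_closed[OF direct_sum_inj_linear[of "{..<n}" R "\<lambda>i. stalk (G i) \<sigma>" i, OF mod]] \<sigma>
        by (simp add: cosheaf_sum_def)
    qed
    have y: "y i \<in> carrier (stalk F \<sigma>)" "\<phi> \<sigma> (y i) = ?inj i (x i)" if "i < n" "t i = \<sigma>" for i
      using inj[OF that] \<phi>(2)[OF \<sigma>] bij_betw_inv_into_right[OF \<phi>(2)[OF \<sigma>]]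
        bij_betw_apply[OF bij_betw_inv_into[OF \<phi>(2)[OF \<sigma>]]] by (auto simp: y_def)
    have "card {i. i < n \<and> t i = \<sigma>} \<le> card (J \<sigma>)"
    \<comment> \<open>The separating maps are the coordinates of \<open>\<phi>\<close>: the image of
      \<open>y i\<close> has the nonzero coordinate \<open>x i\<close> at \<open>i\<close> and zero
      elsewhere.\<close>
    proof (rule independent_card_le[where p = "\<lambda>i z. \<phi> \<sigma> z i" and N = "\<lambda>i. stalk (G i) \<sigma>" and y = y,
        OF \<open>field R\<close> J(1)[OF \<sigma>] _ V[OF \<sigma>] cellular_cosheafD(1)[OF F \<sigma>] _ h(1)[OF \<sigma>] h(2)[OF \<sigma>]])
      show "(\<lambda>z. \<phi> \<sigma> z i) \<in> linear_maps R (stalk F \<sigma>) (stalk (G i) \<sigma>)" if "i \<in> {i. i < n \<and> t i = \<sigma>}" for i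
        using linear_maps_comp[OF \<phi>(1)[OF \<sigma>, unfolded cosheaf_sum_def, simplified]
            direct_sum_coord_linear[of i "{..<n}"]] that by simp
    qed (use y t mod \<sigma> in \<open>auto simp: direct_sum_inj_def\<close>)
    then show ?thesis using J(2)[OF \<sigma>] by simp
  qed
  then have "(\<Sum>\<sigma>\<in>Z. card {i. i < n \<and> t i = \<sigma>}) \<le> card Z * k"
    using sum_bounded_above[of Z "\<lambda>\<sigma>. card {i. i < n \<and> t i = \<sigma>}" k] by simp
  moreover have "card (\<Union>\<sigma>\<in>Z. {i. i < n \<and> t i = \<sigma>}) \<le> (\<Sum>\<sigma>\<in>Z. card {i. i < n \<and> t i = \<sigma>})"
    by (rule card_UN_le[OF \<open>finite Z\<close>])
  moreover have "(\<Union>\<sigma>\<in>Z. {i. i < n \<and> t i = \<sigma>}) = {..<n}"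
    using t(1) by auto
  ultimately show ?thesis by simp
qed

text \<open>The search for a longest decomposition stays in one type: the failure of
  \<open>indecomposable\<close> yields two summands whose stalks have the same type as before, and
  \<open>bound\<close> speaks of families of that type.\<close>

lemma remak_decomposition_exists:
  fixes F :: "('a::topological_space set, 'k, 'v) cosheaf"
  assumes F: "cellular_cosheaf R Z F" "\<not> zero_cosheaf Z F"
    and bound: "\<And>n (G :: nat \<Rightarrow> ('a set, 'k, 'v) cosheaf). (\<And>i. i < n \<Longrightarrow> cellular_cosheaf R Z (G i)) \<Longrightarrow>
      (\<And>i. i < n \<Longrightarrow> \<not> zero_cosheaf Z (G i)) \<Longrightarrow> cosheaf_iso R Z F (cosheaf_sum {..<n} G) \<Longrightarrow> n \<le> m"
  shows "\<exists>n (G :: nat \<Rightarrow> ('a set, 'k, 'v) cosheaf). remak_decomposition R Z F n G"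
proof -
  \<comment> \<open>The summands have to be nonzero for their number to be bounded; otherwise zero
    cosheaves could be appended at will.\<close>
  define P where "P n \<longleftrightarrow> (\<exists>G :: nat \<Rightarrow> ('a set, 'k, 'v) cosheaf.
      (\<forall>i<n. cellular_cosheaf R Z (G i) \<and> \<not> zero_cosheaf Z (G i)) \<and>
      cosheaf_iso R Z F (cosheaf_sum {..<n} G))" for n
  have "{..<Suc 0} = {0::nat}" by auto
  then have "P (Suc 0)"
    using F cosheaf_iso_singleton_sum[of R Z F 0] unfolding P_def by (intro exI[of _ "\<lambda>_. F"]) simp
  moreover have "\<forall>n. P n \<longrightarrow> n \<le> m"
    unfolding P_def using bound by blast
  ultimately obtain n where n: "P n" "\<And>k. P k \<Longrightarrow> k \<le> n"
    using GreatestI_nat[of P "Suc 0" m] Greatest_le_nat[of P _ m] by blast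
  obtain G :: "nat \<Rightarrow> ('a set, 'k, 'v) cosheaf"
    where G: "\<And>i. i < n \<Longrightarrow> cellular_cosheaf R Z (G i) \<and> \<not> zero_cosheaf Z (G i)"
      "cosheaf_iso R Z F (cosheaf_sum {..<n} G)"
    using n(1) unfolding P_def by blast
  have "indecomposable R Z (G i)" if i: "i < n" for i
  proof (rule ccontr)
    assume "\<not> indecomposable R Z (G i)"
    then obtain H :: "bool \<Rightarrow> ('a set, 'k, 'v) cosheaf"
      where H: "\<And>b. cellular_cosheaf R Z (H b)" "cosheaf_iso R Z (G i) (cosheaf_sum UNIV H)"
        "\<And>b. \<not> zero_cosheaf Z (H b)"
      using G(1)[OF i] unfolding indecomposable_def by blast
    have "P (Suc n)"
      unfolding P_def
    proof (intro exI[of _ "G(i := H True, n := H False)"] conjI)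
      show "\<forall>j<Suc n. cellular_cosheaf R Z ((G(i := H True, n := H False)) j) \<and>
          \<not> zero_cosheaf Z ((G(i := H True, n := H False)) j)"
        using G(1) H by (simp add: less_Suc_eq)
      show "cosheaf_iso R Z F (cosheaf_sum {..<Suc n} (G(i := H True, n := H False)))"
        by (rule cosheaf_iso_trans[OF G(2) cosheaf_sum_split[where G = G and H = H, OF i H(2)]])
    qed
    then show False using n(2)[of "Suc n"] by simp
  qed
  then show ?thesis
    using G(2) unfolding remak_decomposition_def by blast
qed

section \<open>A section of the pushforward\<close>

lemma face_refl: "face \<sigma> \<sigma>"
  by (simp add: face_def closure_subset)

lemma face_trans: "face \<rho> \<sigma> \<Longrightarrow> face \<sigma> \<tau> \<Longrightarrow> face \<rho> \<tau>"
  unfolding face_def using closure_minimal[OF _ closed_closure] by blast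

text \<open>\<open>face\<close> refers to closures in the ambient type, so \<open>f\<close> is taken
  continuous on the whole type, as \<open>snd\<close> is. Then the image of a closure lies in the
  closure of the image.\<close>

lemma face_image:
  assumes "continuous_on UNIV f" "face \<sigma> \<tau>"
  shows "face (f ` \<sigma>) (f ` \<tau>)"
proof -
  have "f ` closure \<tau> \<subseteq> closure (f ` \<tau>)"
    by (rule image_closure_subset) (use assms(1) closure_subset continuous_on_subset in blast)+
  then show ?thesis using assms(2) by (auto simp: face_def)
qed

lemma cell_structure_frontier:
  "cell_structure X C \<Longrightarrow> \<sigma> \<in> C \<Longrightarrow> \<tau> \<in> C \<Longrightarrow> \<sigma> \<inter> closure \<tau> \<noteq> {} \<Longrightarrow> face \<sigma> \<tau>"
  by (simp add: cell_structure_def)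

text \<open>The cells of \<open>T\<close> are disjoint points and open intervals, so their midpoints
  order them along [0,1]. Statements about neighbouring cells become inequalities between real
  numbers.\<close>

definition midpoint_of :: "real set \<Rightarrow> real" where
  "midpoint_of \<tau> = (Inf \<tau> + Sup \<tau>) / 2"

lemma midpoint_of_simps [simp]:
  "midpoint_of {t} = t" "a < b \<Longrightarrow> midpoint_of {a<..<b} = (a + b) / 2"
  by (simp_all add: midpoint_of_def cInf_greaterThanLessThan cSup_greaterThanLessThan)

section \<open>The cells of [0,1] in their linear order\<close>

context
  fixes T :: "real set set"
  assumes T: "interval_cell_structure T"
begin

lemma interval_cell_cases:
  assumes "\<tau> \<in> T"
  obtains t where "\<tau> = {t}" | a b where "a < b" "\<tau> = {a<..<b}"
  using assms T by (auto simp: interval_cell_structure_def)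

lemma interval_cells_Union: "\<Union>T = {0..1}"
  and interval_cells_disjoint: "\<sigma> \<in> T \<Longrightarrow> \<tau> \<in> T \<Longrightarrow> x \<in> \<sigma> \<Longrightarrow> x \<in> \<tau> \<Longrightarrow> \<sigma> = \<tau>"
  and interval_cells_nonempty: "{} \<notin> T"
  using T by (auto simp: interval_cell_structure_def cell_structure_def partition_on_def disjoint_def)

lemma midpoint_of_mem: "\<tau> \<in> T \<Longrightarrow> midpoint_of \<tau> \<in> \<tau>"
  by (erule interval_cell_cases) auto

lemma midpoint_of_bounds: "\<tau> \<in> T \<Longrightarrow> 0 \<le> midpoint_of \<tau> \<and> midpoint_of \<tau> \<le> 1"
  using midpoint_of_mem interval_cells_Union by force

lemma midpoint_of_inj: "\<sigma> \<in> T \<Longrightarrow> \<tau> \<in> T \<Longrightarrow> midpoint_of \<sigma> = midpoint_of \<tau> \<Longrightarrow> \<sigma> = \<tau>"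
  using midpoint_of_mem interval_cells_disjoint by metis

text \<open>An open interval that contains 0 or 1 reaches beyond [0,1]. Hence the walk starts over
  the first cell of the order and ends over the last one.\<close>

lemma endpoint_cell:
  assumes "\<tau> \<in> T" "x \<in> \<tau>" "x = 0 \<or> x = 1"
  shows "\<tau> = {x}"
  using assms(1)
proof (rule interval_cell_cases)
  fix a b assume ab: "a < b" "\<tau> = {a<..<b}"
  have "\<tau> \<subseteq> {0..1}" using assms(1) interval_cells_Union by auto
  \<comment> \<open>These points of \<open>\<tau>\<close> lie on the two sides of \<open>x\<close>,
    so one of them is outside [0,1].\<close>
  moreover have "(a + x) / 2 \<in> \<tau>" "(x + b) / 2 \<in> \<tau>"
    using ab assms(2) by auto
  ultimately have "(a + x) / 2 \<ge> 0" "(x + b) / 2 \<le> 1" by auto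
  then show ?thesis using ab assms(2,3) by auto
qed (use assms(2) in auto)

text \<open>This is adjacency in terms of the order. A face of an open interval has its midpoint in
  the closed interval, and every cell other than the interval has its midpoint outside the open one,
  so nothing fits strictly between. It is the reason why a step of the walk affects a single cell of
  \<open>T\<close>.\<close>

lemma no_cell_between:
  assumes "\<sigma> \<in> T" "\<tau> \<in> T" "\<rho> \<in> T" "face \<sigma> \<tau>"
  shows "\<not> (midpoint_of \<sigma> < midpoint_of \<rho> \<and> midpoint_of \<rho> < midpoint_of \<tau>)"
    and "\<not> (midpoint_of \<tau> < midpoint_of \<rho> \<and> midpoint_of \<rho> < midpoint_of \<sigma>)"
proof -
  have "\<rho> = \<sigma> \<or> \<rho> = \<tau> \<or> (midpoint_of \<rho> < midpoint_of \<sigma> \<and> midpoint_of \<rho> < midpoint_of \<tau>) \<or>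
      (midpoint_of \<rho> > midpoint_of \<sigma> \<and> midpoint_of \<rho> > midpoint_of \<tau>)"
    using assms(2)
  proof (rule interval_cell_cases)
    fix t assume "\<tau> = {t}"
    then have "\<sigma> = \<tau>"
      using assms(4) midpoint_of_mem[OF assms(1)] by (auto simp: face_def)
    then show ?thesis
      using midpoint_of_inj[OF assms(3,2)] by (auto simp: neq_iff)
  next
    fix a b assume ab: "a < b" "\<tau> = {a<..<b}"
    then have "midpoint_of \<sigma> \<in> {a..b}"
      using assms(4) midpoint_of_mem[OF assms(1)] by (auto simp: face_def)
    moreover have "midpoint_of \<tau> = (a + b) / 2"
      using ab by simp
    moreover have "\<rho> = \<tau> \<or> midpoint_of \<rho> \<le> a \<or> b \<le> midpoint_of \<rho>"
      using interval_cells_disjoint[OF assms(3,2) midpoint_of_mem[OF assms(3)]] ab(2) by auto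
    moreover have "\<rho> = \<sigma> \<or> midpoint_of \<rho> \<noteq> midpoint_of \<sigma>"
      using midpoint_of_inj[OF assms(3,1)] by blast
    ultimately show ?thesis using ab(1) by (auto simp: field_simps)
  qed
  then show "\<not> (midpoint_of \<sigma> < midpoint_of \<rho> \<and> midpoint_of \<rho> < midpoint_of \<tau>)"
    "\<not> (midpoint_of \<tau> < midpoint_of \<rho> \<and> midpoint_of \<rho> < midpoint_of \<sigma>)" by auto
qed

text \<open>The section is built along a walk \<open>\<sigma>\<^sub>0, \<dots>, \<sigma>\<^sub>1\<close> through faces and cofaces in \<open>K\<close>. When the
  walk has reached \<open>\<sigma>\<close>, the family \<open>s\<close> takes the value 1 under \<open>e\<close> at the cells up to
  \<open>\<pi> \<sigma>\<close> and 0 at the later ones, and it is compatible with the extension maps except for a jump by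
  \<open>b \<sigma>\<close> at the upper end of \<open>\<pi> \<sigma>\<close>; a step of the walk changes \<open>s\<close> in a single cell. At the
  end of the walk no later cell is left.\<close>

lemma cosheaf_section_exists:
  fixes K :: "'b::topological_space set set" and F :: "(real set, 'k, 'v) cosheaf"
  assumes "cring R" and F: "cellular_cosheaf R T F"
    and K: "finite K" "connected (\<Union>K)" "{} \<notin> K"
      "\<And>\<sigma> \<tau>. \<sigma> \<in> K \<Longrightarrow> \<tau> \<in> K \<Longrightarrow> \<sigma> \<inter> closure \<tau> \<noteq> {} \<Longrightarrow> face \<sigma> \<tau>"
    and \<pi>: "\<And>\<sigma>. \<sigma> \<in> K \<Longrightarrow> \<pi> \<sigma> \<in> T"
      "\<And>\<sigma> \<tau>. \<sigma> \<in> K \<Longrightarrow> \<tau> \<in> K \<Longrightarrow> face \<sigma> \<tau> \<Longrightarrow> face (\<pi> \<sigma>) (\<pi> \<tau>)"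
    and b: "\<And>\<tau> \<sigma>. \<tau> \<in> T \<Longrightarrow> \<sigma> \<in> K \<Longrightarrow> face \<tau> (\<pi> \<sigma>) \<Longrightarrow> b \<tau> \<sigma> \<in> carrier (stalk F \<tau>)"
      "\<And>\<tau> \<sigma> \<sigma>'. \<tau> \<in> T \<Longrightarrow> \<sigma> \<in> K \<Longrightarrow> \<sigma>' \<in> K \<Longrightarrow> face \<sigma> \<sigma>' \<Longrightarrow> face \<tau> (\<pi> \<sigma>) \<Longrightarrow> b \<tau> \<sigma> = b \<tau> \<sigma>'"
      "\<And>\<rho> \<tau> \<sigma>. \<rho> \<in> T \<Longrightarrow> \<tau> \<in> T \<Longrightarrow> \<sigma> \<in> K \<Longrightarrow> face \<rho> \<tau> \<Longrightarrow> face \<tau> (\<pi> \<sigma>) \<Longrightarrow>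
        ext_map F \<tau> \<rho> (b \<tau> \<sigma>) = b \<rho> \<sigma>"
    and e: "cosheaf_functional R T F e"
    and eb: "\<And>\<tau> \<sigma>. \<tau> \<in> T \<Longrightarrow> \<sigma> \<in> K \<Longrightarrow> face \<tau> (\<pi> \<sigma>) \<Longrightarrow> e \<tau> (b \<tau> \<sigma>) = \<one>\<^bsub>R\<^esub>"
    and \<sigma>\<^sub>0: "\<sigma>\<^sub>0 \<in> K" "0 \<in> \<pi> \<sigma>\<^sub>0" and \<sigma>\<^sub>1: "\<sigma>\<^sub>1 \<in> K" "1 \<in> \<pi> \<sigma>\<^sub>1"
  shows "\<exists>s. cosheaf_section T F s \<and> (\<forall>\<tau>\<in>T. e \<tau> (s \<tau>) = \<one>\<^bsub>R\<^esub>)"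
proof -
  interpret R: cring R by fact
  let ?m = midpoint_of
  note mod = cellular_cosheafD(1)[OF F] and ext = cellular_cosheafD(2)[OF F]
  have reg: "Module.module R (regular_module R)"
    by (rule regular_module_module) fact
  have lin: "e \<tau> \<in> linear_maps R (stalk F \<tau>) (regular_module R)" if "\<tau> \<in> T" for \<tau>
    using e that by (auto simp: cosheaf_functional_def)
  have e0: "e \<tau> \<zero>\<^bsub>stalk F \<tau>\<^esub> = \<zero>\<^bsub>R\<^esub>" if "\<tau> \<in> T" for \<tau>
    using linear_maps_zero[OF lin mod reg] that by simp
  \<comment> \<open>\<open>c \<tau> p\<close> is the net number of crossings of
    \<open>\<tau>\<close> when the walk stands over \<open>p\<close>: 1 for the cells up to
    \<open>p\<close>, 0 for those beyond.\<close>
  define c where "c \<tau> p = (if ?m \<tau> \<le> ?m p then \<one>\<^bsub>R\<^esub> else \<zero>\<^bsub>R\<^esub>)" for \<tau> p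
  have c [simp]: "c \<tau> p \<in> carrier R" for \<tau> p by (simp add: c_def)
  \<comment> \<open>The default zero allows the defect of \<open>s\<close> to be written for all
    pairs of cells. Where \<open>b\<close> has no meaning, the coefficient in front of it is zero,
    by \<open>move\<close> and \<open>jump\<close> below.\<close>
  define b' where "b' \<tau> \<sigma> = (if face \<tau> (\<pi> \<sigma>) then b \<tau> \<sigma> else \<zero>\<^bsub>stalk F \<tau>\<^esub>)" for \<tau> \<sigma>
  have zero: "\<zero>\<^bsub>stalk F \<tau>\<^esub> \<in> carrier (stalk F \<tau>)" if "\<tau> \<in> T" for \<tau>
  proof -
    interpret M: Module.module R "stalk F \<tau>" by (rule mod[OF that])
    show ?thesis by simp
  qed
  have b'c: "b' \<tau> \<sigma> \<in> carrier (stalk F \<tau>)" if "\<tau> \<in> T" "\<sigma> \<in> K" for \<tau> \<sigma>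
    using b(1)[OF that] zero[OF that(1)] by (simp add: b'_def)
  define Inv where "Inv \<sigma> s \<longleftrightarrow> (\<forall>\<tau>\<in>T. s \<tau> \<in> carrier (stalk F \<tau>) \<and> e \<tau> (s \<tau>) = c \<tau> (\<pi> \<sigma>)) \<and>
      (\<forall>\<tau>\<in>T. \<forall>\<tau>'\<in>T. face \<tau> \<tau>' \<longrightarrow> ext_map F \<tau>' \<tau> (s \<tau>') =
        s \<tau> \<oplus>\<^bsub>stalk F \<tau>\<^esub> (c \<tau>' (\<pi> \<sigma>) \<ominus>\<^bsub>R\<^esub> c \<tau> (\<pi> \<sigma>)) \<odot>\<^bsub>stalk F \<tau>\<^esub> b' \<tau> \<sigma>)" for \<sigma> s
  have "\<exists>s. Inv \<sigma>\<^sub>1 s"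
    using K(1,2) \<sigma>\<^sub>0(1) \<sigma>\<^sub>1(1)
  proof (induction rule: face_connected_induct)
    case start
    have \<pi>0: "\<pi> \<sigma>\<^sub>0 = {0}"
      by (rule endpoint_cell[OF \<pi>(1)[OF \<sigma>\<^sub>0(1)] \<sigma>\<^sub>0(2)]) simp
    have c0: "c \<tau> {0} = (if \<tau> = {0} then \<one>\<^bsub>R\<^esub> else \<zero>\<^bsub>R\<^esub>)" if "\<tau> \<in> T" for \<tau>
    proof -
      have "{0} \<in> T" using \<pi>(1)[OF \<sigma>\<^sub>0(1)] \<pi>0 by simp
      from midpoint_of_inj[OF that this] have "?m \<tau> \<le> 0 \<longleftrightarrow> \<tau> = {0}"
        using midpoint_of_bounds[OF that] by auto
      then show ?thesis by (simp add: c_def)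
    qed
    have "Inv \<sigma>\<^sub>0 (\<lambda>\<tau>. if \<tau> = {0} then b \<tau> \<sigma>\<^sub>0 else \<zero>\<^bsub>stalk F \<tau>\<^esub>)"
      unfolding Inv_def
    proof (intro conjI ballI impI)
      fix \<tau> assume \<tau>: "\<tau> \<in> T"
      show "(if \<tau> = {0} then b \<tau> \<sigma>\<^sub>0 else \<zero>\<^bsub>stalk F \<tau>\<^esub>) \<in> carrier (stalk F \<tau>)"
        using b(1)[OF \<tau> \<sigma>\<^sub>0(1)] zero[OF \<tau>] face_refl \<pi>0 by auto
      show "e \<tau> (if \<tau> = {0} then b \<tau> \<sigma>\<^sub>0 else \<zero>\<^bsub>stalk F \<tau>\<^esub>) = c \<tau> (\<pi> \<sigma>\<^sub>0)"
        using eb[OF \<tau> \<sigma>\<^sub>0(1)] e0[OF \<tau>] face_refl \<pi>0 c0[OF \<tau>] by auto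
      fix \<tau>' assume \<tau>': "\<tau>' \<in> T" "face \<tau> \<tau>'"
      interpret M: Module.module R "stalk F \<tau>" by (rule mod[OF \<tau>])
      have ext0: "ext_map F \<tau>' \<tau> \<zero>\<^bsub>stalk F \<tau>'\<^esub> = \<zero>\<^bsub>stalk F \<tau>\<^esub>"
        by (rule linear_maps_zero[OF ext[OF \<tau> \<tau>'] mod[OF \<tau>'(1)] mod[OF \<tau>]])
      note b'\<tau> = b'c[OF \<tau> \<sigma>\<^sub>0(1)]
      \<comment> \<open>The only defect is between the vertex 0 and a later cell
        \<open>\<tau>'\<close> having it as a face: extension gives zero, and the coefficient -1
        cancels \<open>b\<close>.\<close>
      consider "\<tau>' = {0}" | "\<tau>' \<noteq> {0}" "\<tau> = {0}" | "\<tau>' \<noteq> {0}" "\<tau> \<noteq> {0}" by blast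
      then show "ext_map F \<tau>' \<tau> (if \<tau>' = {0} then b \<tau>' \<sigma>\<^sub>0 else \<zero>\<^bsub>stalk F \<tau>'\<^esub>) =
          (if \<tau> = {0} then b \<tau> \<sigma>\<^sub>0 else \<zero>\<^bsub>stalk F \<tau>\<^esub>) \<oplus>\<^bsub>stalk F \<tau>\<^esub>
          (c \<tau>' (\<pi> \<sigma>\<^sub>0) \<ominus>\<^bsub>R\<^esub> c \<tau> (\<pi> \<sigma>\<^sub>0)) \<odot>\<^bsub>stalk F \<tau>\<^esub> b' \<tau> \<sigma>\<^sub>0"
      proof cases
        case 1
        have "\<tau> \<noteq> {}" using \<tau> interval_cells_nonempty by auto
        then have "\<tau> = {0}" using 1 \<tau>'(2) by (auto simp: face_def subset_singleton_iff)
        moreover from this have "ext_map F \<tau>' \<tau> (b \<tau>' \<sigma>\<^sub>0) = b' \<tau> \<sigma>\<^sub>0" "b \<tau> \<sigma>\<^sub>0 = b' \<tau> \<sigma>\<^sub>0"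
          using 1 b(3)[OF \<tau> \<tau>'(1) \<sigma>\<^sub>0(1) \<tau>'(2)] face_refl[of "{0::real}"] by (simp_all add: b'_def \<pi>0)
        ultimately show ?thesis
          using 1 M.smult_l_null[OF b'\<tau>] M.M.r_zero[OF b'\<tau>] by (simp add: R.minus_eq R.r_neg)
      next
        case 2
        then have "b \<tau> \<sigma>\<^sub>0 = b' \<tau> \<sigma>\<^sub>0"
          using face_refl[of "{0::real}"] by (simp add: b'_def \<pi>0)
        then show ?thesis
          using 2 ext0 c0[OF \<tau>] c0[OF \<tau>'(1)] M.smult_l_minus[OF R.one_closed b'\<tau>]
            M.smult_one[OF b'\<tau>] M.M.r_neg[OF b'\<tau>]
          by (simp add: \<pi>0 R.minus_eq)
      next
        case 3
        then show ?thesis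
          using b'\<tau> ext0 c0[OF \<tau>] c0[OF \<tau>'(1)] by (simp add: \<pi>0 R.minus_eq R.r_neg)
      qed
    qed
    then show ?case by blast
  next
    case (step \<sigma> \<sigma>')
    then obtain s where s: "\<And>\<tau>. \<tau> \<in> T \<Longrightarrow> s \<tau> \<in> carrier (stalk F \<tau>)" "\<And>\<tau>. \<tau> \<in> T \<Longrightarrow> e \<tau> (s \<tau>) = c \<tau> (\<pi> \<sigma>)"
      "\<And>\<tau> \<tau>'. \<tau> \<in> T \<Longrightarrow> \<tau>' \<in> T \<Longrightarrow> face \<tau> \<tau>' \<Longrightarrow> ext_map F \<tau>' \<tau> (s \<tau>') =
        s \<tau> \<oplus>\<^bsub>stalk F \<tau>\<^esub> (c \<tau>' (\<pi> \<sigma>) \<ominus>\<^bsub>R\<^esub> c \<tau> (\<pi> \<sigma>)) \<odot>\<^bsub>stalk F \<tau>\<^esub> b' \<tau> \<sigma>"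
      unfolding Inv_def by blast
    \<comment> \<open>\<open>\<omega>\<close> is the larger of the two cells and has both as faces.
      Where the class of \<open>\<sigma>\<close> or of \<open>\<sigma>'\<close> is defined, it
      equals that of \<open>\<omega>\<close>, so one class serves for the whole step.\<close>
    define \<omega> where "\<omega> = (if face \<sigma> \<sigma>' then \<sigma>' else \<sigma>)"
    have \<omega>: "\<omega> \<in> K" "face \<sigma> \<omega>" "face \<sigma>' \<omega>" "\<pi> \<omega> \<in> {\<pi> \<sigma>, \<pi> \<sigma>'}"
      using step face_refl by (auto simp: \<omega>_def)
    have \<pi>\<omega>: "face (\<pi> \<sigma>) (\<pi> \<omega>)" "face (\<pi> \<sigma>') (\<pi> \<omega>)"
      using \<pi>(2) \<omega> step by auto
    have adj: "face (\<pi> \<sigma>) (\<pi> \<sigma>') \<or> face (\<pi> \<sigma>') (\<pi> \<sigma>)"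
      using \<pi>(2) step by auto
    have b'\<omega>: "b' \<tau> \<rho> = b' \<tau> \<omega>" if "face \<tau> (\<pi> \<rho>)" "\<rho> \<in> {\<sigma>, \<sigma>'}" "\<tau> \<in> T" for \<tau> \<rho>
      using that b(2)[of \<tau> \<rho> \<omega>] \<omega> step face_trans[OF that(1)] \<pi>\<omega> by (auto simp: b'_def)
    \<comment> \<open>The projections of the two cells are neighbours in the order, so only at one
      of these two cells can the value change.\<close>
    have move: "face \<tau> (\<pi> \<omega>)" if "\<tau> \<in> T" "c \<tau> (\<pi> \<sigma>') \<noteq> c \<tau> (\<pi> \<sigma>)" for \<tau>
    proof -
      have "\<tau> = \<pi> \<sigma> \<or> \<tau> = \<pi> \<sigma>'"
        using that adj no_cell_between[OF \<pi>(1) \<pi>(1) that(1)] midpoint_of_inj[OF that(1) \<pi>(1)] step(1,2)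
        unfolding c_def by (metis linorder_less_linear linorder_not_le)
      then show ?thesis using \<pi>\<omega> by auto
    qed
    \<comment> \<open>The indicator differs at two neighbouring cells only if one of them is
      \<open>\<pi> \<rho>\<close>, the last cell at which it is 1.\<close>
    have jump: "face \<tau> (\<pi> \<rho>)" if "\<tau> \<in> T" "\<tau>' \<in> T" "face \<tau> \<tau>'" "\<rho> \<in> K" "c \<tau>' (\<pi> \<rho>) \<noteq> c \<tau> (\<pi> \<rho>)" for \<tau> \<tau>' \<rho>
    proof -
      have "\<pi> \<rho> = \<tau> \<or> \<pi> \<rho> = \<tau>'"
        using that(5) no_cell_between[OF that(1,2) \<pi>(1)[OF that(4)] that(3)]
          midpoint_of_inj[OF \<pi>(1)[OF that(4)] that(1)] midpoint_of_inj[OF \<pi>(1)[OF that(4)] that(2)]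
        unfolding c_def by (metis linorder_less_linear linorder_not_le)
      then show ?thesis using that(3) face_refl by auto
    qed
    \<comment> \<open>The coefficient is 1 at the cell that a forward step enters, -1 at the cell
      that a backward step leaves, and 0 everywhere else. This is the signed count of
      crossings.\<close>
    define s' where "s' \<tau> = s \<tau> \<oplus>\<^bsub>stalk F \<tau>\<^esub> (c \<tau> (\<pi> \<sigma>') \<ominus>\<^bsub>R\<^esub> c \<tau> (\<pi> \<sigma>)) \<odot>\<^bsub>stalk F \<tau>\<^esub> b' \<tau> \<omega>" for \<tau>
    have "Inv \<sigma>' s'"
      unfolding Inv_def
    proof (intro conjI ballI impI)
      fix \<tau> assume \<tau>: "\<tau> \<in> T"
      interpret M: Module.module R "stalk F \<tau>" by (rule mod[OF \<tau>])
      note [simp] = s(1)[OF \<tau>] b'c[OF \<tau> \<omega>(1)]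
      show "s' \<tau> \<in> carrier (stalk F \<tau>)" by (simp add: s'_def)
      have "e \<tau> (s' \<tau>) = c \<tau> (\<pi> \<sigma>) \<oplus>\<^bsub>R\<^esub> (c \<tau> (\<pi> \<sigma>') \<ominus>\<^bsub>R\<^esub> c \<tau> (\<pi> \<sigma>)) \<otimes>\<^bsub>R\<^esub> e \<tau> (b' \<tau> \<omega>)"
        using linear_maps_add[OF lin[OF \<tau>]] linear_maps_smult[OF lin[OF \<tau>]] s(2)[OF \<tau>] by (simp add: s'_def)
      also have "\<dots> = c \<tau> (\<pi> \<sigma>')"
      proof (cases "c \<tau> (\<pi> \<sigma>') = c \<tau> (\<pi> \<sigma>)")
        case True
        then show ?thesis
          using linear_maps_closed[OF lin[OF \<tau>], of "b' \<tau> \<omega>"] by (simp add: R.minus_eq R.r_neg)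
      next
        case False
        then show ?thesis
          using eb[OF \<tau> \<omega>(1)] move[OF \<tau>] R.add_minus_cancel(1) by (simp add: b'_def)
      qed
      finally show "e \<tau> (s' \<tau>) = c \<tau> (\<pi> \<sigma>')" .
      fix \<tau>' assume \<tau>': "\<tau>' \<in> T" "face \<tau> \<tau>'"
      let ?X = "b' \<tau> \<omega>"
      define d where "d = c \<tau>' (\<pi> \<sigma>) \<ominus>\<^bsub>R\<^esub> c \<tau> (\<pi> \<sigma>)"
      define d' where "d' = c \<tau>' (\<pi> \<sigma>') \<ominus>\<^bsub>R\<^esub> c \<tau> (\<pi> \<sigma>')"
      define u where "u = c \<tau> (\<pi> \<sigma>') \<ominus>\<^bsub>R\<^esub> c \<tau> (\<pi> \<sigma>)"
      define u' where "u' = c \<tau>' (\<pi> \<sigma>') \<ominus>\<^bsub>R\<^esub> c \<tau>' (\<pi> \<sigma>)"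
      have [simp]: "d \<in> carrier R" "d' \<in> carrier R" "u \<in> carrier R" "u' \<in> carrier R"
        by (simp_all add: d_def d'_def u_def u'_def)
      \<comment> \<open>Both sides are \<open>c \<tau>' (\<pi> \<sigma>')\<close> minus
        \<open>c \<tau> (\<pi> \<sigma>)\<close>, computed along the two ways around a
        square.\<close>
      have sq: "d \<oplus>\<^bsub>R\<^esub> u' = u \<oplus>\<^bsub>R\<^esub> d'"
        by (auto simp: d_def d'_def u_def u'_def c_def R.minus_eq R.r_neg R.l_neg)
      \<comment> \<open>In \<open>jmp\<close> and \<open>mov\<close>, either the coefficient
        vanishes or the classes are defined and agree. So every correction term becomes a multiple
        of the one vector \<open>?X\<close>.\<close>
      have jmp: "(c \<tau>' (\<pi> \<rho>) \<ominus>\<^bsub>R\<^esub> c \<tau> (\<pi> \<rho>)) \<odot>\<^bsub>stalk F \<tau>\<^esub> b' \<tau> \<rho> = (c \<tau>' (\<pi> \<rho>) \<ominus>\<^bsub>R\<^esub> c \<tau> (\<pi> \<rho>)) \<odot>\<^bsub>stalk F \<tau>\<^esub> ?X"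
        if \<rho>: "\<rho> \<in> {\<sigma>, \<sigma>'}" for \<rho>
      proof (cases "c \<tau>' (\<pi> \<rho>) = c \<tau> (\<pi> \<rho>)")
        case True
        then show ?thesis using b'c[OF \<tau>, of \<rho>] \<rho> step(1,2) by (auto simp: R.minus_eq R.r_neg)
      next
        case False
        then show ?thesis using b'\<omega>[OF jump[OF \<tau> \<tau>'] \<rho> \<tau>] \<rho> step(1,2) by auto
      qed
      have mov: "u' \<odot>\<^bsub>stalk F \<tau>\<^esub> ext_map F \<tau>' \<tau> (b' \<tau>' \<omega>) = u' \<odot>\<^bsub>stalk F \<tau>\<^esub> ?X"
      proof (cases "c \<tau>' (\<pi> \<sigma>') = c \<tau>' (\<pi> \<sigma>)")
        case True
        then show ?thesis
          using linear_maps_closed[OF ext[OF \<tau> \<tau>'] b'c[OF \<tau>'(1) \<omega>(1)]] by (simp add: u'_def R.minus_eq R.r_neg)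
      next
        case False
        then have "face \<tau>' (\<pi> \<omega>)" by (rule move[OF \<tau>'(1)])
        then show ?thesis
          using b(3)[OF \<tau> \<tau>'(1) \<omega>(1) \<tau>'(2)] face_trans[OF \<tau>'(2)] by (simp add: b'_def)
      qed
      have "ext_map F \<tau>' \<tau> (s' \<tau>') = ext_map F \<tau>' \<tau> (s \<tau>') \<oplus>\<^bsub>stalk F \<tau>\<^esub> u' \<odot>\<^bsub>stalk F \<tau>\<^esub> ext_map F \<tau>' \<tau> (b' \<tau>' \<omega>)"
        using linear_maps_add[OF ext[OF \<tau> \<tau>']] linear_maps_smult[OF ext[OF \<tau> \<tau>']] s(1)[OF \<tau>'(1)]
          b'c[OF \<tau>'(1) \<omega>(1)] Module.module.smult_closed[OF mod[OF \<tau>'(1)], of u' "b' \<tau>' \<omega>"]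
        by (simp add: s'_def flip: u'_def)
      also have "\<dots> = (s \<tau> \<oplus>\<^bsub>stalk F \<tau>\<^esub> d \<odot>\<^bsub>stalk F \<tau>\<^esub> ?X) \<oplus>\<^bsub>stalk F \<tau>\<^esub> u' \<odot>\<^bsub>stalk F \<tau>\<^esub> ?X"
        using s(3)[OF \<tau> \<tau>'] jmp[of \<sigma>] mov by (simp flip: d_def)
      also have "\<dots> = s \<tau> \<oplus>\<^bsub>stalk F \<tau>\<^esub> (d \<oplus>\<^bsub>R\<^esub> u') \<odot>\<^bsub>stalk F \<tau>\<^esub> ?X"
        by (simp add: M.smult_l_distr M.M.a_assoc)
      also have "\<dots> = (s \<tau> \<oplus>\<^bsub>stalk F \<tau>\<^esub> u \<odot>\<^bsub>stalk F \<tau>\<^esub> ?X) \<oplus>\<^bsub>stalk F \<tau>\<^esub> d' \<odot>\<^bsub>stalk F \<tau>\<^esub> ?X"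
        unfolding sq by (simp add: M.smult_l_distr M.M.a_assoc)
      also have "\<dots> = s' \<tau> \<oplus>\<^bsub>stalk F \<tau>\<^esub> d' \<odot>\<^bsub>stalk F \<tau>\<^esub> b' \<tau> \<sigma>'"
        using jmp[of \<sigma>'] by (simp add: s'_def d'_def u_def)
      finally show "ext_map F \<tau>' \<tau> (s' \<tau>') =
          s' \<tau> \<oplus>\<^bsub>stalk F \<tau>\<^esub> (c \<tau>' (\<pi> \<sigma>') \<ominus>\<^bsub>R\<^esub> c \<tau> (\<pi> \<sigma>')) \<odot>\<^bsub>stalk F \<tau>\<^esub> b' \<tau> \<sigma>'"
        by (simp only: d'_def)
    qed
    then show ?case by blast
  qed (use K in auto)
  then obtain s where s: "Inv \<sigma>\<^sub>1 s" by blast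
  have "\<pi> \<sigma>\<^sub>1 = {1}"
    by (rule endpoint_cell[OF \<pi>(1)[OF \<sigma>\<^sub>1(1)] \<sigma>\<^sub>1(2)]) simp
  then have c1: "c \<tau> (\<pi> \<sigma>\<^sub>1) = \<one>\<^bsub>R\<^esub>" if "\<tau> \<in> T" for \<tau>
    using midpoint_of_bounds[OF that] by (simp add: c_def)
  have "ext_map F \<tau>' \<tau> (s \<tau>') = s \<tau>" if "\<tau> \<in> T" "\<tau>' \<in> T" "face \<tau> \<tau>'" for \<tau> \<tau>'
  proof -
    interpret M: Module.module R "stalk F \<tau>" by (rule mod[OF that(1)])
    show ?thesis
      using s that c1 b'c[OF that(1) \<sigma>\<^sub>1(1)] by (simp add: Inv_def R.minus_eq R.r_neg)
  qed
  then show ?thesis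
    using s c1 by (intro exI[of _ s]) (simp add: Inv_def cosheaf_section_def)
qed

end

section \<open>The constant cosheaf, its augmentation and the classes of single cells\<close>

lemma constant_cosheaf_simps:
  assumes "\<sigma> \<in> K"
  shows "stalk (constant_cosheaf R K) \<sigma> = regular_module R"
    and "\<tau> \<in> K \<Longrightarrow> ext_map (constant_cosheaf R K) \<tau> \<sigma> x = x"
  using assms by (simp_all add: constant_cosheaf_def)

lemma constant_cosheaf_cellular:
  fixes R :: "('k, 'm) ring_scheme"
  assumes "cring R"
  shows "cellular_cosheaf R K (constant_cosheaf R K)"
proof -
  have "(\<lambda>x. x) \<in> linear_maps R M M" for M :: "('k, 'c) module"
    by (simp add: linear_maps_def)
  moreover have "ext_map (constant_cosheaf R K) \<tau> \<sigma> = (\<lambda>x. x)" if "\<sigma> \<in> K" "\<tau> \<in> K" for \<sigma> \<tau>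
    using that by (simp add: constant_cosheaf_def)
  ultimately show ?thesis
    by (auto simp: cellular_cosheaf_def constant_cosheaf_simps(1) linear_maps_def
        intro: regular_module_module[OF assms])
qed

text \<open>All representatives of a class have the same coordinate sum, so the set below is a singleton.\<close>

definition augmentation ::
  "('k, 'm) ring_scheme \<Rightarrow> 'a set set \<Rightarrow> ('a set \<Rightarrow> 'k) set \<Rightarrow> 'k" where
  "augmentation R I X = the_elem ((\<lambda>x. finsum R x I) ` X)"

context
  fixes R :: "('k, 'm) ring_scheme" and K :: "'a::topological_space set set"
  assumes R: "cring R" and K: "finite K"
begin

interpretation R: cring R by (rule R)

interpretation cosheaf_colimits R K "constant_cosheaf R K"
  by unfold_locales (rule R constant_cosheaf_cellular[OF R])+

lemma constant_sum_carrier: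
  assumes "I \<subseteq> K"
  shows "x \<in> carrier (sumK I) \<longleftrightarrow> x \<in> (\<Pi>\<^sub>E i\<in>I. carrier R)"
proof -
  have "carrier (stalk (constant_cosheaf R K) i) = carrier R" if "i \<in> I" for i
    using that assms by (simp add: constant_cosheaf_simps(1) subset_iff)
  then show ?thesis
    using finite_subset[OF assms K] by (simp add: direct_sum_simps PiE_iff)
qed

lemma finsum_linear:
  assumes "I \<subseteq> K"
  shows "(\<lambda>x. finsum R x I) \<in> linear_maps R (sumK I) (regular_module R)"
proof (rule linear_mapsI)
  note I = finite_subset[OF assms K]
  have st: "stalk (constant_cosheaf R K) i = regular_module R" if "i \<in> I" for i
    using that assms by (simp add: constant_cosheaf_simps(1) subset_iff)
  fix x assume "x \<in> carrier (sumK I)"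
  then have x: "x \<in> I \<rightarrow> carrier R" using constant_sum_carrier[OF assms] by auto
  then show "finsum R x I \<in> carrier (regular_module R)" by (simp add: R.finsum_closed)
  show "finsum R (a \<odot>\<^bsub>sumK I\<^esub> x) I = a \<odot>\<^bsub>regular_module R\<^esub> finsum R x I" if "a \<in> carrier R" for a
    using x that I by (auto simp: direct_sum_simps st R.finsum_rdistr intro!: R.finsum_cong')
  fix y assume "y \<in> carrier (sumK I)"
  then have y: "y \<in> I \<rightarrow> carrier R" using constant_sum_carrier[OF assms] by auto
  have "finsum R (x \<oplus>\<^bsub>sumK I\<^esub> y) I = finsum R (\<lambda>i. x i \<oplus>\<^bsub>R\<^esub> y i) I"
    using x y by (intro R.finsum_cong') (auto simp: direct_sum_simps st)
  then show "finsum R (x \<oplus>\<^bsub>sumK I\<^esub> y) I = finsum R x I \<oplus>\<^bsub>regular_module R\<^esub> finsum R y I"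
    using R.finsum_addf[OF x y] by simp
qed

lemma finsum_gen:
  assumes "I \<subseteq> K" "\<sigma> \<in> I" "v \<in> carrier R"
  shows "finsum R (gen I \<sigma> v) I = v"
proof -
  have "finsum R (gen I \<sigma> v) I = finsum R (\<lambda>i. if \<sigma> = i then v else \<zero>\<^bsub>R\<^esub>) I"
    using assms by (intro R.finsum_cong') (auto simp: direct_sum_inj_def constant_cosheaf_simps(1) subset_iff)
  also have "\<dots> = v"
    using R.finsum_singleton[of \<sigma> I "\<lambda>_. v"] finite_subset[OF assms(1) K] assms by simp
  finally show ?thesis .
qed

text \<open>The extension maps are identities, so the coordinates of a generating relation add up to
  \<open>v - v\<close>.\<close>

lemma finsum_rel:
  assumes "I \<subseteq> K" "x \<in> rel I"
  shows "finsum R x I = \<zero>\<^bsub>R\<^esub>"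
proof -
  have "finsum R x I \<in> {\<zero>\<^bsub>R\<^esub>}"
  proof (rule rel_map[OF assms(1) finsum_linear[OF assms(1)] regular_module_module[OF R] _ assms(2)])
    interpret M: Module.module R "regular_module R" by (rule regular_module_module[OF R])
    show "submodule {\<zero>\<^bsub>R\<^esub>} R (regular_module R)"
      by (rule M.submoduleI) auto
    fix \<sigma> \<tau> v assume *: "\<sigma> \<in> I" "\<tau> \<in> I" "face \<sigma> \<tau>" "v \<in> carrier (stalk (constant_cosheaf R K) \<tau>)"
    then have K: "\<sigma> \<in> K" "\<tau> \<in> K" and v: "v \<in> carrier R"
      using assms(1) by (auto simp: constant_cosheaf_simps(1) subset_iff)
    show "finsum R (gen I \<tau> v) I \<ominus>\<^bsub>regular_module R\<^esub> finsum R (gen I \<sigma> (ext_map (constant_cosheaf R K) \<tau> \<sigma> v)) I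
        \<in> {\<zero>\<^bsub>R\<^esub>}"
      using finsum_gen[OF assms(1) *(1) v] finsum_gen[OF assms(1) *(2) v] v
      by (simp add: constant_cosheaf_simps(2)[OF K] R.minus_eq R.r_neg)
  qed
  then show ?thesis by simp
qed

lemma augmentation_clas:
  assumes "I \<subseteq> K" "x \<in> carrier (sumK I)"
  shows "augmentation R I (clas I x) = finsum R x I"
proof -
  note lin = finsum_linear[OF assms(1)] and mod = sum_module[OF assms(1)] regular_module_module[OF R]
  have "finsum R z I = finsum R x I" if z: "z \<in> clas I x" for z
  proof -
    note z' = submodule_coset_memD[OF mod(1) rel_submodule[OF assms(1)] assms(2) z]
    have "finsum R z I \<ominus>\<^bsub>R\<^esub> finsum R x I = \<zero>\<^bsub>R\<^esub>"
      using finsum_rel[OF assms(1) z'(2)] linear_maps_diff[OF lin mod z'(1) assms(2)] by simp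
    then show ?thesis
      using R.add_minus_cancel(1)[of "finsum R x I" "finsum R z I"]
        linear_maps_closed[OF lin z'(1)] linear_maps_closed[OF lin assms(2)] by simp
  qed
  then have "(\<lambda>z. finsum R z I) ` clas I x = (\<lambda>_. finsum R x I) ` clas I x"
    by (rule image_cong[OF refl])
  also have "\<dots> = {finsum R x I}"
    by (rule image_constant[OF submodule_coset_self[OF mod(1) rel_submodule[OF assms(1)] assms(2)]])
  finally have "(\<lambda>z. finsum R z I) ` clas I x = {finsum R x I}" .
  then show ?thesis by (simp add: augmentation_def)
qed

lemma augmentation_linear:
  assumes "I \<subseteq> K"
  shows "augmentation R I \<in> linear_maps R (cosheaf_colimit R I (constant_cosheaf R K)) (regular_module R)"
  unfolding cosheaf_colimit_def
proof (rule linear_maps_quotientI[OF sum_module[OF assms] rel_submodule[OF assms]])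
  show "(\<lambda>x. augmentation R I (clas I x)) \<in> linear_maps R (sumK I) (regular_module R)"
    by (rule linear_maps_cong[OF finsum_linear[OF assms]])
      (simp_all add: augmentation_clas[OF assms] sum_module[OF assms])
qed

lemma finsum_extend:
  assumes "I \<subseteq> J" "J \<subseteq> K" "x \<in> carrier (sumK I)"
  shows "finsum R (ext_zero I J x) J = finsum R x I"
proof -
  have x: "x \<in> I \<rightarrow> carrier R"
    using assms constant_sum_carrier[of I] by auto
  have J: "finite J" by (rule finite_subset[OF assms(2) K])
  have "finsum R (ext_zero I J x) J = finsum R (\<lambda>\<sigma>. if \<sigma> \<in> I then x \<sigma> else \<zero>\<^bsub>R\<^esub>) J"
    using x assms(2) by (intro R.finsum_cong') (auto simp: constant_cosheaf_simps(1) subset_iff)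
  also have "\<dots> = finsum R (\<lambda>\<sigma>. if \<sigma> \<in> I then x \<sigma> else \<zero>\<^bsub>R\<^esub>) I"
    by (rule R.add.finprod_mono_neutral_cong_left[symmetric, OF J assms(1)]) (use x in auto)
  also have "\<dots> = finsum R x I"
    using x by (intro R.finsum_cong') auto
  finally show ?thesis .
qed

text \<open>The extension maps of the pushforward extend representatives by zero, which leaves the
  sum of the coordinates unchanged.\<close>

lemma augmentation_functional:
  assumes mono: "\<And>\<rho> \<tau>. \<rho> \<in> T \<Longrightarrow> \<tau> \<in> T \<Longrightarrow> face \<rho> \<tau> \<Longrightarrow> cells_over f K \<tau> \<subseteq> cells_over f K \<rho>"
  shows "cosheaf_functional R T (pushforward R f K (constant_cosheaf R K)) (\<lambda>\<tau>. augmentation R (cells_over f K \<tau>))"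
proof -
  have sub: "cells_over f K \<tau> \<subseteq> K" for \<tau> by (auto simp: cells_over_def)
  have "augmentation R (cells_over f K \<sigma>) (colimit_map R (cells_over f K \<tau>) (cells_over f K \<sigma>) (constant_cosheaf R K) X) =
      augmentation R (cells_over f K \<tau>) X"
    if "\<sigma> \<in> T" "\<tau> \<in> T" "face \<sigma> \<tau>" and X: "X \<in> carrier (cosheaf_colimit R (cells_over f K \<tau>) (constant_cosheaf R K))"
    for \<sigma> \<tau> X
  proof -
    note m = mono[OF that(1-3)]
    obtain x where x: "x \<in> carrier (sumK (cells_over f K \<tau>))" "X = clas (cells_over f K \<tau>) x"
      using X by (auto simp: colimit_carrier)
    show ?thesis
      using linear_maps_closed[OF extend_linear[OF m sub] x(1)]
      by (simp add: x(2) colimit_map_clas[OF m sub x(1)] augmentation_clas[OF sub] x(1) finsum_extend[OF m sub x(1)])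
  qed
  then show ?thesis
    unfolding cosheaf_functional_def pushforward_def using augmentation_linear[OF sub] by simp
qed

text \<open>The class of one cell with coefficient 1 plays the role of \<open>b\<close> in
  \<open>cosheaf_section_exists\<close>; the four parts are what is required of it there.\<close>

lemma clas_gen_one:
  assumes "I \<subseteq> K" "\<sigma> \<in> I"
  shows "clas I (gen I \<sigma> \<one>\<^bsub>R\<^esub>) \<in> carrier (cosheaf_colimit R I (constant_cosheaf R K))"
    and "augmentation R I (clas I (gen I \<sigma> \<one>\<^bsub>R\<^esub>)) = \<one>\<^bsub>R\<^esub>"
    and "\<tau> \<in> I \<Longrightarrow> face \<sigma> \<tau> \<Longrightarrow> clas I (gen I \<sigma> \<one>\<^bsub>R\<^esub>) = clas I (gen I \<tau> \<one>\<^bsub>R\<^esub>)"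
    and "I \<subseteq> J \<Longrightarrow> J \<subseteq> K \<Longrightarrow>
      colimit_map R I J (constant_cosheaf R K) (clas I (gen I \<sigma> \<one>\<^bsub>R\<^esub>)) = clas J (gen J \<sigma> \<one>\<^bsub>R\<^esub>)"
proof -
  have one: "\<one>\<^bsub>R\<^esub> \<in> carrier (stalk (constant_cosheaf R K) \<tau>)" if "\<tau> \<in> I" for \<tau>
    using that assms(1) by (simp add: constant_cosheaf_simps(1) subset_iff)
  have gen: "gen I \<sigma> \<one>\<^bsub>R\<^esub> \<in> carrier (sumK I)"
    by (rule gen_closed[OF assms(1) one[OF assms(2)]])
  show "clas I (gen I \<sigma> \<one>\<^bsub>R\<^esub>) \<in> carrier (cosheaf_colimit R I (constant_cosheaf R K))"
    using gen by (simp add: colimit_carrier)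
  show "augmentation R I (clas I (gen I \<sigma> \<one>\<^bsub>R\<^esub>)) = \<one>\<^bsub>R\<^esub>"
    using augmentation_clas[OF assms(1) gen] finsum_gen[OF assms] by simp
  show "clas I (gen I \<sigma> \<one>\<^bsub>R\<^esub>) = clas I (gen I \<tau> \<one>\<^bsub>R\<^esub>)" if "\<tau> \<in> I" "face \<sigma> \<tau>"
    using clas_gen[OF assms that one[OF that(1)]] assms that(1)
    by (simp add: constant_cosheaf_simps(2) subset_iff)
  show "colimit_map R I J (constant_cosheaf R K) (clas I (gen I \<sigma> \<one>\<^bsub>R\<^esub>)) = clas J (gen J \<sigma> \<one>\<^bsub>R\<^esub>)"
    if "I \<subseteq> J" "J \<subseteq> K"
    using colimit_map_clas[OF that gen] extend_gen[OF that(1) assms(2)] by simp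
qed

lemma pushforward_section_exists:
  assumes "{} \<notin> K" "connected (\<Union>K)" "interval_cell_structure T" and f: "continuous_on UNIV f"
    and frontier: "\<And>\<sigma> \<tau>. \<sigma> \<in> K \<Longrightarrow> \<tau> \<in> K \<Longrightarrow> \<sigma> \<inter> closure \<tau> \<noteq> {} \<Longrightarrow> face \<sigma> \<tau>"
    and fK: "\<And>\<sigma>. \<sigma> \<in> K \<Longrightarrow> f ` \<sigma> \<in> T" and "0 \<in> f ` \<Union>K" "1 \<in> f ` \<Union>K"
  shows "\<exists>s. cosheaf_section T (pushforward R f K (constant_cosheaf R K)) s \<and>
           (\<forall>\<tau>\<in>T. augmentation R (cells_over f K \<tau>) (s \<tau>) = \<one>\<^bsub>R\<^esub>)"
proof -
  have mono: "cells_over f K \<tau> \<subseteq> cells_over f K \<rho>" if "face \<rho> \<tau>" for \<rho> \<tau>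
    using face_trans[OF that] by (auto simp: cells_over_def)
  have sub: "cells_over f K \<tau> \<subseteq> K" for \<tau> by (auto simp: cells_over_def)
  have over: "\<sigma> \<in> cells_over f K \<tau>" if "\<sigma> \<in> K" "face \<tau> (f ` \<sigma>)" for \<sigma> \<tau>
    using that by (simp add: cells_over_def)
  obtain \<sigma>\<^sub>0 \<sigma>\<^sub>1 where \<sigma>: "\<sigma>\<^sub>0 \<in> K" "0 \<in> f ` \<sigma>\<^sub>0" "\<sigma>\<^sub>1 \<in> K" "1 \<in> f ` \<sigma>\<^sub>1"
    using assms(7,8) by auto
  show ?thesis
  proof (rule cosheaf_section_exists[OF assms(3) R pushforward_cosheaf[OF mono] K assms(2,1) frontier,
        where \<pi> = "(`) f" and b = "\<lambda>\<tau> \<sigma>. clas (cells_over f K \<tau>) (gen (cells_over f K \<tau>) \<sigma> \<one>\<^bsub>R\<^esub>)"])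
    fix \<tau> \<sigma> assume \<tau>: "\<tau> \<in> T" and \<sigma>: "\<sigma> \<in> K" and face: "face \<tau> (f ` \<sigma>)"
    show "clas (cells_over f K \<tau>) (gen (cells_over f K \<tau>) \<sigma> \<one>\<^bsub>R\<^esub>)
        \<in> carrier (stalk (pushforward R f K (constant_cosheaf R K)) \<tau>)"
      using clas_gen_one(1)[OF sub over[OF \<sigma> face]] by (simp add: pushforward_def)
    show "augmentation R (cells_over f K \<tau>) (clas (cells_over f K \<tau>) (gen (cells_over f K \<tau>) \<sigma> \<one>\<^bsub>R\<^esub>)) = \<one>\<^bsub>R\<^esub>"
      by (rule clas_gen_one(2)[OF sub over[OF \<sigma> face]])
    show "clas (cells_over f K \<tau>) (gen (cells_over f K \<tau>) \<sigma> \<one>\<^bsub>R\<^esub>) =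
        clas (cells_over f K \<tau>) (gen (cells_over f K \<tau>) \<sigma>' \<one>\<^bsub>R\<^esub>)" if "\<sigma>' \<in> K" "face \<sigma> \<sigma>'" for \<sigma>'
      \<comment> \<open>A coface of a cell over \<open>\<tau>\<close> also lies over
        \<open>\<tau>\<close>, since \<open>f\<close> preserves faces. So the relation that
        identifies the two classes is available in this stalk.\<close>
      using clas_gen_one(3)[OF sub over[OF \<sigma> face] over[OF that(1) face_trans[OF face face_image[OF f that(2)]]] that(2)] .
    show "ext_map (pushforward R f K (constant_cosheaf R K)) \<tau> \<rho>
        (clas (cells_over f K \<tau>) (gen (cells_over f K \<tau>) \<sigma> \<one>\<^bsub>R\<^esub>)) =
        clas (cells_over f K \<rho>) (gen (cells_over f K \<rho>) \<sigma> \<one>\<^bsub>R\<^esub>)" if "face \<rho> \<tau>" for \<rho>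
      using clas_gen_one(4)[OF sub over[OF \<sigma> face] mono[OF that] sub] by (simp add: pushforward_def)
  qed (use \<sigma> fK face_image[OF f] augmentation_functional[OF mono] in auto)
qed

text \<open>Every stalk is by construction a quotient of the free module on the cells over
  \<open>\<tau>\<close>, of which there are at most \<open>card K\<close>.\<close>

lemma pushforward_sum_length_le:
  assumes "field R" "finite T"
    and mono: "\<And>\<rho> \<tau>. \<rho> \<in> T \<Longrightarrow> \<tau> \<in> T \<Longrightarrow> face \<rho> \<tau> \<Longrightarrow> cells_over f K \<tau> \<subseteq> cells_over f K \<rho>"
    and G: "\<And>i. i < n \<Longrightarrow> cellular_cosheaf R T (G i)" "\<And>i. i < n \<Longrightarrow> \<not> zero_cosheaf T (G i)"
    and iso: "cosheaf_iso R T (pushforward R f K (constant_cosheaf R K)) (cosheaf_sum {..<n} G)"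
  shows "n \<le> card T * card K"
proof (rule cosheaf_sum_length_le[OF assms(1,2) pushforward_cosheaf[OF mono]])
  have sub: "cells_over f K \<tau> \<subseteq> K" for \<tau> by (auto simp: cells_over_def)
  fix \<tau>
  show "finite (cells_over f K \<tau>)" "card (cells_over f K \<tau>) \<le> card K"
    using finite_subset[OF sub K] card_mono[OF K sub] by auto
  show "stalk (constant_cosheaf R K) \<sigma> = regular_module R" if "\<sigma> \<in> cells_over f K \<tau>" for \<sigma>
    using that by (simp add: cells_over_def constant_cosheaf_simps(1))
  show "(\<lambda>x. clas (cells_over f K \<tau>) x) \<in>
      linear_maps R (sumK (cells_over f K \<tau>)) (stalk (pushforward R f K (constant_cosheaf R K)) \<tau>)"
    using clas_linear[OF sub] by (simp add: pushforward_def)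
  show "carrier (stalk (pushforward R f K (constant_cosheaf R K)) \<tau>) \<subseteq>
      (\<lambda>x. clas (cells_over f K \<tau>) x) ` carrier (sumK (cells_over f K \<tau>))"
    by (simp add: pushforward_def colimit_carrier)
qed (use G iso in auto)

end

text \<open>The universal part leaves the type \<open>'w\<close> of the summands open. The existence
  part, in the type of the pushforward itself, shows that the universal part is not vacuous.\<close>

theorem proposition10p3p1:
  fixes R :: "('k, 'm) ring_scheme"
    and D :: "'a::euclidean_space set"
    and S E :: "('a \<times> real) set"
    and C K :: "('a \<times> real) set set"
    and T :: "real set set"
  assumes "field R"
    and "S \<subseteq> D \<times> {0..1}"
    and "E = evasion_region D S"
    and "cell_structure (D \<times> {0..1}) C"
    and "K \<subseteq> C" "finite K" "E = \<Union>K"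
    and "interval_cell_structure T"
    and "cellular_map K T snd"
    and "compact E"
    and "connected E"
    and "snd ` E = {0..1}"
  shows "(\<exists>n (G :: nat \<Rightarrow> (real set, 'k, (('a \<times> real) set \<Rightarrow> 'k) set) cosheaf).
            remak_decomposition R T (pushforward R snd K (constant_cosheaf R K)) n G) \<and>
         (\<forall>n (G :: nat \<Rightarrow> (real set, 'k, 'w) cosheaf).
            remak_decomposition R T (pushforward R snd K (constant_cosheaf R K)) n G \<longrightarrow>
            (\<exists>i<n. is_barcode R T (G i) \<and> cosheaf_support T (G i) = {0..1}))"
proof -
  let ?F = "pushforward R snd K (constant_cosheaf R K)"
  let ?e = "\<lambda>\<tau>. augmentation R (cells_over snd K \<tau>)"
  interpret R: field R by fact
  note cring = R.is_cring
  interpret cosheaf_colimits R K "constant_cosheaf R K"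
    by unfold_locales (rule cring constant_cosheaf_cellular[OF cring])+
  have cont: "continuous_on UNIV (snd :: 'a \<times> real \<Rightarrow> real)"
    by (intro continuous_intros)
  have neK: "{} \<notin> K"
    using assms(4,5) by (auto simp: cell_structure_def partition_on_def)
  have frontierK: "face \<sigma> \<tau>" if "\<sigma> \<in> K" "\<tau> \<in> K" "\<sigma> \<inter> closure \<tau> \<noteq> {}" for \<sigma> \<tau>
    using cell_structure_frontier[OF assms(4)] assms(5) that by blast
  have sndK: "snd ` \<sigma> \<in> T" if "\<sigma> \<in> K" for \<sigma>
    using assms(9) that by (simp add: cellular_map_def)
  have finT: "finite T" and cellT: "cell_structure {0..1} T"
    using assms(8) by (simp_all add: interval_cell_structure_def)
  note frontierT = cell_structure_frontier[OF cellT]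
  note UT = interval_cells_Union[OF assms(8)] and neT = interval_cells_nonempty[OF assms(8)]
  have connT: "connected (\<Union>T)" unfolding UT by simp
  have mono: "cells_over snd K \<tau> \<subseteq> cells_over snd K \<rho>" if "face \<rho> \<tau>" for \<rho> \<tau>
    using face_trans[OF that] by (auto simp: cells_over_def)
  have F: "cellular_cosheaf R T ?F"
    by (rule pushforward_cosheaf[OF mono])
  have e: "cosheaf_functional R T ?F ?e"
    by (rule augmentation_functional[OF cring assms(6) mono])
  have "connected (\<Union>K)" "0 \<in> snd ` \<Union>K" "1 \<in> snd ` \<Union>K"
    using assms(7,11,12) by auto
  then obtain s where s: "cosheaf_section T ?F s" "\<And>\<tau>. \<tau> \<in> T \<Longrightarrow> ?e \<tau> (s \<tau>) = \<one>\<^bsub>R\<^esub>"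
    using pushforward_section_exists[OF cring assms(6) neK _ assms(8) cont frontierK sndK] by blast
  obtain \<tau>\<^sub>0 where \<tau>\<^sub>0: "\<tau>\<^sub>0 \<in> T" using UT by fastforce
  have e0: "?e \<tau>\<^sub>0 \<zero>\<^bsub>stalk ?F \<tau>\<^sub>0\<^esub> = \<zero>\<^bsub>R\<^esub>"
    using linear_maps_zero[OF _ cellular_cosheafD(1)[OF F \<tau>\<^sub>0] regular_module_module[OF cring]] e \<tau>\<^sub>0
    by (simp add: cosheaf_functional_def)
  \<comment> \<open>The functional takes \<open>s\<close> to 1, which is not zero in a field. So the
    pushforward is nonzero and counts as a decomposition with one summand.\<close>
  have "s \<tau>\<^sub>0 \<in> carrier (stalk ?F \<tau>\<^sub>0)" "s \<tau>\<^sub>0 \<noteq> \<zero>\<^bsub>stalk ?F \<tau>\<^sub>0\<^esub>"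
    using s(1) s(2)[OF \<tau>\<^sub>0] e0 \<tau>\<^sub>0 R.one_not_zero by (auto simp: cosheaf_section_def)
  then have "\<not> zero_cosheaf T ?F"
    using \<tau>\<^sub>0 by (auto simp: zero_cosheaf_def)
  then have "\<exists>n (G :: nat \<Rightarrow> (real set, 'k, (('a \<times> real) set \<Rightarrow> 'k) set) cosheaf). remak_decomposition R T ?F n G"
    by (rule remak_decomposition_exists[OF F])
      (rule pushforward_sum_length_le[OF cring assms(6,1) finT mono])
  moreover have "\<exists>i<n. is_barcode R T (G i) \<and> cosheaf_support T (G i) = {0..1}"
    if remak: "remak_decomposition R T ?F n G" for n and G :: "nat \<Rightarrow> (real set, 'k, 'w) cosheaf"
  proof -
    have indec: "indecomposable R T (G i)" if "i < n" for i
      using remak that by (simp add: remak_decomposition_def)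
    have "?e \<tau>\<^sub>0 (s \<tau>\<^sub>0) \<noteq> \<zero>\<^bsub>R\<^esub>"
      using s(2)[OF \<tau>\<^sub>0] by simp
    then obtain i s' e' where i: "i \<in> {..<n}" and s': "cosheaf_section T (G i) s'"
      and e': "cosheaf_functional R T (G i) e'" and ne: "e' \<tau>\<^sub>0 (s' \<tau>\<^sub>0) \<noteq> \<zero>\<^bsub>R\<^esub>"
      using cosheaf_sum_section_functional[OF cring _ F _ _ s(1) e \<tau>\<^sub>0, of "{..<n}" G] remak indec
      unfolding remak_decomposition_def indecomposable_def by blast
    \<comment> \<open>The composite through the chosen summand is the same nonzero scalar at every
      cell; it is the unit \<open>c\<close> of \<open>indecomposable_constant\<close>.\<close>
    have "e' \<sigma> (s' \<sigma>) = e' \<tau>\<^sub>0 (s' \<tau>\<^sub>0)" if "\<sigma> \<in> T" for \<sigma>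
      by (rule cosheaf_section_functional_const[OF finT connT neT frontierT s' e' \<tau>\<^sub>0 that])
    note const = indecomposable_constant[OF assms(1) indec s' e' this ne]
    have "cosheaf_iso R T (G i) (constant_cosheaf R T)" "T \<noteq> {}"
      using const(1) i \<tau>\<^sub>0 by auto
    then have "is_barcode R T (G i)"
      using connT unfolding is_barcode_def by blast
    moreover have "{\<sigma> \<in> T. carrier (stalk (G i) \<sigma>) \<noteq> {\<zero>\<^bsub>stalk (G i) \<sigma>\<^esub>}} = T"
      using const(2) i \<tau>\<^sub>0 by auto
    then have "cosheaf_support T (G i) = {0..1}"
      using UT by (simp add: cosheaf_support_def)
    ultimately show ?thesis using i by auto
  qed
  ultimately show ?thesis by blast
qed

end
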